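(* Let $\boldsymbol{x}_t$ and $\boldsymbol{x}^{[N]}_t$, $t\in[0,T]$, be the systems $$d\boldsymbol{x}_t=(\mathbb{A}\boldsymbol{x}_t+\mathbb{B}\boldsymbol{u}_t)dt+d\boldsymbol{w}_t,\qquad d\boldsymbol{x}^{[N]}_t=(\mathbb{A}^{[N]}\boldsymbol{x}^{[N]}_t+\mathbb{B}^{[N]}\boldsymbol{u}^{[N]}_t)dt+d\boldsymbol{w}^{[N]}_t,$$ where $\mathbb{A}^{[N]}\to\mathbb{A}$, $\mathbb{B}^{[N]}\to\mathbb{B}$ and $\mathbf{Q}^{[N]}\to\mathbf{Q}$ in the $L_2[0,1]$ operator norm. Assume that for each triple $\epsilon_0,\epsilon_1,\epsilon_2>0$ there exists $N_0$ such that for all $N>M>N_0$ (and all $0\le s\le t\le T$) $$\|\boldsymbol{x}^{[N]}_0-\boldsymbol{x}^{[M]}_0\|_2^2<\epsilon_0,\qquad \|\Phi^{[N]}(t,s)-\Phi^{[M]}(t,s)\|_{\mathrm{op}}^2<\epsilon_1,\qquad \mathbb{E}\big[\|\boldsymbol{w}^{[N]}_t-\boldsymbol{w}^{[M]}_t\|_2^2\big]<\epsilon_2,$$ and that there exist $\alpha,C<\infty$ such that, for all $N$, $\sum_{k=1}^N\sum_{r=1}^N|c^N_{k,r}|^2\le C$ and $\int_0^t\|\Phi^{[N]}(t,s)\|_{\mathrm{op}}^2ds\le\alpha$ for $t\in[0,T]$. In addition, let $\mathbb{R}^{[N]},\mathbb{M}^{[N]},\mathbb{M}^{[N]}_T$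 be bounded, positive, self-adjoint operators on $L_2[0,1]$ converging to $\mathbb{R},\mathbb{M},\mathbb{M}_T$ in operator norm. Let $S_t$ and $S^{[N]}_t$ be the positive, bounded, self-adjoint operators solving the Riccati equation $$-\frac{d}{dt}\langle S_t\boldsymbol{v},\boldsymbol{v}\rangle=2\langle\mathbb{A}\boldsymbol{v},S_t\boldsymbol{v}\rangle-\langle S_t\mathbb{B}\mathbb{R}^{-1}\mathbb{B}^*S_t\boldsymbol{v},\boldsymbol{v}\rangle+\langle\mathbb{M}\boldsymbol{v},\boldsymbol{v}\rangle\quad\forall\boldsymbol{v}\in L_2[0,1],\qquad S_T=\mathbb{M}_T,$$ for the data $(\mathbb{A},\mathbb{B},\mathbb{R},\mathbb{M},\mathbb{M}_T)$ and $(\mathbb{A}^{[N]},\mathbb{B}^{[N]},\mathbb{R}^{[N]},\mathbb{M}^{[N]},\mathbb{M}^{[N]}_T)$ respectively, and let the systems be driven by the optimal controls $\boldsymbol{u}_t=-\mathbb{R}^{-1}\mathbb{B}^*S_t\boldsymbol{x}_t$ and $\boldsymbol{u}^{[N]}_t=-(\mathbb{R}^{[N]})^{-1}\mathbb{B}^{[N]*}S^{[N]}_t\boldsymbol{x}^{[N]}_t$. Then for every $\epsilon>0$ there exists $N(\epsilon)$ such that for all $N>N(\epsilon)$ (and $t\in[0,T]$) $$\mathbb{E}\big[\|\boldsymbol{x}^{[N]}_t-\boldsymbol{x}_t\|_2\big]<\epsilon.$$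
   Context: $\|\cdot\|_2$ and $\langle\cdot,\cdot\rangle$ are the norm and inner product of $L_2[0,1]$; $\|\cdot\|_{\mathrm{op}}$ is the operator norm on $L_2[0,1]$. $\mathbb{A}=\boldsymbol{A}+a\mathbb{I}$ and $\mathbb{B}=\boldsymbol{B}+b\mathbb{I}$ are bounded time-invariant operators on $L_2[0,1]$, where $\boldsymbol{A},\boldsymbol{B}$ are integral operators with bounded symmetric kernels on $[0,1]^2$ (graphons), $a,b\in\mathbb{R}$, $\mathbb{I}$ the identity. $\mathbb{A}^{[N]}=\boldsymbol{A}^{[N]}+a_N\mathbb{I}$ and $\mathbb{B}^{[N]}=\boldsymbol{B}^{[N]}+b_N\mathbb{I}$ have the same form with kernels that are constant on the cells $P_i\times P_j$, where $P_1=[0,\tfrac1N]$, $P_i=(\tfrac{i-1}N,\tfrac iN]$. The operators $\mathbb{R}$ and $\mathbb{R}^{[N]}$ are of the form (non-negative operator)$+r\mathbb{I}$ with $r>0$, in particular strictly positive and boundedly invertible; $\mathbb{M},\mathbb{M}_T$ are bounded, non-negative and self-adjoint. Noise: $\{W_r\}_{r\ge1}$ are independent standard Brownian motions (the same for all $N$), $c^N_{k,r}$ are real coefficients, and $\boldsymbol{w}^{[N]}_t(\alpha)=\sum_{k=1}^N\mathbf{1}_{P_k}(\alpha)\sum_{r=1}^\infty c^N_{k,r}W_r(t)$; its covariance is $\mathbb{E}[\boldsymbol{w}^{[N]}_t(\alpha)\boldsymbol{w}^{[N]}_s(\beta)]=\min(t,s)\mathbf{Q}^{[N]}(\alpha,\beta)$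 with $\mathbf{Q}^{[N]}$ constant on the cells $P_i\times P_j$. $\boldsymbol{w}_t$ is the mean-square $L_2[0,1]$ limit of $\boldsymbol{w}^{[N]}_t$, with covariance $\min(t,s)\mathbf{Q}(\alpha,\beta)$, and $\boldsymbol{x}_0\in L_2[0,1]$ is the limit of $\boldsymbol{x}^{[N]}_0\in L_2[0,1]$. $\Phi^{[N]}(t,s)$ is the solution operator of $\dot{\boldsymbol{y}}_t=\mathbb{A}^{[N]}\boldsymbol{y}_t$, i.e. $\Phi^{[N]}(t,s)=e^{\mathbb{A}^{[N]}(t-s)}$. Solutions of the stochastic equations are mild solutions: $\boldsymbol{x}_t=\Phi(t,0)\boldsymbol{x}_0+\int_0^t\Phi(t,s)\mathbb{B}\boldsymbol{u}_s\,ds+\int_0^t\Phi(t,s)\,d\boldsymbol{w}_s$ with $\Phi(t,s)=e^{\mathbb{A}(t-s)}$, and similarly for $\boldsymbol{x}^{[N]}_t$. The controls above are the minimizers of $J(\boldsymbol{u},\boldsymbol{x}_0)=\mathbb{E}\big[\int_0^T(\langle\boldsymbol{x}_t,\mathbb{M}\boldsymbol{x}_t\rangle+\langle\boldsymbol{u}_t,\mathbb{R}\boldsymbol{u}_t\rangle)dt+\langle\boldsymbol{x}_T,\mathbb{M}_T\boldsymbol{x}_T\rangle\big]$ over admissible controls, and of its analogue with index $[N]$. *)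

theory Defs
  imports "HOL-Probability.Probability"
begin

definition leb01 :: "real measure" where
  "leb01 = restrict_space lborel {0..1}"

lemma space_leb01 [simp]: "space leb01 = {0..1}"
  by (simp add: leb01_def space_restrict_space)

lemma sets_leb01: "sets leb01 = sets (restrict_space borel {0..1})"
  by (simp add: leb01_def sets_restrict_space)

lemma emeasure_space_leb01: "emeasure leb01 (space leb01) = 1"
  by (simp add: leb01_def space_restrict_space emeasure_restrict_space)

interpretation leb01: prob_space leb01
  by (rule prob_spaceI) (rule emeasure_space_leb01)

definition sq_int :: "(real \<Rightarrow> real) \<Rightarrow> bool" where
  "sq_int f \<longleftrightarrow> f \<in> borel_measurable leb01 \<and> integrable leb01 (\<lambda>x. (f x)\<^sup>2)"

lemma sq_int_measurable: "sq_int f \<Longrightarrow> f \<in> borel_measurable leb01"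
  by (simp add: sq_int_def)

lemma sq_int_mult:
  assumes f: "sq_int f" and g: "sq_int g"
  shows "integrable leb01 (\<lambda>x. f x * g x)"
proof (rule Bochner_Integration.integrable_bound[where f="\<lambda>x. (f x)\<^sup>2 + (g x)\<^sup>2"])
  show "integrable leb01 (\<lambda>x. (f x)\<^sup>2 + (g x)\<^sup>2)"
    using f g by (simp add: sq_int_def)
  show "(\<lambda>x. f x * g x) \<in> borel_measurable leb01"
    using f g by (auto simp: sq_int_def)
  have "\<bar>f x * g x\<bar> \<le> (f x)\<^sup>2 + (g x)\<^sup>2" for x
  proof -
    have "2 * (\<bar>f x\<bar> * \<bar>g x\<bar>) \<le> (f x)\<^sup>2 + (g x)\<^sup>2"
      using sum_squares_bound[of "\<bar>f x\<bar>" "\<bar>g x\<bar>"] by simp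
    moreover have "0 \<le> \<bar>f x\<bar> * \<bar>g x\<bar>" by simp
    ultimately show ?thesis unfolding abs_mult by linarith
  qed
  then show "AE x in leb01. norm (f x * g x) \<le> norm ((f x)\<^sup>2 + (g x)\<^sup>2)"
    by (intro AE_I2) simp
qed

lemma sq_int_integrable: "sq_int f \<Longrightarrow> integrable leb01 f"
  using sq_int_mult[of f "\<lambda>_. 1"] by (simp add: sq_int_def)

lemma sq_int_zero: "sq_int (\<lambda>_. 0)"
  by (simp add: sq_int_def)

lemma sq_int_scale: "sq_int f \<Longrightarrow> sq_int (\<lambda>x. c * f x)"
  by (auto simp: sq_int_def power_mult_distrib)

lemma sq_int_add:
  assumes "sq_int f" "sq_int g" shows "sq_int (\<lambda>x. f x + g x)"
proof -
  have "integrable leb01 (\<lambda>x. (f x)\<^sup>2 + 2 * (f x * g x) + (g x)\<^sup>2)"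
    using assms sq_int_mult[OF assms] by (auto simp: sq_int_def)
  moreover have "(\<lambda>x. (f x)\<^sup>2 + 2 * (f x * g x) + (g x)\<^sup>2) = (\<lambda>x. (f x + g x)\<^sup>2)"
    by (auto simp: power2_sum)
  ultimately show ?thesis using assms by (auto simp: sq_int_def)
qed

lemma sq_int_diff: "sq_int f \<Longrightarrow> sq_int g \<Longrightarrow> sq_int (\<lambda>x. f x - g x)"
  using sq_int_add[of f "\<lambda>x. (-1) * g x"] sq_int_scale[of g "-1"] by simp

lemma sq_int_bounded:
  assumes f: "f \<in> borel_measurable leb01" and B: "\<And>x. x \<in> {0..1} \<Longrightarrow> \<bar>f x\<bar> \<le> B"
  shows "sq_int f"
  unfolding sq_int_def
proof
  show "integrable leb01 (\<lambda>x. (f x)\<^sup>2)"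
  proof (rule leb01.integrable_const_bound[where B="B\<^sup>2"])
    have "(f x)\<^sup>2 \<le> B\<^sup>2" if "x \<in> {0..1}" for x
      using power_mono[OF B[OF that], of 2] by simp
    then show "AE x in leb01. norm ((f x)\<^sup>2) \<le> B\<^sup>2"
      by (intro AE_I2) simp
    show "(\<lambda>x. (f x)\<^sup>2) \<in> borel_measurable leb01" using f by measurable
  qed
qed (rule f)

definition l2_eq :: "(real \<Rightarrow> real) \<Rightarrow> (real \<Rightarrow> real) \<Rightarrow> bool" where
  "l2_eq f g \<longleftrightarrow> sq_int f \<and> sq_int g \<and> (AE x in leb01. f x = g x)"

quotient_type L2I = "real \<Rightarrow> real" / partial: l2_eq
proof (rule part_equivpI)
  show "\<exists>x. l2_eq x x" by (intro exI[of _ "\<lambda>_. 0"]) (simp add: l2_eq_def sq_int_zero)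
  show "symp l2_eq" by (auto simp: symp_def l2_eq_def)
  show "transp l2_eq" by (auto simp: transp_def l2_eq_def)
qed

lemma L2I_cases: obtains f where "sq_int f" "x = abs_L2I f"
proof -
  have "l2_eq (rep_L2I x) (rep_L2I x)"
    by (rule Quotient_rep_reflp[OF Quotient_L2I])
  moreover have "abs_L2I (rep_L2I x) = x"
    by (rule Quotient_abs_rep[OF Quotient_L2I])
  ultimately show ?thesis using that by (auto simp: l2_eq_def)
qed

lemma abs_rep_L2I [simp]: "abs_L2I (rep_L2I x) = x"
  by (rule Quotient_abs_rep[OF Quotient_L2I])

lemma sq_int_rep [simp]: "sq_int (rep_L2I x)"
  using Quotient_rep_reflp[OF Quotient_L2I, of x] by (simp add: l2_eq_def)

lemma abs_L2I_eq_iff: "sq_int f \<Longrightarrow> sq_int g \<Longrightarrow> abs_L2I f = abs_L2I g \<longleftrightarrow> (AE x in leb01. f x = g x)"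
  using Quotient_rel[OF Quotient_L2I, of f g] by (auto simp: l2_eq_def)

lemma rep_abs_L2I: "sq_int f \<Longrightarrow> AE x in leb01. rep_L2I (abs_L2I f) x = f x"
  by (subst abs_L2I_eq_iff[symmetric]) auto

instantiation L2I :: real_vector
begin

lift_definition zero_L2I :: L2I is "\<lambda>_. 0"
  by (simp add: l2_eq_def sq_int_zero)

lift_definition plus_L2I :: "L2I \<Rightarrow> L2I \<Rightarrow> L2I" is "\<lambda>f g x. f x + g x"
  by (auto simp: l2_eq_def sq_int_add)

lift_definition minus_L2I :: "L2I \<Rightarrow> L2I \<Rightarrow> L2I" is "\<lambda>f g x. f x - g x"
  by (auto simp: l2_eq_def sq_int_diff)

lift_definition uminus_L2I :: "L2I \<Rightarrow> L2I" is "\<lambda>f x. - f x"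
  using sq_int_scale[of _ "-1"] by (auto simp: l2_eq_def)

lift_definition scaleR_L2I :: "real \<Rightarrow> L2I \<Rightarrow> L2I" is "\<lambda>c f x. c * f x"
  by (auto simp: l2_eq_def sq_int_scale)

instance
proof
  fix x y z :: L2I and a b r :: real
  show "x + y + z = x + (y + z)"
    by transfer (auto simp: l2_eq_def add.assoc intro!: sq_int_add)
  show "x + y = y + x"
    by transfer (auto simp: l2_eq_def add.commute intro!: sq_int_add)
  show "0 + x = x" by transfer (auto simp: l2_eq_def)
  show "- x + x = 0" by transfer (auto simp: l2_eq_def sq_int_zero)
  show "x - y = x + - y"
    by transfer (auto simp: l2_eq_def intro!: sq_int_diff)
  show "a *\<^sub>R (x + y) = a *\<^sub>R x + a *\<^sub>R y"
    by transfer (auto simp: l2_eq_def algebra_simps intro!: sq_int_add sq_int_scale)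
  show "(a + b) *\<^sub>R x = a *\<^sub>R x + b *\<^sub>R x"
    by transfer (auto simp: l2_eq_def algebra_simps intro!: sq_int_add sq_int_scale)
  show "a *\<^sub>R b *\<^sub>R x = (a * b) *\<^sub>R x"
    by transfer (auto simp: l2_eq_def mult.assoc[symmetric] intro!: sq_int_scale)
  show "1 *\<^sub>R x = x" by transfer (auto simp: l2_eq_def)
qed

end

instantiation L2I :: real_inner
begin

lift_definition inner_L2I :: "L2I \<Rightarrow> L2I \<Rightarrow> real" is "\<lambda>f g. \<integral>x. f x * g x \<partial>leb01"
  by (intro integral_cong_AE) (auto simp: l2_eq_def sq_int_def)

definition norm_L2I :: "L2I \<Rightarrow> real" where "norm_L2I x = sqrt (inner x x)"
definition sgn_L2I :: "L2I \<Rightarrow> L2I" where "sgn_L2I x = x /\<^sub>R norm x"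
definition dist_L2I :: "L2I \<Rightarrow> L2I \<Rightarrow> real" where "dist_L2I x y = norm (x - y)"
definition uniformity_L2I :: "(L2I \<times> L2I) filter" where
  "uniformity_L2I = (INF e\<in>{0 <..}. principal {(x, y). dist x y < e})"
definition open_L2I :: "L2I set \<Rightarrow> bool" where
  "open_L2I U = (\<forall>x\<in>U. eventually (\<lambda>(x', y). x' = x \<longrightarrow> y \<in> U) uniformity)"

instance
proof
  fix x y z :: L2I and r :: real
  show "dist x y = norm (x - y)" by (rule dist_L2I_def)
  show "sgn x = x /\<^sub>R norm x" by (rule sgn_L2I_def)
  show "uniformity = (INF e\<in>{0 <..}. principal {(x::L2I, y). dist x y < e})"
    by (rule uniformity_L2I_def)
  show "open U = (\<forall>x\<in>U. eventually (\<lambda>(x', y). x' = x \<longrightarrow> y \<in> U) uniformity)" for U :: "L2I set"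
    by (rule open_L2I_def)
  show "inner x y = inner y x" by transfer (simp add: mult.commute)
  show "inner (x + y) z = inner x z + inner y z"
    by transfer (simp add: l2_eq_def distrib_right sq_int_mult)
  show "inner (r *\<^sub>R x) y = r * inner x y"
    by transfer (simp add: mult.assoc)
  show "0 \<le> inner x x"
    by transfer (simp add: integral_nonneg)
  show "(inner x x = 0) = (x = 0)"
  proof -
    obtain f where f: "sq_int f" and x: "x = abs_L2I f" by (rule L2I_cases)
    have "inner x x = (\<integral>x. f x * f x \<partial>leb01)"
      unfolding x by (rule inner_L2I.abs_eq) (use f in \<open>auto simp: l2_eq_def\<close>)
    moreover have "(\<integral>x. f x * f x \<partial>leb01) = 0 \<longleftrightarrow> (AE x in leb01. f x * f x = 0)"
      by (intro integral_nonneg_eq_0_iff_AE sq_int_mult f AE_I2) simp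
    moreover have "x = 0 \<longleftrightarrow> (AE x in leb01. f x = 0)"
      unfolding x zero_L2I_def by (rule abs_L2I_eq_iff[OF f sq_int_zero])
    ultimately show ?thesis by simp
  qed
  show "norm x = sqrt (inner x x)" by (rule norm_L2I_def)
qed

end

lemma abs_L2I_add: "sq_int f \<Longrightarrow> sq_int g \<Longrightarrow> abs_L2I f + abs_L2I g = abs_L2I (\<lambda>x. f x + g x)"
  by (rule plus_L2I.abs_eq) (auto simp: l2_eq_def)

lemma abs_L2I_diff: "sq_int f \<Longrightarrow> sq_int g \<Longrightarrow> abs_L2I f - abs_L2I g = abs_L2I (\<lambda>x. f x - g x)"
  by (rule minus_L2I.abs_eq) (auto simp: l2_eq_def)

lemma abs_L2I_scaleR: "sq_int f \<Longrightarrow> c *\<^sub>R abs_L2I f = abs_L2I (\<lambda>x. c * f x)"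
  by (rule scaleR_L2I.abs_eq) (auto simp: l2_eq_def)

lemma inner_abs_L2I:
  "sq_int f \<Longrightarrow> sq_int g \<Longrightarrow> inner (abs_L2I f) (abs_L2I g) = (\<integral>x. f x * g x \<partial>leb01)"
  by (rule inner_L2I.abs_eq) (auto simp: l2_eq_def)

lemma norm_abs_L2I: "sq_int f \<Longrightarrow> norm (abs_L2I f) = sqrt (\<integral>x. (f x)\<^sup>2 \<partial>leb01)"
  unfolding norm_L2I_def by (subst inner_abs_L2I) (simp_all add: power2_eq_square)

lemma nn_integral_sq_L2I:
  assumes "sq_int f"
  shows "(\<integral>\<^sup>+x. ennreal ((f x)\<^sup>2) \<partial>leb01) = ennreal ((norm (abs_L2I f))\<^sup>2)"
proof -
  have "0 \<le> (\<integral>x. (f x)\<^sup>2 \<partial>leb01)" by (rule Bochner_Integration.integral_nonneg) simp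
  then have "(norm (abs_L2I f))\<^sup>2 = (\<integral>x. (f x)\<^sup>2 \<partial>leb01)"
    unfolding norm_abs_L2I[OF assms] by (rule real_sqrt_pow2)
  then show ?thesis
    using assms by (simp add: nn_integral_eq_integral sq_int_def)
qed

lemma nn_integral_abs_le_norm:
  assumes "sq_int f"
  shows "(\<integral>\<^sup>+x. ennreal \<bar>f x\<bar> \<partial>leb01) \<le> ennreal (norm (abs_L2I f))"
proof -
  define I where "I = (\<integral>\<^sup>+x. ennreal \<bar>f x\<bar> \<partial>leb01)"
  have fm: "f \<in> borel_measurable leb01" using assms by (rule sq_int_measurable)
  have "(\<integral>\<^sup>+x. ennreal \<bar>f x\<bar> * 1 \<partial>leb01)\<^sup>2 \<le> (\<integral>\<^sup>+x. (ennreal \<bar>f x\<bar>)\<^sup>2 \<partial>leb01) * (\<integral>\<^sup>+x. 1\<^sup>2 \<partial>leb01)"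
    by (rule Cauchy_Schwarz_nn_integral) (use fm in measurable)
  also have "\<dots> = ennreal ((norm (abs_L2I f))\<^sup>2)"
    using leb01.emeasure_space_1
    by (simp add: nn_integral_sq_L2I[OF assms, symmetric] ennreal_power)
  finally have le: "I\<^sup>2 \<le> ennreal ((norm (abs_L2I f))\<^sup>2)"
    by (simp add: I_def)
  have "I \<le> ennreal (norm (abs_L2I f))"
  proof (cases I rule: ennreal_cases)
    case (real r)
    have "r\<^sup>2 \<le> (norm (abs_L2I f))\<^sup>2"
      using le real(1) unfolding real(2) by (simp add: ennreal_power del: power_mono_iff)
    then have "r \<le> norm (abs_L2I f)" by (rule power2_le_imp_le) simp
    then show ?thesis unfolding real(2) by (rule ennreal_leI)
  next
    case top
    then have "I\<^sup>2 = top" by (simp add: power2_eq_square)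
    then show ?thesis using le by (simp add: top_unique)
  qed
  then show ?thesis by (simp add: I_def)
qed

instance L2I :: complete_space
proof
  fix X :: "nat \<Rightarrow> L2I"
  assume X: "Cauchy X"
  have "\<exists>s. \<forall>n. (\<forall>i\<ge>s n. \<forall>j\<ge>s n. dist (X i) (X j) < (1/2)^n) \<and> s n < s (Suc n)"
  proof (rule dependent_nat_choice)
    show "\<exists>M. \<forall>i\<ge>M. \<forall>j\<ge>M. dist (X i) (X j) < (1/2)^0"
      using X[unfolded Cauchy_def, rule_format, of 1] by simp
    fix M :: nat and n
    obtain M' where "\<forall>i\<ge>M'. \<forall>j\<ge>M'. dist (X i) (X j) < (1/2)^Suc n"
      using X[unfolded Cauchy_def, rule_format, of "(1/2)^Suc n"] by auto
    then show "\<exists>y. (\<forall>i\<ge>y. \<forall>j\<ge>y. dist (X i) (X j) < (1/2)^Suc n) \<and> M < y"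
      by (intro exI[of _ "max M' (Suc M)"]) auto
  qed
  then obtain s where s: "\<And>n i j. i \<ge> s n \<Longrightarrow> j \<ge> s n \<Longrightarrow> dist (X i) (X j) < (1/2)^n"
    and mono: "\<And>n. s n < s (Suc n)" by blast
  have sm: "strict_mono s" using mono by (simp add: strict_mono_Suc_iff)
  define g where "g n = rep_L2I (X (s n))" for n
  have g[simp]: "sq_int (g n)" for n by (simp add: g_def)
  have gm[measurable]: "g n \<in> borel_measurable leb01" for n by (rule sq_int_measurable) simp
  have absg: "abs_L2I (g n) = X (s n)" for n by (simp add: g_def)
  have step: "(\<integral>\<^sup>+x. ennreal \<bar>g (Suc n) x - g n x\<bar> \<partial>leb01) \<le> ennreal ((1/2)^n)" for n
  proof -
    have "(\<integral>\<^sup>+x. ennreal \<bar>g (Suc n) x - g n x\<bar> \<partial>leb01) \<le> ennreal (norm (X (s (Suc n)) - X (s n)))"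
      using nn_integral_abs_le_norm[OF sq_int_diff[of "g (Suc n)" "g n"]]
      by (simp add: abs_L2I_diff[symmetric] absg)
    also have "\<dots> \<le> ennreal ((1/2)^n)"
      using s[of n "s (Suc n)" "s n"] mono[of n] by (intro ennreal_leI) (simp add: dist_norm)
    finally show ?thesis .
  qed
  have "(\<integral>\<^sup>+x. (\<Sum>n. ennreal \<bar>g (Suc n) x - g n x\<bar>) \<partial>leb01)
      = (\<Sum>n. \<integral>\<^sup>+x. ennreal \<bar>g (Suc n) x - g n x\<bar> \<partial>leb01)"
    by (rule nn_integral_suminf) measurable
  also have "\<dots> \<le> (\<Sum>n. ennreal ((1/2)^n))"
    by (intro suminf_le step) auto
  also have "\<dots> = ennreal (\<Sum>n. (1/2)^n)"
    by (rule suminf_ennreal2) (auto intro: summable_geometric)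
  also have "\<dots> < \<infinity>" by simp
  finally have "(\<integral>\<^sup>+x. (\<Sum>n. ennreal \<bar>g (Suc n) x - g n x\<bar>) \<partial>leb01) \<noteq> \<infinity>" by simp
  then have "AE x in leb01. (\<Sum>n. ennreal \<bar>g (Suc n) x - g n x\<bar>) \<noteq> \<infinity>"
    by (intro nn_integral_PInf_AE) auto
  then have conv: "AE x in leb01. (\<lambda>n. g n x) \<longlonglongrightarrow> lim (\<lambda>n. g n x)"
  proof eventually_elim
    case (elim x)
    then have "summable (\<lambda>n. \<bar>g (Suc n) x - g n x\<bar>)"
      by (intro summable_suminf_not_top) auto
    then have "summable (\<lambda>n. g (Suc n) x - g n x)" by (rule summable_rabs_cancel)
    then have "convergent (\<lambda>n. (\<Sum>i<n. g (Suc i) x - g i x))"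
      by (simp add: summable_iff_convergent)
    then have "convergent (\<lambda>n. g n x - g 0 x)"
      using sum_lessThan_telescope[of "\<lambda>n. g n x"] by simp
    then have "convergent (\<lambda>n. (g n x - g 0 x) + g 0 x)"
      by (intro convergent_add convergent_const)
    then show ?case by (simp add: convergent_LIMSEQ_iff)
  qed
  define f where "f x = lim (\<lambda>n. g n x)" for x
  have fm[measurable]: "f \<in> borel_measurable leb01"
    unfolding f_def by (rule borel_measurable_lim_metric) measurable
  have bound: "(\<integral>\<^sup>+x. ennreal ((g n x - f x)\<^sup>2) \<partial>leb01) \<le> ennreal (e\<^sup>2)"
    if "e > 0" and M: "\<And>m. m \<ge> M \<Longrightarrow> dist (X (s n)) (X (s m)) < e" for e n M
  proof -
    have "(\<integral>\<^sup>+x. ennreal ((g n x - f x)\<^sup>2) \<partial>leb01)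
        = (\<integral>\<^sup>+x. liminf (\<lambda>m. ennreal ((g n x - g m x)\<^sup>2)) \<partial>leb01)"
    proof (rule nn_integral_cong_AE, use conv in eventually_elim)
      case (elim x)
      then have "(\<lambda>m. ennreal ((g n x - g m x)\<^sup>2)) \<longlonglongrightarrow> ennreal ((g n x - f x)\<^sup>2)"
        unfolding f_def[symmetric] by (intro tendsto_intros tendsto_ennrealI)
      from lim_imp_Liminf[OF _ this] show ?case by simp
    qed
    also have "\<dots> \<le> liminf (\<lambda>m. \<integral>\<^sup>+x. ennreal ((g n x - g m x)\<^sup>2) \<partial>leb01)"
      by (rule nn_integral_liminf) measurable
    also have "\<dots> \<le> limsup (\<lambda>m. \<integral>\<^sup>+x. ennreal ((g n x - g m x)\<^sup>2) \<partial>leb01)"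
      by (rule Liminf_le_Limsup) simp
    also have "\<dots> \<le> ennreal (e\<^sup>2)"
    proof (rule Limsup_bounded, rule eventually_sequentiallyI[of M])
      fix m assume m: "M \<le> m"
      have "(\<integral>\<^sup>+x. ennreal ((g n x - g m x)\<^sup>2) \<partial>leb01) = ennreal ((dist (X (s n)) (X (s m)))\<^sup>2)"
        by (subst nn_integral_sq_L2I) (auto intro: sq_int_diff simp: abs_L2I_diff[symmetric] absg dist_norm)
      also have "\<dots> \<le> ennreal (e\<^sup>2)"
        using M[OF m] by (intro ennreal_leI power_mono) auto
      finally show "(\<integral>\<^sup>+x. ennreal ((g n x - g m x)\<^sup>2) \<partial>leb01) \<le> ennreal (e\<^sup>2)" .
    qed
    finally show ?thesis .
  qed
  have diff: "sq_int (\<lambda>x. g n x - f x)"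
    if "e > 0" and M: "\<And>m. m \<ge> M \<Longrightarrow> dist (X (s n)) (X (s m)) < e" for e n M
    unfolding sq_int_def
  proof
    show "(\<lambda>x. g n x - f x) \<in> borel_measurable leb01" by measurable
    show "integrable leb01 (\<lambda>x. (g n x - f x)\<^sup>2)"
    proof (rule integrableI_bounded)
      have "(\<integral>\<^sup>+x. ennreal ((g n x - f x)\<^sup>2) \<partial>leb01) \<le> ennreal (e\<^sup>2)"
        by (rule bound[OF \<open>e > 0\<close> M])
      also have "\<dots> < \<infinity>" by simp
      finally show "(\<integral>\<^sup>+x. ennreal (norm ((g n x - f x)\<^sup>2)) \<partial>leb01) < \<infinity>" by simp
    qed measurable
  qed
  have seq: "m \<ge> n \<Longrightarrow> dist (X (s n)) (X (s m)) < (1/2)^n" for n m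
    using s[of n "s n" "s m"] strict_mono_less_eq[OF sm, of n m] by simp
  have "sq_int (\<lambda>x. g 0 x - f x)" by (rule diff[of 1 0 0]) (use seq[of 0] in auto)
  from sq_int_diff[OF g[of 0] this] have f: "sq_int f" by simp
  have le: "dist (X (s n)) (abs_L2I f) \<le> (1/2)^n" for n
  proof -
    have "ennreal ((norm (X (s n) - abs_L2I f))\<^sup>2) \<le> ennreal (((1/2)^n)\<^sup>2)"
      using bound[of "(1/2)^n" n n] seq[of n] f nn_integral_sq_L2I[OF sq_int_diff[OF g f], of n]
      by (simp add: abs_L2I_diff[symmetric] absg)
    then have "(norm (X (s n) - abs_L2I f))\<^sup>2 \<le> ((1/2)^n)\<^sup>2"
      by (subst (asm) ennreal_le_iff) auto
    then show ?thesis unfolding dist_norm by (rule power2_le_imp_le) simp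
  qed
  have half: "(\<lambda>n. (1/2::real)^n) \<longlonglongrightarrow> 0"
    by (rule LIMSEQ_realpow_zero) simp_all
  have "(\<lambda>n. dist (X (s n)) (abs_L2I f)) \<longlonglongrightarrow> 0"
    by (rule Lim_null_comparison[OF always_eventually half])
      (simp only: real_norm_def abs_of_nonneg[OF zero_le_dist] le simp_thms)
  then have "(X \<circ> s) \<longlonglongrightarrow> abs_L2I f" unfolding o_def by (subst tendsto_dist_iff)
  then show "convergent X"
    using Cauchy_converges_subseq[OF X sm] by (auto simp: convergent_def)
qed

instance L2I :: banach ..

lemma tendsto_abs_L2I_dominated:
  assumes h: "sq_int h" and fm: "\<And>n. f n \<in> borel_measurable leb01"
    and le: "\<And>n x. x \<in> {0..1} \<Longrightarrow> \<bar>f n x\<bar> \<le> h x"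
    and lim: "\<And>x. x \<in> {0..1} \<Longrightarrow> (\<lambda>n. f n x) \<longlonglongrightarrow> g x"
    and gm: "g \<in> borel_measurable leb01"
  shows "(\<lambda>n. abs_L2I (f n)) \<longlonglongrightarrow> abs_L2I g"
proof -
  have h2: "integrable leb01 (\<lambda>x. (h x)\<^sup>2)" using h by (simp add: sq_int_def)
  have dom: "sq_int u" if u: "u \<in> borel_measurable leb01" and ule: "\<And>x. x \<in> {0..1} \<Longrightarrow> \<bar>u x\<bar> \<le> h x" for u
    unfolding sq_int_def
  proof
    show "integrable leb01 (\<lambda>x. (u x)\<^sup>2)"
    proof (rule Bochner_Integration.integrable_bound[OF h2])
      show "(\<lambda>x. (u x)\<^sup>2) \<in> borel_measurable leb01" using u by measurable
      have "(u x)\<^sup>2 \<le> (h x)\<^sup>2" if "x \<in> {0..1}" for x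
        using power_mono[OF ule[OF that], of 2] by simp
      then show "AE x in leb01. norm ((u x)\<^sup>2) \<le> norm ((h x)\<^sup>2)"
        by (intro AE_I2) simp
    qed
  qed (rule u)
  have gle: "\<bar>g x\<bar> \<le> h x" if "x \<in> {0..1}" for x
    by (rule LIMSEQ_le_const2[OF tendsto_rabs[OF lim[OF that]]]) (use le[OF that] in blast)
  have f: "sq_int (f n)" for n by (rule dom[OF fm le])
  have g: "sq_int g" by (rule dom[OF gm gle])
  have "(\<lambda>n. \<integral>x. (f n x - g x)\<^sup>2 \<partial>leb01) \<longlonglongrightarrow> (\<integral>x. 0 \<partial>leb01)"
  proof (rule integral_dominated_convergence[where w="\<lambda>x. 4 * (h x)\<^sup>2"])
    show "integrable leb01 (\<lambda>x. 4 * (h x)\<^sup>2)" using h2 by simp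
    show "(\<lambda>x. (f n x - g x)\<^sup>2) \<in> borel_measurable leb01" for n using fm gm by measurable
    show "AE x in leb01. (\<lambda>n. (f n x - g x)\<^sup>2) \<longlonglongrightarrow> 0"
    proof (rule AE_I2)
      fix x assume "x \<in> space leb01"
      then have "(\<lambda>n. (f n x - g x)\<^sup>2) \<longlonglongrightarrow> (g x - g x)\<^sup>2"
        by (intro tendsto_intros lim) simp
      then show "(\<lambda>n. (f n x - g x)\<^sup>2) \<longlonglongrightarrow> 0" by simp
    qed
    show "AE x in leb01. norm ((f n x - g x)\<^sup>2) \<le> 4 * (h x)\<^sup>2" for n
    proof (rule AE_I2)
      fix x assume "x \<in> space leb01"
      then have "\<bar>f n x - g x\<bar> \<le> 2 * h x"
        using le[of x n] gle[of x] by simp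
      from power_mono[OF this, of 2] show "norm ((f n x - g x)\<^sup>2) \<le> 4 * (h x)\<^sup>2"
        by (simp add: power_mult_distrib)
    qed
  qed simp
  then have "(\<lambda>n. sqrt (\<integral>x. (f n x - g x)\<^sup>2 \<partial>leb01)) \<longlonglongrightarrow> 0"
    using tendsto_real_sqrt by fastforce
  also have "(\<lambda>n. sqrt (\<integral>x. (f n x - g x)\<^sup>2 \<partial>leb01)) = (\<lambda>n. norm (abs_L2I (f n) - abs_L2I g))"
    by (simp only: abs_L2I_diff[OF f g] norm_abs_L2I[OF sq_int_diff[OF f g]])
  finally show ?thesis
    by (subst tendsto_dist_iff) (simp only: dist_norm)
qed

definition L2I_basic :: "(rat \<times> rat) list \<Rightarrow> L2I" where
  "L2I_basic l = (\<Sum>(c, q)\<leftarrow>l. of_rat c *\<^sub>R abs_L2I (indicator {..of_rat q}))"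

lemma indicator_measurable_leb01: "A \<in> sets borel \<Longrightarrow> indicator A \<in> borel_measurable leb01"
  unfolding leb01_def by (intro measurable_restrict_space1) simp

lemma sq_int_indicator: "A \<in> sets borel \<Longrightarrow> sq_int (indicator A)"
  by (rule sq_int_bounded[where B=1, OF indicator_measurable_leb01]) (simp_all add: indicator_def)

lemma L2I_basic_dense: "closure (range L2I_basic) = UNIV"
proof -
  define C where "C = closure (range L2I_basic)"
  have seqC: "x \<in> C \<longleftrightarrow> (\<exists>l. (\<lambda>n. L2I_basic (l n)) \<longlonglongrightarrow> x)" for x
    unfolding C_def closure_sequential
  proof safe
    fix X assume "\<forall>n. X n \<in> range L2I_basic" "X \<longlonglongrightarrow> x"
    then show "\<exists>l. (\<lambda>n. L2I_basic (l n)) \<longlonglongrightarrow> x"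
      by (intro exI[of _ "\<lambda>n. inv L2I_basic (X n)"]) (simp add: f_inv_into_f)
  next
    fix l assume "(\<lambda>n. L2I_basic (l n)) \<longlonglongrightarrow> x"
    then show "\<exists>X. (\<forall>n. X n \<in> range L2I_basic) \<and> X \<longlonglongrightarrow> x"
      by (intro exI[of _ "\<lambda>n. L2I_basic (l n)"]) simp
  qed
  have CI: "x \<in> C" if "(\<lambda>n. L2I_basic (l n)) \<longlonglongrightarrow> x" for x l
    unfolding seqC by (rule exI[of _ l]) (rule that)
  have closed: "closed C" by (simp add: C_def)
  have Clim: "x \<in> C" if "\<And>n. X n \<in> C" "X \<longlonglongrightarrow> x" for X x
    using closed that unfolding closed_sequential_limits by blast
  have add: "x + y \<in> C" if "x \<in> C" "y \<in> C" for x y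
  proof -
    from that obtain l m where "(\<lambda>n. L2I_basic (l n)) \<longlonglongrightarrow> x" "(\<lambda>n. L2I_basic (m n)) \<longlonglongrightarrow> y"
      unfolding seqC by blast
    then have "(\<lambda>n. L2I_basic (l n) + L2I_basic (m n)) \<longlonglongrightarrow> x + y" by (rule tendsto_add)
    then have "(\<lambda>n. L2I_basic (l n @ m n)) \<longlonglongrightarrow> x + y" by (simp add: L2I_basic_def)
    then show ?thesis by (rule CI)
  qed
  have scale_basic: "of_rat r *\<^sub>R L2I_basic l = L2I_basic (map (\<lambda>(c, q). (r * c, q)) l)" for r l
    by (induction l) (auto simp: L2I_basic_def scaleR_add_right of_rat_mult)
  have scale: "r *\<^sub>R x \<in> C" if "x \<in> C" for r x
  proof -
    from that obtain l where l: "(\<lambda>n. L2I_basic (l n)) \<longlonglongrightarrow> x"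
      unfolding seqC by blast
    have "\<exists>p::rat. \<bar>of_rat p - r\<bar> < inverse (real (Suc n))" for n
    proof -
      obtain p :: rat where "r < of_rat p" "of_rat p < r + inverse (real (Suc n))"
        using of_rat_dense[of r "r + inverse (real (Suc n))"] by auto
      then show ?thesis by (intro exI[of _ p]) linarith
    qed
    then obtain p :: "nat \<Rightarrow> rat" where p: "\<And>n. \<bar>of_rat (p n) - r\<bar> < inverse (real (Suc n))" by metis
    have "(\<lambda>n. of_rat (p n) - r) \<longlonglongrightarrow> 0"
      by (rule Lim_null_comparison[OF always_eventually LIMSEQ_inverse_real_of_nat])
        (use p in \<open>simp add: less_imp_le\<close>)
    then have "(\<lambda>n. of_rat (p n)) \<longlonglongrightarrow> r" by (simp add: LIM_zero_iff)
    then have "(\<lambda>n. of_rat (p n) *\<^sub>R L2I_basic (l n)) \<longlonglongrightarrow> r *\<^sub>R x" using l by (rule tendsto_scaleR)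
    then show ?thesis unfolding scale_basic by (rule CI)
  qed
  have zero: "0 \<in> C" unfolding seqC by (intro exI[of _ "\<lambda>_. []"]) (simp add: L2I_basic_def)
  have diff: "x - y \<in> C" if "x \<in> C" "y \<in> C" for x y
    using add[OF that(1) scale[OF that(2), of "-1"]] by simp
  have indrat: "abs_L2I (indicator {..of_rat q}) \<in> C" for q
    unfolding seqC by (intro exI[of _ "\<lambda>_. [(1, q)]"]) (simp add: L2I_basic_def)
  have indempty: "abs_L2I (indicator {}) \<in> C"
  proof -
    have "abs_L2I (indicator {}) = 0"
      unfolding zero_L2I_def by (rule arg_cong[where f=abs_L2I]) (simp add: fun_eq_iff)
    then show ?thesis using zero by (simp only:)
  qed
  have one: "sq_int (\<lambda>_. 1)" by (rule sq_int_bounded[where B=1]) simp_all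
  have limind: "abs_L2I (indicator A) \<in> C"
    if "\<And>n. abs_L2I (f n) \<in> C" "\<And>n. f n \<in> borel_measurable leb01"
      "\<And>n x. \<bar>f n x\<bar> \<le> 1" "\<And>x. (\<lambda>n. f n x) \<longlonglongrightarrow> indicator A x" "A \<in> sets borel" for f A
    by (rule Clim[OF that(1)])
      (rule tendsto_abs_L2I_dominated[OF one that(2)], use that indicator_measurable_leb01 in auto)
  have indreal: "abs_L2I (indicator {..a}) \<in> C" for a
  proof -
    have "\<exists>q::rat. a < of_rat q \<and> of_rat q < a + inverse (real (Suc n))" for n
      using of_rat_dense[of a "a + inverse (real (Suc n))"] by auto
    then obtain q :: "nat \<Rightarrow> rat" where q: "\<And>n. a < of_rat (q n)" "\<And>n. of_rat (q n) < a + inverse (real (Suc n))" by metis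
    show ?thesis
    proof (rule limind[where f="\<lambda>n. indicator {..of_rat (q n)}"])
      fix x
      show "(\<lambda>n. indicator {..real_of_rat (q n)} x) \<longlonglongrightarrow> (indicator {..a} x :: real)"
      proof (cases "x \<le> a")
        case True
        then have "indicator {..real_of_rat (q n)} x = (indicator {..a} x :: real)" for n
          using q(1)[of n] by (simp add: indicator_def)
        then show ?thesis by simp
      next
        case False
        then have "0 < x - a" by simp
        from reals_Archimedean[OF this] obtain n0 where n0: "inverse (real (Suc n0)) < x - a" by auto
        have "indicator {..real_of_rat (q n)} x = (indicator {..a} x :: real)" if "n \<ge> n0" for n
        proof -
          have "inverse (real (Suc n)) \<le> inverse (real (Suc n0))"
            using that by (intro le_imp_inverse_le) simp_all
          then have "of_rat (q n) < x" using q(2)[of n] n0 by linarith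
          then show ?thesis using False by (simp add: indicator_def)
        qed
        then show ?thesis
          by (intro tendsto_eventually eventually_sequentiallyI[of n0]) 
      qed
    qed (simp_all add: indrat indicator_measurable_leb01 split: split_indicator)
  qed
  have ind: "abs_L2I (indicator A) \<in> C" if "A \<in> sets borel" for A
  proof -
    have gen: "sets borel = sigma_sets UNIV (range (\<lambda>a::real. {..a}))"
      by (subst borel_eq_atMost) (simp add: sets_measure_of)
    have "Int_stable (range (\<lambda>a::real. {..a}))"
      by (auto simp: Int_stable_def)
    moreover have "range (\<lambda>a::real. {..a}) \<subseteq> Pow UNIV" by simp
    moreover from that have "A \<in> sigma_sets UNIV (range (\<lambda>a::real. {..a}))" by (simp add: gen)
    ultimately show ?thesis
    proof (induction rule: sigma_sets_induct_disjoint)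
      case (basic A)
      then show ?case using indreal by auto
    next
      case empty
      show ?case by (rule indempty)
    next
      case (compl A)
      then have A: "A \<in> sets borel" by (simp add: gen)
      have univ: "abs_L2I (indicator UNIV) \<in> C"
      proof -
        have "abs_L2I (indicator UNIV) = abs_L2I (indicator {..1})"
          by (subst abs_L2I_eq_iff) (auto intro!: sq_int_indicator AE_I2 one split: split_indicator)
        then show ?thesis by (simp only: indreal)
      qed
      have "abs_L2I (indicator (UNIV - A)) = abs_L2I (indicator UNIV) - abs_L2I (indicator A)"
        by (subst abs_L2I_diff[OF sq_int_indicator sq_int_indicator])
          (use A in \<open>auto intro!: arg_cong[where f=abs_L2I] simp: fun_eq_iff split: split_indicator\<close>)
      then show ?case using diff[OF univ compl(2)] by simp
    next
      case (union A)
      have A: "A i \<in> sets borel" for i using union(2) by (auto simp: gen)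
      have U: "abs_L2I (indicator (\<Union>i<n. A i)) \<in> C" for n
      proof (induction n)
        case 0
        show ?case by (simp only: lessThan_0 UN_empty indempty)
      next
        case (Suc n)
        have disj: "A n \<inter> (\<Union>i<n. A i) = {}"
        proof -
          have "A n \<inter> A i = {}" if "i < n" for i
            by (rule disjoint_family_onD[OF union(1)]) (use that in simp_all)
          then show ?thesis by blast
        qed
        have "(indicator (\<Union>i<Suc n. A i) :: real \<Rightarrow> real)
            = (\<lambda>x. indicator (\<Union>i<n. A i) x + indicator (A n) x)"
          unfolding lessThan_Suc UN_insert Un_commute[of "A n"]
          by (rule ext, rule indicator_add[symmetric]) (use disj in blast)
        then have "abs_L2I (indicator (\<Union>i<Suc n. A i)) = abs_L2I (indicator (\<Union>i<n. A i)) + abs_L2I (indicator (A n))"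
          by (subst abs_L2I_add[OF sq_int_indicator sq_int_indicator]) (use A in auto)
        then show ?case using add[OF Suc union(3)] by (simp only:)
      qed
      show ?case
      proof (rule limind[OF U])
        show "(\<lambda>n. indicator (\<Union>i<n. A i) x) \<longlonglongrightarrow> (indicator (\<Union>(range A)) x :: real)" for x
          by (rule LIMSEQ_indicator_UN)
      qed (use A in \<open>auto intro!: indicator_measurable_leb01 split: split_indicator\<close>)
    qed
  qed
  have "x \<in> C" for x
  proof -
    obtain f where f: "sq_int f" and x: "x = abs_L2I f" by (rule L2I_cases)
    have fm: "f \<in> borel_measurable leb01" using f by (rule sq_int_measurable)
    obtain F where F: "\<And>i. simple_function leb01 (F i)"
      and lim: "\<And>x. x \<in> {0..1} \<Longrightarrow> (\<lambda>i. F i x) \<longlonglongrightarrow> f x"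
      and le: "\<And>i x. x \<in> {0..1} \<Longrightarrow> \<bar>F i x\<bar> \<le> 2 * \<bar>f x\<bar>"
      using borel_measurable_implies_sequence_metric[OF fm, of 0]
      unfolding space_leb01 dist_real_def diff_0_right by blast
    have Fm: "F i \<in> borel_measurable leb01" for i by (rule borel_measurable_simple_function[OF F])
    have FC: "abs_L2I (F i) \<in> C" for i
    proof -
      define Y where "Y = F i ` space leb01"
      define A where "A y = F i -` {y} \<inter> space leb01" for y
      have Y: "finite Y" using simple_functionD(1)[OF F] by (simp add: Y_def)
      have A: "A y \<in> sets borel" for y
      proof -
        have "A y \<in> sets leb01" using simple_functionD(2)[OF F[of i], of "{y}"] by (simp add: A_def)
        then show ?thesis by (auto simp: leb01_def sets_restrict_space)
      qed
      have "sq_int (\<lambda>x. \<Sum>y\<in>Z. y * indicator (A y) x) \<and> abs_L2I (\<lambda>x. \<Sum>y\<in>Z. y * indicator (A y) x) \<in> C"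
        if "finite Z" for Z
        using that
      proof (induction Z)
        case empty
        then show ?case using zero by (simp add: sq_int_zero zero_L2I_def)
      next
        case (insert y Z)
        have s: "sq_int (\<lambda>x. y * indicator (A y) x)" by (intro sq_int_scale sq_int_indicator A)
        have "abs_L2I (\<lambda>x. y * indicator (A y) x) \<in> C"
          by (subst abs_L2I_scaleR[symmetric]) (intro sq_int_indicator A scale ind)+
        then have "abs_L2I (\<lambda>x. y * indicator (A y) x) + abs_L2I (\<lambda>x. \<Sum>y\<in>Z. y * indicator (A y) x) \<in> C"
          using insert.IH by (intro add) blast+
        moreover have t: "sq_int (\<lambda>x. \<Sum>y\<in>Z. y * indicator (A y) x)" using insert.IH by blast
        ultimately show ?case
          unfolding sum.insert[OF insert.hyps] abs_L2I_add[OF s t] using sq_int_add[OF s t] by blast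
      qed
      from this[OF Y] have "sq_int (\<lambda>x. \<Sum>y\<in>Y. y * indicator (A y) x)"
        and C: "abs_L2I (\<lambda>x. \<Sum>y\<in>Y. y * indicator (A y) x) \<in> C" by blast+
      moreover have eq: "F i x = (\<Sum>y\<in>Y. y * indicator (A y) x)" if "x \<in> {0..1}" for x
      proof -
        have "F i x = (\<Sum>y\<in>F i ` space leb01. indicator (F i -` {y} \<inter> space leb01) x *\<^sub>R y)"
          by (rule simple_function_indicator_representation_banach[OF F]) (use that in simp)
        also have "\<dots> = (\<Sum>y\<in>Y. y * indicator (A y) x)"
          unfolding Y_def A_def by (rule sum.cong[OF refl]) (simp only: real_scaleR_def mult.commute)
        finally show ?thesis .
      qed
      moreover have "sq_int (F i)"
      proof (rule sq_int_bounded[OF Fm])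
        show "\<bar>F i x\<bar> \<le> Max (abs ` Y)" if "x \<in> {0..1}" for x
          using that Y by (intro Max_ge) (auto simp: Y_def)
      qed
      ultimately have "abs_L2I (F i) = abs_L2I (\<lambda>x. \<Sum>y\<in>Y. y * indicator (A y) x)"
        by (subst abs_L2I_eq_iff) (assumption | rule AE_I2 | simp only: space_leb01)+
      then show ?thesis using C by simp
    qed
    have "sq_int (\<lambda>x. \<bar>f x\<bar>)" using f by (auto simp: sq_int_def)
    then have h: "sq_int (\<lambda>x. 2 * \<bar>f x\<bar>)" by (rule sq_int_scale)
    show ?thesis unfolding x
      by (rule Clim[OF FC tendsto_abs_L2I_dominated[OF h Fm le lim fm]])
  qed
  then show ?thesis by (auto simp: C_def)
qed

instance L2I :: second_countable_topology
proof
  define B where "B = (\<lambda>(l, n). ball (L2I_basic l) (inverse (real (Suc n)))) ` UNIV"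
  have "topological_basis B"
  proof (rule topological_basisI)
    show "open U" if "U \<in> B" for U using that by (auto simp: B_def)
    fix U :: "L2I set" and x assume "open U" "x \<in> U"
    then obtain e where e: "e > 0" "ball x e \<subseteq> U" by (meson open_contains_ball)
    obtain n where n: "inverse (real (Suc n)) < e / 2"
      using reals_Archimedean[of "e/2"] e by auto
    have "x \<in> closure (range L2I_basic)" by (simp add: L2I_basic_dense)
    then obtain l where l: "dist (L2I_basic l) x < inverse (real (Suc n))"
      unfolding closure_approachable by (metis inverse_positive_iff_positive of_nat_0_less_iff rangeE zero_less_Suc)
    have "ball (L2I_basic l) (inverse (real (Suc n))) \<subseteq> U"
    proof
      fix y assume "y \<in> ball (L2I_basic l) (inverse (real (Suc n)))"
      then have "dist x y < e"
        using l n dist_triangle[of x y "L2I_basic l"] by (simp add: dist_commute)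
      then show "y \<in> U" using e by auto
    qed
    moreover have "ball (L2I_basic l) (inverse (real (Suc n))) \<in> B"
      unfolding B_def by (rule image_eqI[where x="(l, n)"]) simp_all
    ultimately show "\<exists>V\<in>B. x \<in> V \<and> V \<subseteq> U" using l by (intro bexI) auto
  qed
  moreover have "countable B" by (simp add: B_def)
  ultimately show "\<exists>B::L2I set set. countable B \<and> open = generate_topology B"
    by (blast intro: topological_basis_imp_subbasis)
qed

definition L2_kernel :: "(real \<Rightarrow> real \<Rightarrow> real) \<Rightarrow> bool" where
  "L2_kernel K \<longleftrightarrow> (\<lambda>(\<alpha>, \<beta>). K \<alpha> \<beta>) \<in> borel_measurable (leb01 \<Otimes>\<^sub>M leb01) \<and>
     integrable (leb01 \<Otimes>\<^sub>M leb01) (\<lambda>(\<alpha>, \<beta>). (K \<alpha> \<beta>)\<^sup>2)"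

definition graphon :: "(real \<Rightarrow> real \<Rightarrow> real) \<Rightarrow> bool" where
  "graphon K \<longleftrightarrow> (\<lambda>(\<alpha>, \<beta>). K \<alpha> \<beta>) \<in> borel_measurable (leb01 \<Otimes>\<^sub>M leb01) \<and>
     (\<exists>b. \<forall>\<alpha>\<in>{0..1}. \<forall>\<beta>\<in>{0..1}. \<bar>K \<alpha> \<beta>\<bar> \<le> b) \<and>
     (\<forall>\<alpha>\<in>{0..1}. \<forall>\<beta>\<in>{0..1}. K \<alpha> \<beta> = K \<beta> \<alpha>)"

text \<open>
  By \<open>Blinfun\<close>, the following is unspecified when the integral does not define a bounded operator;
  see \<open>kernel_op_abs\<close> below for square-integrable kernels, and \<open>graphon_L2_kernel\<close>.
\<close>

definition kernel_op :: "(real \<Rightarrow> real \<Rightarrow> real) \<Rightarrow> L2I \<Rightarrow>\<^sub>L L2I" where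
  "kernel_op K = Blinfun (\<lambda>f. abs_L2I (\<lambda>\<alpha>. \<integral>\<beta>. K \<alpha> \<beta> * rep_L2I f \<beta> \<partial>leb01))"

lemma graphon_L2_kernel:
  assumes "graphon K" shows "L2_kernel K"
proof -
  interpret pair_prob_space leb01 leb01 ..
  obtain b where b: "\<And>\<alpha> \<beta>. \<alpha> \<in> {0..1} \<Longrightarrow> \<beta> \<in> {0..1} \<Longrightarrow> \<bar>K \<alpha> \<beta>\<bar> \<le> b"
    and m: "(\<lambda>(\<alpha>, \<beta>). K \<alpha> \<beta>) \<in> borel_measurable (leb01 \<Otimes>\<^sub>M leb01)"
    using assms unfolding graphon_def by blast
  have m2: "(\<lambda>p. (case p of (\<alpha>, \<beta>) \<Rightarrow> K \<alpha> \<beta>)\<^sup>2) \<in> borel_measurable (leb01 \<Otimes>\<^sub>M leb01)"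
    using m by (rule borel_measurable_power)
  have "integrable (leb01 \<Otimes>\<^sub>M leb01) (\<lambda>p. (case p of (\<alpha>, \<beta>) \<Rightarrow> K \<alpha> \<beta>)\<^sup>2)"
  proof (rule P.integrable_const_bound[where B="b\<^sup>2", OF _ m2], rule AE_I2)
    fix p assume "p \<in> space (leb01 \<Otimes>\<^sub>M leb01)"
    then obtain \<alpha> \<beta> where p: "p = (\<alpha>, \<beta>)" "\<alpha> \<in> {0..1}" "\<beta> \<in> {0..1}"
      by (auto simp: space_pair_measure)
    show "norm ((case p of (\<alpha>, \<beta>) \<Rightarrow> K \<alpha> \<beta>)\<^sup>2) \<le> b\<^sup>2"
      using power_mono[OF b[OF p(2,3)], of 2] by (simp add: p(1))
  qed
  also have "(\<lambda>p. (case p of (\<alpha>, \<beta>) \<Rightarrow> K \<alpha> \<beta>)\<^sup>2) = (\<lambda>(\<alpha>, \<beta>). (K \<alpha> \<beta>)\<^sup>2)"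
    by (auto simp: fun_eq_iff)
  finally show ?thesis using m by (simp add: L2_kernel_def)
qed

lemma nn_integral_kernel_le:
  assumes K: "L2_kernel K" and f: "sq_int f"
  shows "(\<integral>\<^sup>+\<alpha>. ennreal ((\<integral>\<beta>. K \<alpha> \<beta> * f \<beta> \<partial>leb01)\<^sup>2) \<partial>leb01)
    \<le> (\<integral>\<^sup>+\<alpha>. \<integral>\<^sup>+\<beta>. ennreal ((K \<alpha> \<beta>)\<^sup>2) \<partial>leb01 \<partial>leb01) * ennreal ((norm (abs_L2I f))\<^sup>2)"
proof -
  have Km[measurable]: "(\<lambda>(\<alpha>, \<beta>). K \<alpha> \<beta>) \<in> borel_measurable (leb01 \<Otimes>\<^sub>M leb01)"
    using K by (simp add: L2_kernel_def)
  have fm[measurable]: "f \<in> borel_measurable leb01" using f by (rule sq_int_measurable)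
  have pt: "ennreal ((\<integral>\<beta>. K \<alpha> \<beta> * f \<beta> \<partial>leb01)\<^sup>2)
      \<le> (\<integral>\<^sup>+\<beta>. ennreal ((K \<alpha> \<beta>)\<^sup>2) \<partial>leb01) * ennreal ((norm (abs_L2I f))\<^sup>2)"
    if \<alpha>: "\<alpha> \<in> space leb01" for \<alpha>
  proof -
    have [measurable]: "K \<alpha> \<in> borel_measurable leb01"
      using measurable_Pair2[OF Km \<alpha>] by simp
    have "ennreal \<bar>\<integral>\<beta>. K \<alpha> \<beta> * f \<beta> \<partial>leb01\<bar> \<le> (\<integral>\<^sup>+\<beta>. ennreal \<bar>K \<alpha> \<beta> * f \<beta>\<bar> \<partial>leb01)"
    proof (cases "integrable leb01 (\<lambda>\<beta>. K \<alpha> \<beta> * f \<beta>)")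
      case True
      then show ?thesis using integral_norm_bound_ennreal[OF True] by simp
    next
      case False
      then show ?thesis by (simp add: not_integrable_integral_eq)
    qed
    also have "\<dots> = (\<integral>\<^sup>+\<beta>. ennreal \<bar>K \<alpha> \<beta>\<bar> * ennreal \<bar>f \<beta>\<bar> \<partial>leb01)"
      by (simp add: abs_mult ennreal_mult)
    finally have "(ennreal \<bar>\<integral>\<beta>. K \<alpha> \<beta> * f \<beta> \<partial>leb01\<bar>)\<^sup>2
        \<le> (\<integral>\<^sup>+\<beta>. ennreal \<bar>K \<alpha> \<beta>\<bar> * ennreal \<bar>f \<beta>\<bar> \<partial>leb01)\<^sup>2"
      by (rule power_mono) simp
    also have "\<dots> \<le> (\<integral>\<^sup>+\<beta>. (ennreal \<bar>K \<alpha> \<beta>\<bar>)\<^sup>2 \<partial>leb01) * (\<integral>\<^sup>+\<beta>. (ennreal \<bar>f \<beta>\<bar>)\<^sup>2 \<partial>leb01)"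
      by (rule Cauchy_Schwarz_nn_integral) measurable
    finally show ?thesis
      by (simp add: ennreal_power nn_integral_sq_L2I[OF f, symmetric])
  qed
  have "(\<integral>\<^sup>+\<alpha>. ennreal ((\<integral>\<beta>. K \<alpha> \<beta> * f \<beta> \<partial>leb01)\<^sup>2) \<partial>leb01)
      \<le> (\<integral>\<^sup>+\<alpha>. (\<integral>\<^sup>+\<beta>. ennreal ((K \<alpha> \<beta>)\<^sup>2) \<partial>leb01) * ennreal ((norm (abs_L2I f))\<^sup>2) \<partial>leb01)"
    by (rule nn_integral_mono) (rule pt)
  also have "\<dots> = (\<integral>\<^sup>+\<alpha>. \<integral>\<^sup>+\<beta>. ennreal ((K \<alpha> \<beta>)\<^sup>2) \<partial>leb01 \<partial>leb01) * ennreal ((norm (abs_L2I f))\<^sup>2)"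
    by (rule nn_integral_multc) measurable
  finally show ?thesis .
qed

lemma L2_kernel_finite:
  assumes K: "L2_kernel K"
  shows "(\<integral>\<^sup>+\<alpha>. \<integral>\<^sup>+\<beta>. ennreal ((K \<alpha> \<beta>)\<^sup>2) \<partial>leb01 \<partial>leb01) < \<infinity>"
proof -
  interpret pair_prob_space leb01 leb01 ..
  have [measurable]: "(\<lambda>(\<alpha>, \<beta>). K \<alpha> \<beta>) \<in> borel_measurable (leb01 \<Otimes>\<^sub>M leb01)"
    using K by (simp add: L2_kernel_def)
  have "(\<integral>\<^sup>+\<alpha>. \<integral>\<^sup>+\<beta>. ennreal ((K \<alpha> \<beta>)\<^sup>2) \<partial>leb01 \<partial>leb01)
      = (\<integral>\<^sup>+p. (\<lambda>(\<alpha>, \<beta>). ennreal ((K \<alpha> \<beta>)\<^sup>2)) p \<partial>(leb01 \<Otimes>\<^sub>M leb01))"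
    by (subst leb01.nn_integral_fst[symmetric]) simp_all
  also have "\<dots> = (\<integral>\<^sup>+p. ennreal (norm ((\<lambda>(\<alpha>, \<beta>). (K \<alpha> \<beta>)\<^sup>2) p)) \<partial>(leb01 \<Otimes>\<^sub>M leb01))"
    by (rule nn_integral_cong) auto
  also have "\<dots> < \<infinity>"
    using K by (simp add: L2_kernel_def integrable_iff_bounded)
  finally show ?thesis .
qed

lemma sq_int_kernel:
  assumes K: "L2_kernel K" and f: "sq_int f"
  shows "sq_int (\<lambda>\<alpha>. \<integral>\<beta>. K \<alpha> \<beta> * f \<beta> \<partial>leb01)"
  unfolding sq_int_def
proof
  have [measurable]: "(\<lambda>(\<alpha>, \<beta>). K \<alpha> \<beta>) \<in> borel_measurable (leb01 \<Otimes>\<^sub>M leb01)"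
    using K by (simp add: L2_kernel_def)
  have [measurable]: "f \<in> borel_measurable leb01" using f by (rule sq_int_measurable)
  show m[measurable]: "(\<lambda>\<alpha>. \<integral>\<beta>. K \<alpha> \<beta> * f \<beta> \<partial>leb01) \<in> borel_measurable leb01"
    by measurable
  show "integrable leb01 (\<lambda>\<alpha>. (\<integral>\<beta>. K \<alpha> \<beta> * f \<beta> \<partial>leb01)\<^sup>2)"
  proof (rule integrableI_bounded)
    have "(\<integral>\<^sup>+\<alpha>. ennreal (norm ((\<integral>\<beta>. K \<alpha> \<beta> * f \<beta> \<partial>leb01)\<^sup>2)) \<partial>leb01)
        \<le> (\<integral>\<^sup>+\<alpha>. \<integral>\<^sup>+\<beta>. ennreal ((K \<alpha> \<beta>)\<^sup>2) \<partial>leb01 \<partial>leb01) * ennreal ((norm (abs_L2I f))\<^sup>2)"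
      using nn_integral_kernel_le[OF K f] by simp
    also have "\<dots> < \<infinity>"
      using L2_kernel_finite[OF K] by (simp add: ennreal_mult_less_top)
    finally show "(\<integral>\<^sup>+\<alpha>. ennreal (norm ((\<integral>\<beta>. K \<alpha> \<beta> * f \<beta> \<partial>leb01)\<^sup>2)) \<partial>leb01) < \<infinity>" .
  qed measurable
qed

lemma AE_integrable_kernel:
  assumes K: "L2_kernel K" and f: "sq_int f"
  shows "AE \<alpha> in leb01. integrable leb01 (\<lambda>\<beta>. K \<alpha> \<beta> * f \<beta>)"
proof -
  have Km[measurable]: "(\<lambda>(\<alpha>, \<beta>). K \<alpha> \<beta>) \<in> borel_measurable (leb01 \<Otimes>\<^sub>M leb01)"
    using K by (simp add: L2_kernel_def)
  have "AE \<alpha> in leb01. (\<integral>\<^sup>+\<beta>. ennreal ((K \<alpha> \<beta>)\<^sup>2) \<partial>leb01) \<noteq> \<infinity>"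
    by (rule nn_integral_PInf_AE) (use L2_kernel_finite[OF K] in simp_all)
  moreover have "AE \<alpha> in leb01. \<alpha> \<in> space leb01" by (rule AE_space)
  ultimately show ?thesis
  proof eventually_elim
    case (elim \<alpha>)
    have [measurable]: "K \<alpha> \<in> borel_measurable leb01"
      using measurable_Pair2[OF Km elim(2)] by simp
    have "sq_int (K \<alpha>)"
      unfolding sq_int_def
    proof
      show "integrable leb01 (\<lambda>\<beta>. (K \<alpha> \<beta>)\<^sup>2)"
        by (rule integrableI_bounded) (use elim(1) in \<open>simp_all add: less_top\<close>)
    qed simp
    then show ?case using f by (rule sq_int_mult)
  qed
qed

lemma kernel_op_apply_rep:
  assumes K: "L2_kernel K"
  shows "kernel_op K f = abs_L2I (\<lambda>\<alpha>. \<integral>\<beta>. K \<alpha> \<beta> * rep_L2I f \<beta> \<partial>leb01)"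
  unfolding kernel_op_def
proof (subst bounded_linear_Blinfun_apply)
  define T where "T f \<alpha> = (\<integral>\<beta>. K \<alpha> \<beta> * rep_L2I f \<beta> \<partial>leb01)" for f \<alpha>
  have T: "sq_int (T f)" for f
    unfolding T_def by (rule sq_int_kernel[OF K sq_int_rep])
  have AE_T: "AE \<alpha> in leb01. integrable leb01 (\<lambda>\<beta>. K \<alpha> \<beta> * rep_L2I f \<beta>)" for f
    by (rule AE_integrable_kernel[OF K sq_int_rep])
  have [measurable]: "rep_L2I f \<in> borel_measurable leb01" for f
    by (rule sq_int_measurable[OF sq_int_rep])
  have Km: "(\<lambda>(\<alpha>, \<beta>). K \<alpha> \<beta>) \<in> borel_measurable (leb01 \<Otimes>\<^sub>M leb01)"
    using K by (simp add: L2_kernel_def)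
  have Kam: "K \<alpha> \<in> borel_measurable leb01" if "\<alpha> \<in> space leb01" for \<alpha>
    using measurable_Pair2[OF Km that] by simp
  have repadd: "AE x in leb01. rep_L2I (f + g) x = rep_L2I f x + rep_L2I g x" for f g
    using rep_abs_L2I[OF sq_int_add[OF sq_int_rep sq_int_rep, of f g]]
    by (simp flip: abs_L2I_add)
  have repscale: "AE x in leb01. rep_L2I (c *\<^sub>R f) x = c * rep_L2I f x" for c f
    using rep_abs_L2I[OF sq_int_scale[OF sq_int_rep, of c f]]
    by (simp flip: abs_L2I_scaleR)
  define M where "M = enn2real (\<integral>\<^sup>+\<alpha>. \<integral>\<^sup>+\<beta>. ennreal ((K \<alpha> \<beta>)\<^sup>2) \<partial>leb01 \<partial>leb01)"
  have M: "(\<integral>\<^sup>+\<alpha>. \<integral>\<^sup>+\<beta>. ennreal ((K \<alpha> \<beta>)\<^sup>2) \<partial>leb01 \<partial>leb01) = ennreal M" "0 \<le> M"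
    unfolding M_def using L2_kernel_finite[OF K] by simp_all
  have "bounded_linear (\<lambda>f. abs_L2I (T f))"
  proof (rule bounded_linear_intro)
    fix f g :: L2I
    have "AE \<alpha> in leb01. T (f + g) \<alpha> = T f \<alpha> + T g \<alpha>"
      using AE_T[of f] AE_T[of g] AE_space[of leb01]
    proof eventually_elim
      case (elim \<alpha>)
      note [measurable] = Kam[OF elim(3)]
      have "T (f + g) \<alpha> = (\<integral>\<beta>. K \<alpha> \<beta> * rep_L2I f \<beta> + K \<alpha> \<beta> * rep_L2I g \<beta> \<partial>leb01)"
        unfolding T_def
      proof (rule integral_cong_AE)
        show "AE \<beta> in leb01. K \<alpha> \<beta> * rep_L2I (f + g) \<beta> = K \<alpha> \<beta> * rep_L2I f \<beta> + K \<alpha> \<beta> * rep_L2I g \<beta>"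
          using repadd[of f g] by eventually_elim (simp only: distrib_left)
      qed measurable
      also have "\<dots> = T f \<alpha> + T g \<alpha>"
        unfolding T_def by (rule Bochner_Integration.integral_add) (use elim in blast)+
      finally show ?case .
    qed
    then show "abs_L2I (T (f + g)) = abs_L2I (T f) + abs_L2I (T g)"
      unfolding abs_L2I_add[OF T T] by (subst abs_L2I_eq_iff[OF T sq_int_add[OF T T]])
  next
    fix c :: real and f :: L2I
    have "AE \<alpha> in leb01. T (c *\<^sub>R f) \<alpha> = c * T f \<alpha>"
      using AE_space[of leb01]
    proof eventually_elim
      case (elim \<alpha>)
      note [measurable] = Kam[OF elim(1)]
      have "T (c *\<^sub>R f) \<alpha> = (\<integral>\<beta>. c * (K \<alpha> \<beta> * rep_L2I f \<beta>) \<partial>leb01)"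
        unfolding T_def
      proof (rule integral_cong_AE)
        show "AE \<beta> in leb01. K \<alpha> \<beta> * rep_L2I (c *\<^sub>R f) \<beta> = c * (K \<alpha> \<beta> * rep_L2I f \<beta>)"
          using repscale[of c f] by eventually_elim (simp only: mult.left_commute)
      qed measurable
      also have "\<dots> = c * T f \<alpha>"
        unfolding T_def by (rule integral_mult_right_zero)
      finally show ?case .
    qed
    then show "abs_L2I (T (c *\<^sub>R f)) = c *\<^sub>R abs_L2I (T f)"
      unfolding abs_L2I_scaleR[OF T] by (subst abs_L2I_eq_iff[OF T sq_int_scale[OF T]])
  next
    fix f :: L2I
    have "ennreal ((norm (abs_L2I (T f)))\<^sup>2) \<le> ennreal M * ennreal ((norm f)\<^sup>2)"
      using nn_integral_kernel_le[OF K sq_int_rep, of f] nn_integral_sq_L2I[OF T[of f]]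
      by (simp add: M T_def)
    also have "\<dots> = ennreal ((norm f * sqrt M)\<^sup>2)"
      using M(2) by (simp add: power_mult_distrib ennreal_mult mult.commute)
    finally have "(norm (abs_L2I (T f)))\<^sup>2 \<le> (norm f * sqrt M)\<^sup>2"
      by (subst (asm) ennreal_le_iff) simp_all
    then show "norm (abs_L2I (T f)) \<le> norm f * sqrt M"
      by (rule power2_le_imp_le) (use M(2) in simp)
  qed
  then show "bounded_linear (\<lambda>f. abs_L2I (\<lambda>\<alpha>. \<integral>\<beta>. K \<alpha> \<beta> * rep_L2I f \<beta> \<partial>leb01))"
    unfolding T_def .
qed simp

lemma kernel_op_abs:
  assumes K: "L2_kernel K" and f: "sq_int f"
  shows "kernel_op K (abs_L2I f) = abs_L2I (\<lambda>\<alpha>. \<integral>\<beta>. K \<alpha> \<beta> * f \<beta> \<partial>leb01)"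
proof -
  have Km: "(\<lambda>(\<alpha>, \<beta>). K \<alpha> \<beta>) \<in> borel_measurable (leb01 \<Otimes>\<^sub>M leb01)"
    using K by (simp add: L2_kernel_def)
  have [measurable]: "f \<in> borel_measurable leb01" "rep_L2I (abs_L2I f) \<in> borel_measurable leb01"
    using f by (auto intro: sq_int_measurable)
  have "(\<integral>\<beta>. K \<alpha> \<beta> * rep_L2I (abs_L2I f) \<beta> \<partial>leb01) = (\<integral>\<beta>. K \<alpha> \<beta> * f \<beta> \<partial>leb01)"
    if "\<alpha> \<in> space leb01" for \<alpha>
  proof (rule integral_cong_AE)
    have [measurable]: "K \<alpha> \<in> borel_measurable leb01"
      using measurable_Pair2[OF Km that] by simp
    show "(\<lambda>\<beta>. K \<alpha> \<beta> * rep_L2I (abs_L2I f) \<beta>) \<in> borel_measurable leb01"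
      "(\<lambda>\<beta>. K \<alpha> \<beta> * f \<beta>) \<in> borel_measurable leb01" by measurable
    show "AE \<beta> in leb01. K \<alpha> \<beta> * rep_L2I (abs_L2I f) \<beta> = K \<alpha> \<beta> * f \<beta>"
      using rep_abs_L2I[OF f] by eventually_elim (simp only:)
  qed
  then show ?thesis
    unfolding kernel_op_apply_rep[OF K]
    by (subst abs_L2I_eq_iff[OF sq_int_kernel[OF K sq_int_rep] sq_int_kernel[OF K f]])
      (rule AE_I2)
qed

definition cell :: "nat \<Rightarrow> nat \<Rightarrow> real set" where
  "cell N k = (if k = 1 then {0..1 / real N} else {(real k - 1) / real N<..real k / real N})"

definition step_kernel :: "nat \<Rightarrow> (real \<Rightarrow> real \<Rightarrow> real) \<Rightarrow> bool" where
  "step_kernel N K \<longleftrightarrow> (\<forall>i\<in>{1..N}. \<forall>j\<in>{1..N}. \<exists>v. \<forall>\<alpha>\<in>cell N i. \<forall>\<beta>\<in>cell N j. K \<alpha> \<beta> = v)"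


definition self_adjoint_op :: "L2I \<Rightarrow>\<^sub>L L2I \<Rightarrow> bool" where
  "self_adjoint_op A \<longleftrightarrow> (\<forall>v y. inner (A v) y = inner v (A y))"

definition nonneg_op :: "L2I \<Rightarrow>\<^sub>L L2I \<Rightarrow> bool" where
  "nonneg_op A \<longleftrightarrow> self_adjoint_op A \<and> (\<forall>v. 0 \<le> inner (A v) v)"

definition nonneg_plus_scalar :: "L2I \<Rightarrow>\<^sub>L L2I \<Rightarrow> bool" where
  "nonneg_plus_scalar R \<longleftrightarrow> (\<exists>R0 r. nonneg_op R0 \<and> r > 0 \<and> R = R0 + r *\<^sub>R id_blinfun)"

primrec op_power :: "L2I \<Rightarrow>\<^sub>L L2I \<Rightarrow> nat \<Rightarrow> L2I \<Rightarrow>\<^sub>L L2I" where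
  "op_power A 0 = id_blinfun"
| "op_power A (Suc n) = A o\<^sub>L op_power A n"

definition op_exp :: "L2I \<Rightarrow>\<^sub>L L2I \<Rightarrow> L2I \<Rightarrow>\<^sub>L L2I" where
  "op_exp A = (\<Sum>n. (1 / fact n) *\<^sub>R op_power A n)"

lemma norm_op_power: "norm (op_power A n) \<le> norm A ^ n"
proof (induction n)
  case 0
  show ?case using norm_blinfun_id_le by simp
next
  case (Suc n)
  have "norm (A o\<^sub>L op_power A n) \<le> norm A * norm (op_power A n)"
    by (rule norm_blinfun_compose)
  also have "\<dots> \<le> norm A * norm A ^ n" by (rule mult_left_mono[OF Suc norm_ge_zero])
  finally show ?case by simp
qed

lemma summable_op_exp: "summable (\<lambda>n. (1 / fact n) *\<^sub>R op_power A n)"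
proof (rule summable_comparison_test')
  show "summable (\<lambda>n. inverse (fact n) * norm A ^ n)" by (rule summable_exp)
  show "norm ((1 / fact n) *\<^sub>R op_power A n) \<le> inverse (fact n) * norm A ^ n" for n
    using norm_op_power[of A n] by (simp add: divide_inverse mult_left_mono)
qed

definition Phi :: "L2I \<Rightarrow>\<^sub>L L2I \<Rightarrow> real \<Rightarrow> real \<Rightarrow> L2I \<Rightarrow>\<^sub>L L2I" where
  "Phi A t s = op_exp ((t - s) *\<^sub>R A)"

text \<open>
  \<^const>\<open>adjoint\<close> and \<^const>\<open>inv\<close> are choice operators; they denote $B^*$ and $R^{-1}$ because here
  $B$ has an adjoint (it is symmetric) and $R$ is bijective (it is \<^const>\<open>nonneg_plus_scalar\<close>).
\<close>

definition feedback :: "L2I \<Rightarrow>\<^sub>L L2I \<Rightarrow> L2I \<Rightarrow>\<^sub>L L2I \<Rightarrow> L2I \<Rightarrow>\<^sub>L L2I \<Rightarrow> L2I \<Rightarrow> L2I" where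
  "feedback B R S v = inv (blinfun_apply R) (adjoint (blinfun_apply B) (S v))"

definition riccati_solution ::
  "real \<Rightarrow> L2I \<Rightarrow>\<^sub>L L2I \<Rightarrow> L2I \<Rightarrow>\<^sub>L L2I \<Rightarrow> L2I \<Rightarrow>\<^sub>L L2I \<Rightarrow> L2I \<Rightarrow>\<^sub>L L2I \<Rightarrow> L2I \<Rightarrow>\<^sub>L L2I
    \<Rightarrow> (real \<Rightarrow> L2I \<Rightarrow>\<^sub>L L2I) \<Rightarrow> bool" where
  "riccati_solution T A B R M MT S \<longleftrightarrow>
     (\<forall>t\<in>{0..T}. nonneg_op (S t)) \<and> S T = MT \<and>
     (\<forall>v. \<forall>t\<in>{0..T}. ((\<lambda>t. inner (S t v) v) has_real_derivative
        - (2 * inner (A v) (S t v) - inner (S t (B (feedback B R (S t) v))) v + inner (M v) v))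
        (at t within {0..T}))"


definition brownian_motion :: "'w measure \<Rightarrow> (real \<Rightarrow> 'w \<Rightarrow> real) \<Rightarrow> bool" where
  "brownian_motion P W \<longleftrightarrow>
     (\<forall>t\<ge>0. W t \<in> borel_measurable P) \<and>
     (AE \<omega> in P. W 0 \<omega> = 0) \<and>
     (AE \<omega> in P. continuous_on {0..} (\<lambda>t. W t \<omega>)) \<and>
     (\<forall>s t. 0 \<le> s \<and> s < t \<longrightarrow>
        distributed P lborel (\<lambda>\<omega>. W t \<omega> - W s \<omega>) (normal_density 0 (sqrt (t - s)))) \<and>
     (\<forall>\<tau> n. incseq \<tau> \<and> 0 \<le> \<tau> 0 \<longrightarrow>
        prob_space.indep_vars P (\<lambda>_. borel) (\<lambda>i \<omega>. W (\<tau> (Suc i)) \<omega> - W (\<tau> i) \<omega>) {..<n::nat})"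

text \<open>Whole paths are independent: each process is one random variable valued in the path space.\<close>

definition independent_brownian_motions :: "'w measure \<Rightarrow> (nat \<Rightarrow> real \<Rightarrow> 'w \<Rightarrow> real) \<Rightarrow> nat set \<Rightarrow> bool" where
  "independent_brownian_motions P W I \<longleftrightarrow>
     (\<forall>r\<in>I. brownian_motion P (W r)) \<and>
     prob_space.indep_vars P (\<lambda>_. \<Pi>\<^sub>M t\<in>{0::real..}. borel) (\<lambda>r \<omega>. \<lambda>t\<in>{0..}. W r t \<omega>) I"

definition mean_sq :: "'w measure \<Rightarrow> ('w \<Rightarrow> 'b::real_normed_vector) \<Rightarrow> ennreal" where
  "mean_sq P X = (\<integral>\<^sup>+\<omega>. ennreal ((norm (X \<omega>))\<^sup>2) \<partial>P)"

definition msq_tendsto :: "'w measure \<Rightarrow> (nat \<Rightarrow> 'w \<Rightarrow> 'b::real_normed_vector) \<Rightarrow> ('w \<Rightarrow> 'b) \<Rightarrow> bool" where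
  "msq_tendsto P X Y \<longleftrightarrow> Y \<in> borel_measurable P \<and> (\<lambda>n. mean_sq P (\<lambda>\<omega>. X n \<omega> - Y \<omega>)) \<longlonglongrightarrow> 0"

definition noise_field :: "nat \<Rightarrow> (nat \<Rightarrow> real \<Rightarrow> 'w \<Rightarrow> real) \<Rightarrow> real \<Rightarrow> 'w \<Rightarrow> real \<Rightarrow> real" where
  "noise_field N \<xi> t \<omega> \<alpha> = (\<Sum>k=1..N. indicator (cell N k) \<alpha> * \<xi> k t \<omega>)"

lemma sq_int_noise_field: "sq_int (noise_field N \<xi> t \<omega>)"
proof -
  have cell: "cell N k \<in> sets borel" for k by (simp add: cell_def)
  have "sq_int (\<lambda>\<alpha>. \<Sum>k\<in>K. \<xi> k t \<omega> * indicator (cell N k) \<alpha>)" if "finite K" for K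
    using that
  proof (induction K)
    case empty
    show ?case unfolding sum.empty by (rule sq_int_zero)
  next
    case (insert k K)
    show ?case unfolding sum.insert[OF insert.hyps]
      by (intro sq_int_add sq_int_scale sq_int_indicator cell insert.IH)
  qed
  from this[of "{1..N}"] show ?thesis
    unfolding noise_field_def by (simp only: mult.commute finite_atLeastAtMost)
qed

text \<open>
  The integral $Z = \int_a^b F(s)\,dw_s$ of a deterministic operator-valued integrand: the
  mean-square limit of the elementary integrals $\sum_i G_{n,i}(w_{\tau_{n,i+1}}-w_{\tau_{n,i}})$
  of some step functions that converge to $F$ in $L_2([a,b])$ with respect to the operator norm.
\<close>

definition has_wiener_integral ::
  "'w measure \<Rightarrow> (real \<Rightarrow> 'w \<Rightarrow> L2I) \<Rightarrow> real \<Rightarrow> real \<Rightarrow> (real \<Rightarrow> L2I \<Rightarrow>\<^sub>L L2I) \<Rightarrow> ('w \<Rightarrow> L2I) \<Rightarrow> bool" where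
  "has_wiener_integral P w a b F Z \<longleftrightarrow>
     (\<exists>(m :: nat \<Rightarrow> nat) (\<tau> :: nat \<Rightarrow> nat \<Rightarrow> real) (G :: nat \<Rightarrow> nat \<Rightarrow> L2I \<Rightarrow>\<^sub>L L2I).
        (\<forall>n. \<tau> n 0 = a \<and> \<tau> n (m n) = b \<and> (\<forall>i<m n. \<tau> n i \<le> \<tau> n (Suc i))) \<and>
        (\<lambda>n. \<Sum>i<m n. \<integral>\<^sup>+s\<in>{\<tau> n i<..\<tau> n (Suc i)}. ennreal ((norm (G n i - F s))\<^sup>2) \<partial>lborel) \<longlonglongrightarrow> 0 \<and>
        msq_tendsto P (\<lambda>n \<omega>. \<Sum>i<m n. G n i (w (\<tau> n (Suc i)) \<omega> - w (\<tau> n i) \<omega>)) Z)"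

text \<open>
  The almost sure integrability of the paths makes the Bochner integral below meaningful. Adaptedness is
  not part of the notion: it is not needed for the defining identity, as the integrand of the
  stochastic integral is deterministic.
\<close>

definition mild_solution ::
  "'w measure \<Rightarrow> real \<Rightarrow> L2I \<Rightarrow>\<^sub>L L2I \<Rightarrow> L2I \<Rightarrow>\<^sub>L L2I \<Rightarrow> (real \<Rightarrow> 'w \<Rightarrow> L2I) \<Rightarrow> L2I
    \<Rightarrow> (real \<Rightarrow> 'w \<Rightarrow> L2I) \<Rightarrow> (real \<Rightarrow> 'w \<Rightarrow> L2I) \<Rightarrow> bool" where
  "mild_solution P T A B w x0 u x \<longleftrightarrow>
     (\<lambda>(t, \<omega>). x t \<omega>) \<in> borel_measurable (restrict_space borel {0..T} \<Otimes>\<^sub>M P) \<and>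
     (\<lambda>(t, \<omega>). u t \<omega>) \<in> borel_measurable (restrict_space borel {0..T} \<Otimes>\<^sub>M P) \<and>
     (AE \<omega> in P. set_integrable lborel {0..T} (\<lambda>t. x t \<omega>)) \<and>
     (AE \<omega> in P. set_integrable lborel {0..T} (\<lambda>t. u t \<omega>)) \<and>
     (\<forall>t\<in>{0..T}. \<exists>Z. has_wiener_integral P w 0 t (Phi A t) Z \<and>
        (AE \<omega> in P. x t \<omega> = Phi A t 0 x0 + (LINT s:{0..t}|lborel. Phi A t s (B (u s \<omega>))) + Z \<omega>))"

end

theory Submission
  imports Defs
begin

text \<open>
  The proof compares the two closed loops in mild form. With
  \<open>G t = R\<^sup>-\<^sup>1 B\<^sup>* S\<^sub>t\<close> the limit state satisfies
  \<open>x\<^sub>t = \<Phi>(t,0) x\<^sub>0 - \<integral>\<^sub>0\<^sup>t \<Phi>(t,s) B (G s) x\<^sub>s ds + Z\<^sub>t\<close>, where \<open>Z\<^sub>t\<close> is the Wiener integral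
  of \<open>\<Phi>(t,\<cdot>)\<close>, and \<open>x\<^sup>N\<close> satisfies the same equation with data that converge. Three ingredients
  have to converge uniformly in time: the propagators, the gains and the stochastic convolutions.
  A Gronwall argument then carries the convergence over to the states.

  Propagators. The exponential series is Lipschitz on bounded sets of operators
  (\<open>norm_op_exp_diff_le\<close>).

  Gains. The Riccati equation is only given for the quadratic forms \<open>\<langle>S\<^sub>t v, v\<rangle>\<close>. These are continuous
  in \<open>t\<close>, so the uniform boundedness principle makes \<open>S\<close> bounded on \<open>{0..T}\<close>. As the quadratic form
  of a self-adjoint operator determines its norm, comparing derivatives of quadratic forms
  gives Gronwall estimates in operator norm. The control term has a sign, which gives a bound on
  \<open>S\<^sup>N\<close> that depends on the norms of the data only; inside that ball the equation is Lipschitz in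
  \<open>S\<close> and in the data (\<open>riccati_stability\<close>, \<open>gain_uniform_limit\<close>).

  Stochastic convolutions. Each \<open>w\<^sup>N\<close> takes values in a finite-dimensional space and has the
  covariance of a Wiener process, so its elementary integrals satisfy one half of the Ito isometry,
  with a constant that is bounded in \<open>N\<close> (\<open>wiener_bound_finite_rank\<close>). The limit noise inherits the
  inequality. Thus both \<open>Z\<^sup>N\<^sub>t\<close> and \<open>Z\<^sub>t\<close> are close to elementary integrals on one and the same grid
  with a number of cells that depends neither on \<open>t\<close> nor on \<open>N\<close>, and on such a grid the mean-square
  convergence of the noise at single times, which is uniform in time, is enough
  (\<open>wiener_integral_convergence\<close>).

  States. A mild solution is only known to have integrable paths; its expected norm could be infinite
  a priori, and Gronwall's lemma says nothing about infinite functions. It is therefore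
  applied to the paths, and the expectation is taken afterwards (\<open>mean_gronwall\<close>). A first use shows that
  \<open>E \<integral> \<parallel>x\<^sub>t\<parallel> dt\<close> is finite, a second one bounds \<open>E \<parallel>x\<^sup>N\<^sub>t - x\<^sub>t\<parallel>\<close>.
\<close>

section \<open>Uniform boundedness\<close>

text \<open>
  By Baire's theorem one of the closed sets \<open>{x. \<forall>i\<in>I. norm (f i x) \<le> n}\<close> contains a ball.
  Moving its centre to the origin only doubles the bound.
\<close>
lemma uniform_boundedness:
  fixes f :: "'i \<Rightarrow> 'a::banach \<Rightarrow>\<^sub>L 'b::real_normed_vector"
  assumes bdd: "\<And>x. \<exists>C. \<forall>i\<in>I. norm (f i x) \<le> C"
  shows "\<exists>C. \<forall>i\<in>I. norm (f i) \<le> C"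
proof -
  define F where "F n = {x. \<forall>i\<in>I. norm (f i x) \<le> real n}" for n :: nat
  have closed: "closed (F n)" for n
  proof -
    have "F n = (\<Inter>i\<in>I. {x. norm (f i x) \<le> real n})" by (auto simp: F_def)
    then show ?thesis
      by (auto intro!: closed_INT closed_Collect_le continuous_intros)
  qed
  have "\<exists>n. interior (F n) \<noteq> {}"
  proof (rule ccontr)
    assume empty: "\<nexists>n. interior (F n) \<noteq> {}"
    have "euclidean interior_of \<Union>(range F) = {}"
    proof (rule Baire_category_alt)
      show "completely_metrizable_space (euclidean :: 'a topology) \<or> locally_compact_space (euclidean :: 'a topology) \<and> regular_space (euclidean :: 'a topology)"
        using completely_metrizable_space_euclidean by blast
      show "countable (range F)" by simp
      show "closedin euclidean X \<and> euclidean interior_of X = {}" if "X \<in> range F" for X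
        using that closed empty by auto
    qed
    moreover have "\<Union>(range F) = UNIV"
    proof (intro equalityI subset_UNIV subsetI)
      fix x
      obtain C where C: "\<forall>i\<in>I. norm (f i x) \<le> C" using bdd by blast
      obtain n where "C \<le> real n" using real_arch_simple by blast
      with C have "x \<in> F n" by (auto simp: F_def intro: order_trans)
      then show "x \<in> \<Union>(range F)" by blast
    qed
    ultimately show False by simp
  qed
  then obtain n x e where e: "e > 0" and ball: "ball x e \<subseteq> F n"
    by (metis all_not_in_conv mem_interior)
  have small: "norm (f i y) \<le> 2 * real n" if "i \<in> I" "norm y < e" for i y
  proof -
    have "x + y \<in> F n" "x \<in> F n" using ball that(2) e by (auto simp: dist_norm)
    then have "norm (f i (x + y)) \<le> n" "norm (f i x) \<le> n" using that(1) by (auto simp: F_def)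
    moreover have "f i y = f i (x + y) - f i x" by (simp add: blinfun.add_right)
    ultimately show ?thesis using norm_triangle_ineq4[of "f i (x + y)" "f i x"] by simp
  qed
  have "norm (f i) \<le> 4 * real n / e" if i: "i \<in> I" for i
  proof (rule norm_blinfun_bound)
    show "0 \<le> 4 * real n / e" using e by simp
    fix z
    show "norm (f i z) \<le> 4 * real n / e * norm z"
    proof (cases "z = 0")
      case False
      define y where "y = (e / (2 * norm z)) *\<^sub>R z"
      have "norm y < e" using False e by (simp add: y_def)
      from small[OF i this] have "e / (2 * norm z) * norm (f i z) \<le> 2 * real n"
        using e by (simp add: y_def blinfun.scaleR_right)
      then show ?thesis using False e by (simp add: field_simps)
    qed simp
  qed
  then show ?thesis by blast
qed

section \<open>Exponentials of bounded operators\<close>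

text \<open>
  Telescoping with \<open>A\<^sup>n\<^sup>+\<^sup>1 - B\<^sup>n\<^sup>+\<^sup>1 = A (A\<^sup>n - B\<^sup>n) + (A - B) B\<^sup>n\<close>, which holds for
  noncommuting operators as well.
\<close>
lemma norm_op_power_diff_le:
  assumes "norm A \<le> c" "norm B \<le> c"
  shows "norm (op_power A n - op_power B n) \<le> real n * c ^ (n - 1) * norm (A - B)"
proof (induction n)
  case (Suc n)
  have c: "0 \<le> c" using assms norm_ge_zero order_trans by blast
  have "op_power A (Suc n) - op_power B (Suc n)
      = (A o\<^sub>L (op_power A n - op_power B n)) + ((A - B) o\<^sub>L op_power B n)"
    by (rule blinfun_eqI) (simp add: blinfun.bilinear_simps)
  also have "norm \<dots> \<le> norm A * norm (op_power A n - op_power B n) + norm (A - B) * norm (op_power B n)"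
    by (intro order_trans[OF norm_triangle_ineq] add_mono norm_blinfun_compose)
  also have "\<dots> \<le> c * (real n * c ^ (n - 1) * norm (A - B)) + norm (A - B) * c ^ n"
  proof (intro add_mono mult_mono)
    show "norm (op_power B n) \<le> c ^ n"
      using norm_op_power[of B n] power_mono[OF assms(2), of n] by simp
  qed (use Suc assms c in auto)
  also have "\<dots> = real (Suc n) * c ^ (Suc n - 1) * norm (A - B)"
    by (cases n) (auto simp: algebra_simps)
  finally show ?case .
qed simp

lemma norm_op_exp_le: "norm (op_exp A) \<le> exp (norm A)"
proof -
  have le: "norm ((1 / fact n) *\<^sub>R op_power A n) \<le> inverse (fact n) * norm A ^ n" for n
    using norm_op_power[of A n] by (simp add: divide_inverse mult_left_mono)
  have "norm (op_exp A) \<le> (\<Sum>n. inverse (fact n) * norm A ^ n)"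
    unfolding op_exp_def
    by (intro norm_suminf_le le summable_exp)
  then show ?thesis by (simp add: exp_def)
qed

text \<open>
  The bounds for the powers add up to the termwise derivative of the exponential series. The
  estimate serves twice: for the dependence of \<^const>\<open>Phi\<close> on the generator and for its
  dependence on time.
\<close>
lemma norm_op_exp_diff_le:
  assumes "norm A \<le> c" "norm B \<le> c"
  shows "norm (op_exp A - op_exp B) \<le> exp c * norm (A - B)"
proof -
  define g where "g n = real n / fact n * c ^ (n - 1)" for n :: nat
  have gSuc: "g (Suc n) = inverse (fact n) * c ^ n" for n
  proof -
    have "real (Suc n) / fact (Suc n) = (1 / fact n :: real)"
      unfolding fact_Suc by (simp del: of_nat_Suc)
    then show ?thesis by (simp add: g_def divide_inverse)
  qed
  have g0: "g 0 = 0" by (simp add: g_def)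
  have "(\<lambda>n. inverse (fact n) * c ^ n) sums exp c"
    using summable_sums[OF summable_exp[of c]] by (simp add: exp_def)
  then have "(\<lambda>n. g (Suc n)) sums exp c" by (simp only: gSuc)
  then have "g sums (exp c + g 0)" by (rule sums_Suc)
  then have g: "(\<lambda>n. g n * norm (A - B)) sums (exp c * norm (A - B))"
    by (intro sums_mult2) (simp add: g0)
  have "op_exp A - op_exp B = (\<Sum>n. (1 / fact n) *\<^sub>R op_power A n - (1 / fact n) *\<^sub>R op_power B n)"
    unfolding op_exp_def by (rule suminf_diff[OF summable_op_exp summable_op_exp])
  also have "norm \<dots> \<le> (\<Sum>n. g n * norm (A - B))"
  proof (rule norm_suminf_le)
    show "summable (\<lambda>n. g n * norm (A - B))" using g by (rule sums_summable)
    fix n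
    have "norm ((1 / fact n) *\<^sub>R op_power A n - (1 / fact n) *\<^sub>R op_power B n)
        = (1 / fact n) * norm (op_power A n - op_power B n)"
      by (simp flip: scaleR_diff_right)
    also have "\<dots> \<le> (1 / fact n) * (real n * c ^ (n - 1) * norm (A - B))"
      by (intro mult_left_mono norm_op_power_diff_le assms) simp
    finally show "norm ((1 / fact n) *\<^sub>R op_power A n - (1 / fact n) *\<^sub>R op_power B n) \<le> g n * norm (A - B)"
      by (simp add: g_def)
  qed
  also have "\<dots> = exp c * norm (A - B)" using g by (rule sums_unique[symmetric])
  finally show ?thesis .
qed

lemma norm_Phi_le:
  assumes "norm A \<le> c" "0 \<le> s" "s \<le> t" "t \<le> T"
  shows "norm (Phi A t s) \<le> exp (T * c)"
proof -
  have "norm ((t - s) *\<^sub>R A) \<le> T * c"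
    unfolding norm_scaleR using assms by (intro mult_mono) auto
  then show ?thesis unfolding Phi_def using norm_op_exp_le[of "(t - s) *\<^sub>R A"] by (meson exp_le_cancel_iff order_trans)
qed

lemma norm_Phi_diff_le:
  assumes "norm A \<le> c" "norm B \<le> c" "0 \<le> s" "s \<le> t" "t \<le> T"
  shows "norm (Phi A t s - Phi B t s) \<le> exp (T * c) * (T * norm (A - B))"
proof -
  have le: "norm ((t - s) *\<^sub>R X) \<le> T * c" if "norm X \<le> c" for X :: "L2I \<Rightarrow>\<^sub>L L2I"
    unfolding norm_scaleR using assms(3-) that by (intro mult_mono) auto
  have "norm (Phi A t s - Phi B t s) \<le> exp (T * c) * norm ((t - s) *\<^sub>R A - (t - s) *\<^sub>R B)"
    unfolding Phi_def by (intro norm_op_exp_diff_le le assms)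
  also have "\<dots> \<le> exp (T * c) * (T * norm (A - B))"
    using assms(3-) by (simp flip: scaleR_diff_right add: mult_right_mono)
  finally show ?thesis .
qed

lemma norm_Phi_lipschitz:
  assumes "norm A \<le> c" "0 \<le> s" "s \<le> t" "0 \<le> r" "r \<le> t" "t \<le> T"
  shows "norm (Phi A t s - Phi A t r) \<le> exp (T * c) * c * \<bar>s - r\<bar>"
proof -
  have le: "norm ((t - s) *\<^sub>R A) \<le> T * c" if "0 \<le> s" "s \<le> t" for s
    unfolding norm_scaleR using assms that by (intro mult_mono) auto
  have "norm (Phi A t s - Phi A t r) \<le> exp (T * c) * norm ((t - s) *\<^sub>R A - (t - r) *\<^sub>R A)"
    unfolding Phi_def by (intro norm_op_exp_diff_le le assms)
  also have "norm ((t - s) *\<^sub>R A - (t - r) *\<^sub>R A) = \<bar>s - r\<bar> * norm A"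
    by (simp flip: scaleR_diff_left add: abs_minus_commute)
  also have "exp (T * c) * (\<bar>s - r\<bar> * norm A) \<le> exp (T * c) * (\<bar>s - r\<bar> * c)"
    using assms by (intro mult_left_mono) auto
  finally show ?thesis by (simp add: mult_ac)
qed

lemma continuous_on_Phi: "continuous_on {0..t} (Phi A t)"
proof (cases "0 \<le> t")
  case True
  have "(exp (t * norm A) * norm A)-lipschitz_on {0..t} (Phi A t)"
    by (rule lipschitz_onI) (use norm_Phi_lipschitz[of A "norm A" _ t _ t] in \<open>auto simp: dist_norm dist_real_def\<close>)
  then show ?thesis by (rule lipschitz_on_continuous_on)
qed simp

text \<open>
  The space of bounded operators is not separable, so measurability of \<open>s \<mapsto> \<Phi>(t,s)\<close> and of
  \<open>v\<close> does not by itself give measurability of \<open>s \<mapsto> \<Phi>(t,s) v\<^sub>s\<close>. The partial sums of the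
  exponential series, applied to \<open>v\<^sub>s\<close>, are measurable term by term.
\<close>
lemma borel_measurable_Phi_apply:
  assumes "v \<in> borel_measurable M" "f \<in> borel_measurable M"
  shows "(\<lambda>s. Phi A t (f s) (v s)) \<in> borel_measurable M"
proof (rule borel_measurable_LIMSEQ_metric)
  show "(\<lambda>s. \<Sum>n<k. ((t - f s) ^ n / fact n) *\<^sub>R op_power A n (v s)) \<in> borel_measurable M" for k
  proof (intro borel_measurable_sum borel_measurable_scaleR)
    show "(\<lambda>s. (t - f s) ^ n / fact n) \<in> borel_measurable M" for n using assms(2) by measurable
    show "(\<lambda>s. op_power A n (v s)) \<in> borel_measurable M" for n
      by (rule measurable_compose[OF assms(1)]) (intro borel_measurable_continuous_onI continuous_intros)
  qed
  fix s
  have pow: "op_power (c *\<^sub>R A) n = c ^ n *\<^sub>R op_power A n" for c n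
    by (induction n) (auto intro!: blinfun_eqI simp: blinfun.bilinear_simps)
  have "(\<lambda>n. (1 / fact n) *\<^sub>R op_power ((t - f s) *\<^sub>R A) n) sums Phi A t (f s)"
    unfolding Phi_def op_exp_def by (rule summable_sums[OF summable_op_exp])
  then have "(\<lambda>n. ((t - f s) ^ n / fact n) *\<^sub>R op_power A n) sums Phi A t (f s)"
    by (simp add: pow)
  then have "(\<lambda>n. (((t - f s) ^ n / fact n) *\<^sub>R op_power A n) (v s)) sums Phi A t (f s) (v s)"
    by (rule bounded_linear.sums[OF blinfun.bounded_linear_left])
  then show "(\<lambda>k. \<Sum>n<k. ((t - f s) ^ n / fact n) *\<^sub>R op_power A n (v s)) \<longlonglongrightarrow> Phi A t (f s) (v s)"
    by (simp add: sums_def blinfun.scaleR_left)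
qed

section \<open>Self-adjoint and coercive operators\<close>

lemma blinfun_inner_le: "\<bar>inner (D v) w\<bar> \<le> norm D * norm v * norm w"
  for D :: "'a::real_inner \<Rightarrow>\<^sub>L 'b::real_inner"
  by (rule order_trans[OF Cauchy_Schwarz_ineq2]) (intro mult_right_mono norm_blinfun norm_ge_zero)

lemma blinfun_quadratic_le: "\<bar>inner (D v) v\<bar> \<le> norm D * (norm v)\<^sup>2"
  for D :: "'a::real_inner \<Rightarrow>\<^sub>L 'a"
  using blinfun_inner_le[of D v v] by (simp add: power2_eq_square mult.assoc)

lemma self_adjoint_opD: "self_adjoint_op A \<Longrightarrow> inner (A v) y = inner v (A y)"
  by (simp add: self_adjoint_op_def)

lemma polarization:
  assumes "self_adjoint_op D"
  shows "4 * inner (D v) w = inner (D (v + w)) (v + w) - inner (D (v - w)) (v - w)"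
  using self_adjoint_opD[OF assms, of v w] self_adjoint_opD[OF assms, of w v]
  by (simp add: blinfun.bilinear_simps inner_simps inner_commute)

text \<open>
  Polarization with a second vector parallel to \<open>D v\<close> and as long as \<open>v\<close>; the parallelogram law makes
  the constant exact. This is what turns information about quadratic forms, the only
  information that the Riccati equation gives, into operator norm estimates.
\<close>
lemma norm_self_adjoint_le:
  assumes D: "self_adjoint_op D" and q: "\<And>v. \<bar>inner (D v) v\<bar> \<le> q * (norm v)\<^sup>2" and "0 \<le> q"
  shows "norm D \<le> q"
proof (rule norm_blinfun_bound[OF \<open>0 \<le> q\<close>])
  fix v
  show "norm (D v) \<le> q * norm v"
  proof (cases "D v = 0")
    case False
    \<comment> \<open>This choice gives \<open>inner (D v) w = norm v * norm (D v)\<close>.\<close>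
    define w where "w = (norm v / norm (D v)) *\<^sub>R D v"
    have w: "norm w = norm v" using False by (simp add: w_def)
    have "4 * (norm v * norm (D v)) = 4 * inner (D v) w"
      using False by (simp add: w_def dot_square_norm power2_eq_square)
    also have "\<dots> \<le> q * (norm (v + w))\<^sup>2 + q * (norm (v - w))\<^sup>2"
      unfolding polarization[OF D] using q[of "v + w"] q[of "v - w"] by (simp add: abs_le_iff)
    also have "\<dots> = 4 * (norm v * (q * norm v))"
      using w by (simp add: dot_square_norm[symmetric] inner_simps inner_commute algebra_simps)
        (simp add: dot_square_norm power2_eq_square algebra_simps)
    finally have "norm v * norm (D v) \<le> norm v * (q * norm v)" by simp
    moreover have "norm v > 0" using False by auto
    ultimately show ?thesis by simp
  qed (use \<open>0 \<le> q\<close> in simp)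
qed

text \<open>
  Fubini's theorem and the symmetry of the kernel; the double integral converges absolutely because the
  kernel is bounded and square integrable functions on \<open>{0..1}\<close> are integrable.
\<close>
lemma self_adjoint_graphon:
  assumes K: "graphon K"
  shows "self_adjoint_op (kernel_op K + a *\<^sub>R id_blinfun)"
proof -
  interpret pair_prob_space leb01 leb01 ..
  have "inner (kernel_op K x) y = inner x (kernel_op K y)" for x y
  proof -
    obtain f where f: "sq_int f" and x: "x = abs_L2I f" by (rule L2I_cases)
    obtain g where g: "sq_int g" and y: "y = abs_L2I g" by (rule L2I_cases)
    have [measurable]: "f \<in> borel_measurable leb01" "g \<in> borel_measurable leb01"
      using f g by (auto intro: sq_int_measurable)
    have Km[measurable]: "(\<lambda>(\<alpha>, \<beta>). K \<alpha> \<beta>) \<in> borel_measurable (leb01 \<Otimes>\<^sub>M leb01)"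
      using K by (simp add: graphon_def)
    obtain b where b: "\<And>\<alpha> \<beta>. \<alpha> \<in> {0..1} \<Longrightarrow> \<beta> \<in> {0..1} \<Longrightarrow> \<bar>K \<alpha> \<beta>\<bar> \<le> b"
      using K unfolding graphon_def by blast
    have sym: "K \<alpha> \<beta> = K \<beta> \<alpha>" if "\<alpha> \<in> {0..1}" "\<beta> \<in> {0..1}" for \<alpha> \<beta>
      using K that unfolding graphon_def by blast
    have fi: "integrable leb01 f" and gi: "integrable leb01 g"
      using f g by (auto intro: sq_int_integrable)
    have prod: "integrable (leb01 \<Otimes>\<^sub>M leb01) (\<lambda>(\<alpha>, \<beta>). g \<alpha> * f \<beta>)"
    proof (rule Fubini_integrable)
      show "integrable leb01 (\<lambda>x. \<integral>y. norm (case (x, y) of (\<alpha>, \<beta>) \<Rightarrow> g \<alpha> * f \<beta>) \<partial>leb01)"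
        using gi by (simp add: abs_mult)
    qed (use fi in auto)
    have int: "integrable (leb01 \<Otimes>\<^sub>M leb01) (\<lambda>(\<alpha>, \<beta>). K \<alpha> \<beta> * f \<beta> * g \<alpha>)"
    proof (rule Bochner_Integration.integrable_bound)
      show "integrable (leb01 \<Otimes>\<^sub>M leb01) (\<lambda>p. b * (case p of (\<alpha>, \<beta>) \<Rightarrow> g \<alpha> * f \<beta>))"
        using prod by simp
      have "\<bar>K \<alpha> \<beta> * f \<beta> * g \<alpha>\<bar> \<le> \<bar>b * (g \<alpha> * f \<beta>)\<bar>" if "\<alpha> \<in> {0..1}" "\<beta> \<in> {0..1}" for \<alpha> \<beta>
        using b[OF that] mult_right_mono[of "\<bar>K \<alpha> \<beta>\<bar>" "\<bar>b\<bar>" "\<bar>f \<beta>\<bar> * \<bar>g \<alpha>\<bar>"] by (simp add: abs_mult mult_ac)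
      then show "AE p in leb01 \<Otimes>\<^sub>M leb01. norm (case p of (\<alpha>, \<beta>) \<Rightarrow> K \<alpha> \<beta> * f \<beta> * g \<alpha>)
          \<le> norm (b * (case p of (\<alpha>, \<beta>) \<Rightarrow> g \<alpha> * f \<beta>))"
        by (intro AE_I2) (auto simp: space_pair_measure)
    qed measurable
    have "inner (kernel_op K x) y = (\<integral>\<alpha>. (\<integral>\<beta>. K \<alpha> \<beta> * f \<beta> \<partial>leb01) * g \<alpha> \<partial>leb01)"
      unfolding x y kernel_op_abs[OF graphon_L2_kernel[OF K] f]
      by (rule inner_abs_L2I[OF sq_int_kernel[OF graphon_L2_kernel[OF K] f] g])
    also have "\<dots> = (\<integral>\<alpha>. (\<integral>\<beta>. K \<alpha> \<beta> * f \<beta> * g \<alpha> \<partial>leb01) \<partial>leb01)" by simp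
    also have "\<dots> = (\<integral>\<beta>. (\<integral>\<alpha>. K \<alpha> \<beta> * f \<beta> * g \<alpha> \<partial>leb01) \<partial>leb01)"
      by (rule Fubini_integral[OF int, symmetric])
    also have "\<dots> = (\<integral>\<beta>. f \<beta> * (\<integral>\<alpha>. K \<beta> \<alpha> * g \<alpha> \<partial>leb01) \<partial>leb01)"
    proof (rule Bochner_Integration.integral_cong[OF refl])
      fix \<beta> assume "\<beta> \<in> space leb01"
      then have "(\<integral>\<alpha>. K \<alpha> \<beta> * f \<beta> * g \<alpha> \<partial>leb01) = (\<integral>\<alpha>. f \<beta> * (K \<beta> \<alpha> * g \<alpha>) \<partial>leb01)"
        by (intro Bochner_Integration.integral_cong) (use sym[of \<beta>] in auto)
      then show "(\<integral>\<alpha>. K \<alpha> \<beta> * f \<beta> * g \<alpha> \<partial>leb01) = f \<beta> * (\<integral>\<alpha>. K \<beta> \<alpha> * g \<alpha> \<partial>leb01)" by simp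
    qed
    also have "\<dots> = inner x (kernel_op K y)"
      unfolding x y kernel_op_abs[OF graphon_L2_kernel[OF K] g]
      by (rule inner_abs_L2I[OF f sq_int_kernel[OF graphon_L2_kernel[OF K] g], symmetric])
    finally show ?thesis .
  qed
  then show ?thesis
    by (simp add: self_adjoint_op_def blinfun.bilinear_simps inner_simps)
qed

definition coercive_op :: "real \<Rightarrow> 'a::real_inner \<Rightarrow>\<^sub>L 'a \<Rightarrow> bool" where
  "coercive_op r R \<longleftrightarrow> r > 0 \<and> (\<forall>v. r * (norm v)\<^sup>2 \<le> inner (R v) v)"

text \<open>
  Meaningful when \<open>inv R\<close> is a bounded linear map, as it is for coercive \<open>R\<close>
  (\<open>op_inverse_apply\<close> below).
\<close>
definition op_inverse :: "'a::real_normed_vector \<Rightarrow>\<^sub>L 'a \<Rightarrow> 'a \<Rightarrow>\<^sub>L 'a" where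
  "op_inverse R = Blinfun (inv (blinfun_apply R))"

lemma coercive_op_lower_bound:
  assumes "coercive_op r R" shows "r * norm v \<le> norm (R v)"
proof (cases "v = 0")
  case False
  have "r * (norm v)\<^sup>2 \<le> norm (R v) * norm v"
    using assms norm_cauchy_schwarz[of "R v" v] unfolding coercive_op_def by (blast intro: order_trans)
  then show ?thesis using False by (simp add: power2_eq_square mult.assoc[symmetric])
qed simp

text \<open>
  Surjectivity is the Lax-Milgram theorem. In a Hilbert space \<open>R x = y\<close> is solved by the fixed point of
  \<open>x \<mapsto> x - l (R x - y)\<close>, a contraction for small \<open>l\<close>.
\<close>
lemma coercive_op_bij:
  fixes R :: "'a::{real_inner,banach} \<Rightarrow>\<^sub>L 'a"
  assumes R: "coercive_op r R" shows "bij (blinfun_apply R)"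
proof (rule bijI)
  have r: "r > 0" using R by (simp add: coercive_op_def)
  show "inj (blinfun_apply R)"
  proof (rule injI)
    fix x y assume "R x = R y"
    then have "r * norm (x - y) \<le> 0"
      using coercive_op_lower_bound[OF R, of "x - y"] by (simp add: blinfun.diff_right)
    then show "x = y" using r by (simp add: mult_le_0_iff)
  qed
  show "surj (blinfun_apply R)"
  proof (rule surjI)
    define K where "K = max (norm R) r"
    \<comment> \<open>The factor \<open>1 - 2 l r + l\<^sup>2 K\<^sup>2\<close> by which the map shrinks squared distances is smallest at \<open>l = r / K\<^sup>2\<close>.\<close>
    define l where "l = r / K\<^sup>2"
    define c where "c = sqrt (1 - (r / K)\<^sup>2)"
    have K: "K > 0" "r \<le> K" "norm R \<le> K" using r by (auto simp: K_def)
    have "r / K \<le> 1" "r / K > 0" using K r by auto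
    then have rK: "(r / K)\<^sup>2 \<le> 1" "(r / K)\<^sup>2 > 0" by (auto simp: power_le_one)
    have contr: "norm (x - l *\<^sub>R R x) \<le> c * norm x" for x
    proof (rule power2_le_imp_le)
      have Rx: "(norm (R x))\<^sup>2 \<le> (K * norm x)\<^sup>2"
        using norm_blinfun[of R x] mult_right_mono[OF K(3), of "norm x"] by (intro power_mono) auto
      have lower: "r * (norm x)\<^sup>2 \<le> inner (R x) x" using R by (simp add: coercive_op_def)
      have l: "l > 0" using K r by (simp add: l_def)
      have "(norm (x - l *\<^sub>R R x))\<^sup>2 = (norm x)\<^sup>2 - 2 * l * inner (R x) x + l\<^sup>2 * (norm (R x))\<^sup>2"
        unfolding power2_norm_eq_inner by (simp add: inner_simps inner_commute power2_eq_square)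
      also have "\<dots> \<le> (norm x)\<^sup>2 - 2 * l * (r * (norm x)\<^sup>2) + l\<^sup>2 * (K * norm x)\<^sup>2"
        using lower Rx l by (intro add_mono diff_mono mult_left_mono) auto
      also have "\<dots> = (1 - (r / K)\<^sup>2) * (norm x)\<^sup>2"
        using K by (simp add: l_def field_simps power2_eq_square)
      also have "\<dots> = (c * norm x)\<^sup>2" using rK by (simp add: c_def power_mult_distrib)
      finally show "(norm (x - l *\<^sub>R R x))\<^sup>2 \<le> (c * norm x)\<^sup>2" .
      show "0 \<le> c * norm x" using rK by (simp add: c_def)
    qed
    have ex: "\<exists>x. R x = y" for y
    proof -
      have "\<exists>!x. x - l *\<^sub>R (R x - y) = x"
      proof (rule banach_fix_type)
        show "0 \<le> c" "c < 1" using rK by (auto simp: c_def)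
        show "\<forall>x z. dist (x - l *\<^sub>R (R x - y)) (z - l *\<^sub>R (R z - y)) \<le> c * dist x z"
        proof (intro allI)
          fix x z
          have "(x - l *\<^sub>R (R x - y)) - (z - l *\<^sub>R (R z - y)) = (x - z) - l *\<^sub>R R (x - z)"
            by (simp add: blinfun.diff_right scaleR_diff_right)
          with contr[of "x - z"] show "dist (x - l *\<^sub>R (R x - y)) (z - l *\<^sub>R (R z - y)) \<le> c * dist x z"
            by (simp only: dist_norm)
        qed
      qed
      then obtain x where "x - l *\<^sub>R (R x - y) = x" by blast
      then have "l *\<^sub>R (R x - y) = 0" by simp
      then show ?thesis using K r by (auto simp: l_def)
    qed
    show "R (SOME x. R x = y) = y" for y using ex[of y] by (rule someI_ex)
  qed
qed

lemma
  fixes R :: "'a::{real_inner,banach} \<Rightarrow>\<^sub>L 'a"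
  assumes R: "coercive_op r R"
  shows op_inverse_apply: "blinfun_apply (op_inverse R) = inv (blinfun_apply R)"
    and norm_op_inverse_le: "norm (op_inverse R) \<le> 1 / r"
proof -
  have r: "r > 0" using R by (simp add: coercive_op_def)
  note bij = coercive_op_bij[OF R]
  have inv: "R (inv R y) = y" for y using bij by (simp add: bij_is_surj surj_f_inv_f)
  have inj: "x = y" if "R x = R y" for x y using bij that by (meson bij_is_inj injD)
  have le: "norm (inv R y) \<le> norm y * (1 / r)" for y
    using coercive_op_lower_bound[OF R, of "inv R y"] r by (simp add: inv field_simps)
  have "bounded_linear (inv (blinfun_apply R))"
  proof (rule bounded_linear_intro[where K="1 / r"])
    show "inv R (x + y) = inv R x + inv R y" for x y
      by (rule inj) (simp add: inv blinfun.add_right)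
    show "inv R (c *\<^sub>R x) = c *\<^sub>R inv R x" for c x
      by (rule inj) (simp add: inv blinfun.scaleR_right)
  qed (rule le)
  then show eq: "blinfun_apply (op_inverse R) = inv (blinfun_apply R)"
    unfolding op_inverse_def by (rule bounded_linear_Blinfun_apply)
  show "norm (op_inverse R) \<le> 1 / r"
    by (rule norm_blinfun_bound) (use le r in \<open>auto simp: eq mult.commute\<close>)
qed

lemma
  fixes R :: "'a::{real_inner,banach} \<Rightarrow>\<^sub>L 'a"
  assumes R: "coercive_op r R"
  shows op_inverse_right: "R (op_inverse R y) = y"
    and op_inverse_left: "op_inverse R (R y) = y"
  using coercive_op_bij[OF R]
  by (simp_all add: op_inverse_apply[OF R] bij_is_surj surj_f_inv_f bij_is_inj)

text \<open>
  The resolvent identity \<open>R\<^sub>1\<^sup>-\<^sup>1 - R\<^sub>2\<^sup>-\<^sup>1 = R\<^sub>1\<^sup>-\<^sup>1 (R\<^sub>2 - R\<^sub>1) R\<^sub>2\<^sup>-\<^sup>1\<close>.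
\<close>
lemma norm_op_inverse_diff_le:
  fixes R1 R2 :: "'a::{real_inner,banach} \<Rightarrow>\<^sub>L 'a"
  assumes "coercive_op r1 R1" "coercive_op r2 R2"
  shows "norm (op_inverse R1 - op_inverse R2) \<le> 1 / r1 * norm (R2 - R1) * (1 / r2)"
proof -
  have "op_inverse R1 - op_inverse R2 = op_inverse R1 o\<^sub>L ((R2 - R1) o\<^sub>L op_inverse R2)"
    by (rule blinfun_eqI) (simp add: blinfun.bilinear_simps op_inverse_right[OF assms(2)] op_inverse_left[OF assms(1)])
  also have "norm \<dots> \<le> norm (op_inverse R1) * (norm (R2 - R1) * norm (op_inverse R2))"
    by (rule order_trans[OF norm_blinfun_compose]) (intro mult_left_mono norm_blinfun_compose norm_ge_zero)
  also have "\<dots> \<le> 1 / r1 * (norm (R2 - R1) * (1 / r2))"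
    using assms by (intro mult_mono norm_op_inverse_le) (auto simp: coercive_op_def)
  finally show ?thesis by (simp add: mult.assoc)
qed

lemma coercive_op_perturb:
  assumes "coercive_op r R" "norm (R' - R) \<le> r / 2"
  shows "coercive_op (r / 2) R'"
  unfolding coercive_op_def
proof (intro conjI allI)
  show "r / 2 > 0" using assms by (simp add: coercive_op_def)
  fix v
  have "inner (R' v) v = inner (R v) v + inner ((R' - R) v) v"
    by (simp add: blinfun.bilinear_simps inner_simps)
  moreover have "\<bar>inner ((R' - R) v) v\<bar> \<le> r / 2 * (norm v)\<^sup>2"
    using blinfun_quadratic_le[of "R' - R" v] mult_right_mono[OF assms(2), of "(norm v)\<^sup>2"] by simp
  moreover have "r * (norm v)\<^sup>2 \<le> inner (R v) v" using assms by (simp add: coercive_op_def)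
  ultimately show "r / 2 * (norm v)\<^sup>2 \<le> inner (R' v) v" by (simp add: abs_le_iff)
qed

lemma nonneg_plus_scalar_coercive:
  assumes "nonneg_plus_scalar R" shows "\<exists>r. coercive_op r R"
  using assms unfolding nonneg_plus_scalar_def nonneg_op_def coercive_op_def
  by (auto simp: blinfun.bilinear_simps inner_simps dot_square_norm)

lemma coercive_op_inverse_tendsto:
  fixes R :: "'a::{real_inner,banach} \<Rightarrow>\<^sub>L 'a"
  assumes R: "coercive_op r R" and lim: "RN \<longlonglongrightarrow> R"
  shows "\<forall>\<^sub>F N in sequentially. coercive_op (r / 2) (RN N)"
    and "(\<lambda>N. op_inverse (RN N)) \<longlonglongrightarrow> op_inverse R"
proof -
  have r: "r > 0" using R by (simp add: coercive_op_def)
  then have "\<forall>\<^sub>F N in sequentially. dist (RN N) R < r / 2" using lim by (intro tendstoD) auto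
  then show ev: "\<forall>\<^sub>F N in sequentially. coercive_op (r / 2) (RN N)"
    by eventually_elim (auto intro: coercive_op_perturb[OF R] simp: dist_norm)
  have "\<forall>\<^sub>F N in sequentially. norm (op_inverse (RN N) - op_inverse R) \<le> 1 / (r / 2) * norm (R - RN N) * (1 / r)"
    using ev by eventually_elim (rule norm_op_inverse_diff_le[OF _ R])
  moreover
  have "(\<lambda>N. 1 / (r / 2) * norm (R - RN N) * (1 / r)) \<longlonglongrightarrow> 1 / (r / 2) * norm (R - R) * (1 / r)"
    by (intro tendsto_intros lim)
  then have "(\<lambda>N. 1 / (r / 2) * norm (R - RN N) * (1 / r)) \<longlonglongrightarrow> 0" by simp
  ultimately have "(\<lambda>N. op_inverse (RN N) - op_inverse R) \<longlonglongrightarrow> 0"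
    by (rule Lim_null_comparison)
  then show "(\<lambda>N. op_inverse (RN N)) \<longlonglongrightarrow> op_inverse R" by (rule LIM_zero_cancel)
qed

section \<open>Stability of the Riccati equation\<close>

text \<open>
  Gronwall's lemma for functions that are merely bounded. The hypothesis \<open>step\<close> says that a bound
  \<open>m exp (2 L (T - s))\<close> improves itself to half of it plus \<open>k\<close>; applied to the least such \<open>m\<close> it gives
  \<open>m \<le> k + m / 2\<close>. The factor 2 in the exponent is what makes the integral of \<open>L\<close> times the
  bound half as large as the bound.
\<close>
lemma backward_gronwall:
  fixes n :: "real \<Rightarrow> real"
  assumes T: "0 \<le> T" and bdd: "\<And>t. t \<in> {0..T} \<Longrightarrow> 0 \<le> n t \<and> n t \<le> C"
    and L: "L > 0" and k: "k \<ge> 0"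
    and step: "\<And>m t. \<lbrakk>\<And>s. s \<in> {0..T} \<Longrightarrow> n s \<le> m * exp (2 * L * (T - s)); t \<in> {0..T}\<rbrakk>
      \<Longrightarrow> n t \<le> k + m / 2 * exp (2 * L * (T - t))"
    and t: "t \<in> {0..T}"
  shows "n t \<le> 2 * k * exp (2 * L * T)"
proof -
  define f where "f s = n s * exp (- (2 * L * (T - s)))" for s
  define m where "m = Sup (f ` {0..T})"
  have f_eq: "n s = f s * exp (2 * L * (T - s))" for s
    by (simp add: f_def mult.assoc exp_add[symmetric])
  have le1: "exp (- (2 * L * (T - s))) \<le> 1" if "s \<in> {0..T}" for s using that L by simp
  have "f s \<le> C" if "s \<in> {0..T}" for s
    using bdd[OF that] mult_left_mono[OF le1[OF that], of "n s"] by (simp add: f_def)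
  then have "bdd_above (f ` {0..T})" by (intro bdd_aboveI2) auto
  then have fm: "f s \<le> m" if "s \<in> {0..T}" for s
    unfolding m_def using that by (rule cSUP_upper2) auto
  have nm: "n s \<le> m * exp (2 * L * (T - s))" if "s \<in> {0..T}" for s
    unfolding f_eq using fm[OF that] by simp
  have st: "n s \<le> k + m / 2 * exp (2 * L * (T - s))" if "s \<in> {0..T}" for s
    by (rule step) (use nm that in auto)
  have "f s \<le> k + m / 2" if s: "s \<in> {0..T}" for s
  proof -
    have "f s \<le> (k + m / 2 * exp (2 * L * (T - s))) * exp (- (2 * L * (T - s)))"
      unfolding f_def using st[OF s] by (intro mult_right_mono) auto
    also have "\<dots> = k * exp (- (2 * L * (T - s))) + m / 2"
      by (simp add: distrib_right mult.assoc exp_add[symmetric])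
    also have "\<dots> \<le> k + m / 2"
      using mult_left_mono[OF le1[OF s] k] by simp
    finally show ?thesis .
  qed
  then have "m \<le> k + m / 2" unfolding m_def by (intro cSUP_least) (use T in auto)
  then have "f t \<le> 2 * k" using fm[OF t] by linarith
  moreover have "exp (2 * L * (T - t)) \<le> exp (2 * L * T)" using t L by simp
  ultimately show ?thesis unfolding f_eq using k bdd[OF t]
    by (intro mult_mono) auto
qed

text \<open>
  Produces the hypothesis \<open>step\<close> of \<open>backward_gronwall\<close> for a quadratic form \<open>g\<close>, with
  \<open>q = (norm v)\<^sup>2\<close>: the bound on the slope is integrated from \<open>t\<close> to \<open>T\<close>, and the boundary term
  \<open>- m q / 2\<close> at \<open>T\<close> is discarded.
\<close>
lemma backward_comparison:
  fixes g :: "real \<Rightarrow> real"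
  assumes der: "\<And>s. s \<in> {0..T} \<Longrightarrow> (g has_real_derivative - d s) (at s within {0..T})"
    and d: "\<And>s. s \<in> {0..T} \<Longrightarrow> d s \<le> (L * (m * exp (2 * L * (T - s))) + e) * q"
    and t: "t \<in> {0..T}" and L: "L > 0" and "0 \<le> m" "0 \<le> e" "0 \<le> q"
  shows "g t \<le> g T + (m / 2 * exp (2 * L * (T - t)) + T * e) * q"
proof -
  define f where "f s = g s - (m / 2 * exp (2 * L * (T - s)) - e * s) * q" for s
  have der_f: "(f has_real_derivative - d s + (L * (m * exp (2 * L * (T - s))) + e) * q) (at s within {0..T})"
    if "s \<in> {0..T}" for s
    unfolding f_def
    by (auto intro!: derivative_eq_intros der[OF that] simp: algebra_simps)
  have "f t \<le> f T"
  proof (cases "t = T")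
    case False
    with t have "t < T" by simp
    moreover have "(f has_derivative (*) (- d s + (L * (m * exp (2 * L * (T - s))) + e) * q)) (at s within {t..T})"
      if "t \<le> s" "s \<le> T" for s
      using has_field_derivative_subset[OF der_f, of s "{t..T}"] that t
      by (simp add: has_field_derivative_def)
    ultimately obtain s where s: "s \<in> {t<..<T}"
      and "f T - f t = (- d s + (L * (m * exp (2 * L * (T - s))) + e) * q) * (T - t)"
      using mvt_simple[of t T f "\<lambda>s. (*) (- d s + (L * (m * exp (2 * L * (T - s))) + e) * q)"] by blast
    moreover have "0 \<le> - d s + (L * (m * exp (2 * L * (T - s))) + e) * q"
      using d[of s] s t by simp
    ultimately show ?thesis using s by (smt (verit, best) greaterThanLessThan_iff mult_nonneg_nonneg)
  qed simp
  then have "g t \<le> g T + (m / 2 * exp (2 * L * (T - t)) + e * (T - t)) * q - m / 2 * q"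
    by (simp add: f_def algebra_simps)
  also have "\<dots> \<le> g T + (m / 2 * exp (2 * L * (T - t)) + T * e) * q"
  proof -
    have "e * (T - t) * q \<le> T * e * q"
      using t \<open>0 \<le> e\<close> \<open>0 \<le> q\<close> by (intro mult_right_mono) (auto simp: algebra_simps)
    moreover have "0 \<le> m / 2 * q" using \<open>0 \<le> m\<close> \<open>0 \<le> q\<close> by simp
    ultimately show ?thesis by (simp add: distrib_right)
  qed
  finally show ?thesis .
qed

lemma adjoint_self_adjoint: "self_adjoint_op B \<Longrightarrow> adjoint (blinfun_apply B) = blinfun_apply B"
  by (rule adjoint_unique) (simp add: self_adjoint_opD)

text \<open>
  The feedback operator \<open>R\<^sup>-\<^sup>1 B\<^sup>* S\<close> for self-adjoint \<open>B\<close>.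
\<close>
definition gain :: "L2I \<Rightarrow>\<^sub>L L2I \<Rightarrow> L2I \<Rightarrow>\<^sub>L L2I \<Rightarrow> L2I \<Rightarrow>\<^sub>L L2I \<Rightarrow> L2I \<Rightarrow>\<^sub>L L2I" where
  "gain B R S = op_inverse R o\<^sub>L (B o\<^sub>L S)"

lemma feedback_eq_gain:
  assumes "coercive_op r R" "self_adjoint_op B"
  shows "feedback B R S v = gain B R S v"
  using assms by (simp add: feedback_def gain_def adjoint_self_adjoint op_inverse_apply)

text \<open>
  The operator \<open>B R\<^sup>-\<^sup>1 B\<^sup>*\<close> of the quadratic term, again for self-adjoint \<open>B\<close>.
\<close>
definition control_weight :: "L2I \<Rightarrow>\<^sub>L L2I \<Rightarrow> L2I \<Rightarrow>\<^sub>L L2I \<Rightarrow> L2I \<Rightarrow>\<^sub>L L2I" where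
  "control_weight B R = B o\<^sub>L (op_inverse R o\<^sub>L B)"

locale riccati =
  fixes T :: real and A B R M MT :: "L2I \<Rightarrow>\<^sub>L L2I" and S :: "real \<Rightarrow> L2I \<Rightarrow>\<^sub>L L2I" and r :: real
  assumes T: "T > 0" and A: "self_adjoint_op A" and B: "self_adjoint_op B"
    and R: "coercive_op r R" and solution: "riccati_solution T A B R M MT S"
begin

lemma nonneg: "t \<in> {0..T} \<Longrightarrow> 0 \<le> inner (S t v) v"
  and self_adjoint: "t \<in> {0..T} \<Longrightarrow> self_adjoint_op (S t)"
  and terminal: "S T = MT"
  using solution by (auto simp: riccati_solution_def nonneg_op_def)

abbreviation "rhs t v \<equiv> 2 * inner (A v) (S t v)
  - inner ((S t o\<^sub>L (control_weight B R o\<^sub>L S t)) v) v + inner (M v) v"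

lemma derivative:
  "t \<in> {0..T} \<Longrightarrow> ((\<lambda>t. inner (S t v) v) has_real_derivative - rhs t v) (at t within {0..T})"
  using solution
  by (simp add: riccati_solution_def feedback_eq_gain[OF R B] control_weight_def gain_def)

text \<open>
  With \<open>y = R\<^sup>-\<^sup>1 B S v\<close> the form equals \<open>\<langle>y, R y\<rangle>\<close>. Dropping this term leaves a linear differential
  inequality, so the quadratic nonlinearity cannot make \<open>S\<close> explode.
\<close>
lemma control_term_nonneg:
  assumes "t \<in> {0..T}"
  shows "0 \<le> inner ((S t o\<^sub>L (control_weight B R o\<^sub>L S t)) v) v"
proof -
  define y where "y = op_inverse R (B (S t v))"
  have "inner ((S t o\<^sub>L (control_weight B R o\<^sub>L S t)) v) v = inner y (R y)"
    using self_adjoint_opD[OF self_adjoint[OF assms]] self_adjoint_opD[OF B]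
    by (simp add: control_weight_def y_def op_inverse_right[OF R])
  also have "0 \<le> \<dots>"
    using R unfolding coercive_op_def inner_commute[of y] by (metis less_imp_le order_trans zero_le_mult_iff zero_le_power2)
  finally show ?thesis .
qed

text \<open>
  The quadratic forms are differentiable, hence bounded on the compact interval. Polarization
  passes this on to the bilinear forms, and the uniform boundedness principle, used first for the
  functionals \<open>w \<mapsto> \<langle>S\<^sub>t v, w\<rangle>\<close> and then for the operators \<open>S\<^sub>t\<close>, to the norms. The bound is
  qualitative; it only licenses the Gronwall arguments below.
\<close>
lemma solution_bounded: "\<exists>C. \<forall>t\<in>{0..T}. norm (S t) \<le> C"
proof -
  have quad: "\<exists>C. \<forall>t\<in>{0..T}. \<bar>inner (S t v) v\<bar> \<le> C" for v
  proof -
    have "continuous_on {0..T} (\<lambda>t. inner (S t v) v)"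
      by (rule DERIV_continuous_on) (rule derivative)
    then have "bounded ((\<lambda>t. inner (S t v) v) ` {0..T})"
      by (intro compact_imp_bounded compact_continuous_image) auto
    then show ?thesis by (auto simp: bounded_iff)
  qed
  show ?thesis
  proof (rule uniform_boundedness)
    fix v
    have "\<exists>C. \<forall>t\<in>{0..T}. norm (blinfun_inner_right (S t v)) \<le> C"
    proof (rule uniform_boundedness)
      fix w
      obtain C1 C2 where "\<forall>t\<in>{0..T}. \<bar>inner (S t (v + w)) (v + w)\<bar> \<le> C1"
        "\<forall>t\<in>{0..T}. \<bar>inner (S t (v - w)) (v - w)\<bar> \<le> C2" using quad by metis
      then have "\<forall>t\<in>{0..T}. norm (blinfun_inner_right (S t v) w) \<le> C1 + C2"
        using polarization[OF self_adjoint, of _ v w] by (fastforce simp: abs_le_iff)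
      then show "\<exists>C. \<forall>t\<in>{0..T}. norm (blinfun_inner_right (S t v) w) \<le> C" by blast
    qed
    then obtain C where C: "\<And>t. t \<in> {0..T} \<Longrightarrow> norm (blinfun_inner_right (S t v)) \<le> C" by blast
    have "norm (S t v) \<le> C" if "t \<in> {0..T}" for t
    proof -
      have "norm (S t v) * norm (S t v) \<le> norm (blinfun_inner_right (S t v)) * norm (S t v)"
        using norm_blinfun[of "blinfun_inner_right (S t v)" "S t v"]
        by (simp add: dot_square_norm power2_eq_square)
      then have "norm (S t v) \<le> norm (blinfun_inner_right (S t v))"
        by (cases "S t v = 0") auto
      then show ?thesis using C[OF that] by simp
    qed
    then show "\<exists>C. \<forall>t\<in>{0..T}. norm (S t v) \<le> C" by blast
  qed
qed

text \<open>
  A bound in terms of \<open>T\<close> and the norms of \<open>A\<close>, \<open>M\<close> and \<open>MT\<close> alone, hence uniform along a convergent sequence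
  of data.
\<close>
lemma norm_le:
  assumes L: "2 * norm A \<le> L" "L > 0" and t: "t \<in> {0..T}"
  shows "norm (S t) \<le> 2 * (norm MT + T * norm M) * exp (2 * L * T)"
proof -
  obtain C where C: "\<And>t. t \<in> {0..T} \<Longrightarrow> norm (S t) \<le> C" using solution_bounded by blast
  show ?thesis
  proof (rule backward_gronwall[where C=C and L=L and T=T and n="\<lambda>t. norm (S t)"])
    fix m t assume m: "\<And>s. s \<in> {0..T} \<Longrightarrow> norm (S s) \<le> m * exp (2 * L * (T - s))"
      and t: "t \<in> {0..T}"
    have m0: "0 \<le> m" using m[of T] T order_trans[OF norm_ge_zero] by fastforce
    have rhs_le: "rhs s v \<le> (L * (m * exp (2 * L * (T - s))) + norm M) * (norm v)\<^sup>2"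
      if s: "s \<in> {0..T}" for s v
    proof -
      have "2 * inner (A v) (S s v) \<le> 2 * (norm A * norm v * (norm (S s) * norm v))"
        using blinfun_inner_le[of A v "S s v"]
          mult_left_mono[OF norm_blinfun[of "S s" v], of "norm A * norm v"] by simp
      also have "\<dots> = (2 * norm A) * norm (S s) * (norm v)\<^sup>2" by (simp add: power2_eq_square mult_ac)
      also have "\<dots> \<le> L * (m * exp (2 * L * (T - s))) * (norm v)\<^sup>2"
        using L m[OF s] by (intro mult_right_mono mult_mono) auto
      finally show ?thesis
        using control_term_nonneg[OF s, of v] blinfun_quadratic_le[of M v] by (simp add: distrib_right)
    qed
    have le: "inner (S t v) v \<le> (norm MT + T * norm M + m / 2 * exp (2 * L * (T - t))) * (norm v)\<^sup>2" for v
    proof -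
      have "inner (S t v) v \<le> inner (S T v) v + (m / 2 * exp (2 * L * (T - t)) + T * norm M) * (norm v)\<^sup>2"
        by (rule backward_comparison[OF derivative rhs_le]) (use t L m0 in auto)
      then show ?thesis
        using blinfun_quadratic_le[of MT v] by (simp add: terminal distrib_right)
    qed
    show "norm (S t) \<le> norm MT + T * norm M + m / 2 * exp (2 * L * (T - t))"
      by (rule norm_self_adjoint_le[OF self_adjoint[OF t]])
        (use le nonneg[OF t] m0 T in auto)
  qed (use C T t L in auto)
qed

end

lemma norm_compose3_le:
  fixes X Y Z :: "'a::real_normed_vector \<Rightarrow>\<^sub>L 'a"
  assumes "norm X \<le> a" "norm Y \<le> b" "norm Z \<le> c"
  shows "norm (X o\<^sub>L (Y o\<^sub>L Z)) \<le> a * (b * c)"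
proof -
  have "0 \<le> a" "0 \<le> b" using assms by (auto intro: order_trans[OF norm_ge_zero])
  then show ?thesis
    by (intro order_trans[OF norm_blinfun_compose] mult_mono assms) auto
qed

text \<open>
  The difference of two solutions is self-adjoint, and on a ball of radius \<open>K\<close> the right-hand side of the
  equation is Lipschitz in \<open>S\<close> with constant \<open>L\<close>. The remaining differences of the data act as a
  forcing term \<open>e\<close>.
\<close>
lemma riccati_stability:
  assumes 1: "riccati T A1 B1 R1 M1 MT1 S1 r1" and 2: "riccati T A2 B2 R2 M2 MT2 S2 r2"
    and K: "\<And>t. t \<in> {0..T} \<Longrightarrow> norm (S1 t) \<le> K \<and> norm (S2 t) \<le> K"
    and h: "norm (control_weight B1 R1) \<le> h" "norm (control_weight B2 R2) \<le> h"
    and L: "2 * norm A1 + 2 * K * h \<le> L" "L > 0" and t: "t \<in> {0..T}"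
  shows "norm (S1 t - S2 t) \<le> 2 * (norm (MT1 - MT2) + T * (2 * K * norm (A1 - A2)
    + K\<^sup>2 * norm (control_weight B1 R1 - control_weight B2 R2) + norm (M1 - M2))) * exp (2 * L * T)"
proof -
  interpret r1: riccati T A1 B1 R1 M1 MT1 S1 r1 by (rule 1)
  interpret r2: riccati T A2 B2 R2 M2 MT2 S2 r2 by (rule 2)
  define H1 where "H1 = control_weight B1 R1"
  define H2 where "H2 = control_weight B2 R2"
  define e where "e = 2 * K * norm (A1 - A2) + K\<^sup>2 * norm (H1 - H2) + norm (M1 - M2)"
  have K0: "0 \<le> K" using K[OF t] norm_ge_zero[of "S1 t"] by linarith
  have h0: "0 \<le> h" using h norm_ge_zero order_trans by blast
  have e0: "0 \<le> e" using K0 by (simp add: e_def)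
  have sa: "self_adjoint_op (S1 t - S2 t)" if "t \<in> {0..T}" for t
    using r1.self_adjoint[OF that] r2.self_adjoint[OF that]
    by (simp add: self_adjoint_op_def blinfun.bilinear_simps inner_simps)
  have diff: "\<bar>r1.rhs s v - r2.rhs s v\<bar> \<le> (L * norm (S1 s - S2 s) + e) * (norm v)\<^sup>2"
    if s: "s \<in> {0..T}" for s v
  proof -
    define D where "D = S1 s - S2 s"
    have Kt: "norm (S1 s) \<le> K" "norm (S2 s) \<le> K" using K[OF s] by auto
    have "inner (A1 v) (S1 s v) - inner (A2 v) (S2 s v) = inner (A1 v) (D v) + inner ((A1 - A2) v) (S2 s v)"
      by (simp add: D_def blinfun.bilinear_simps inner_simps)
    moreover have "\<bar>inner (A1 v) (D v)\<bar> \<le> norm A1 * norm D * (norm v)\<^sup>2"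
      using order_trans[OF blinfun_inner_le[of A1 v "D v"] mult_left_mono[OF norm_blinfun[of D v], of "norm A1 * norm v"]]
      by (simp add: power2_eq_square mult_ac)
    moreover have "\<bar>inner ((A1 - A2) v) (S2 s v)\<bar> \<le> K * norm (A1 - A2) * (norm v)\<^sup>2"
    proof -
      have "norm (S2 s v) \<le> K * norm v"
        using order_trans[OF norm_blinfun mult_right_mono[OF Kt(2) norm_ge_zero]] .
      from order_trans[OF blinfun_inner_le[of "A1 - A2" v "S2 s v"] mult_left_mono[OF this, of "norm (A1 - A2) * norm v"]]
      show ?thesis by (simp add: power2_eq_square mult_ac)
    qed
    ultimately have a: "\<bar>2 * inner (A1 v) (S1 s v) - 2 * inner (A2 v) (S2 s v)\<bar>
        \<le> (2 * norm A1 * norm D + 2 * K * norm (A1 - A2)) * (norm v)\<^sup>2"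
      by (simp add: distrib_right abs_le_iff)
    have "(S1 s o\<^sub>L (H1 o\<^sub>L S1 s)) - (S2 s o\<^sub>L (H2 o\<^sub>L S2 s))
        = (S1 s o\<^sub>L (H1 o\<^sub>L D)) + ((S1 s o\<^sub>L ((H1 - H2) o\<^sub>L S2 s)) + (D o\<^sub>L (H2 o\<^sub>L S2 s)))"
      by (rule blinfun_eqI) (simp add: D_def blinfun.bilinear_simps)
    also have "norm \<dots> \<le> K * (h * norm D) + (K * (norm (H1 - H2) * K) + norm D * (h * K))"
      by (intro order_trans[OF norm_triangle_ineq] add_mono norm_compose3_le Kt order_refl)
        (use h in \<open>simp_all add: H1_def H2_def\<close>)
    finally have b: "norm ((S1 s o\<^sub>L (H1 o\<^sub>L S1 s)) - (S2 s o\<^sub>L (H2 o\<^sub>L S2 s)))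
        \<le> 2 * K * h * norm D + K\<^sup>2 * norm (H1 - H2)"
      by (simp add: power2_eq_square algebra_simps)
    have b': "\<bar>inner ((S1 s o\<^sub>L (H1 o\<^sub>L S1 s)) v) v - inner ((S2 s o\<^sub>L (H2 o\<^sub>L S2 s)) v) v\<bar>
        \<le> (2 * K * h * norm D + K\<^sup>2 * norm (H1 - H2)) * (norm v)\<^sup>2"
      using order_trans[OF blinfun_quadratic_le[of "(S1 s o\<^sub>L (H1 o\<^sub>L S1 s)) - (S2 s o\<^sub>L (H2 o\<^sub>L S2 s))" v]
          mult_right_mono[OF b, of "(norm v)\<^sup>2"]]
      by (simp add: blinfun.diff_left inner_diff_left)
    have c: "\<bar>inner (M1 v) v - inner (M2 v) v\<bar> \<le> norm (M1 - M2) * (norm v)\<^sup>2"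
      using blinfun_quadratic_le[of "M1 - M2" v] by (simp add: blinfun.diff_left inner_diff_left)
    have "\<bar>r1.rhs s v - r2.rhs s v\<bar>
        \<le> (2 * norm A1 * norm D + 2 * K * norm (A1 - A2) + (2 * K * h * norm D + K\<^sup>2 * norm (H1 - H2)) + norm (M1 - M2)) * (norm v)\<^sup>2"
      using a b' c unfolding H1_def[symmetric] H2_def[symmetric] distrib_right by linarith
    also have "\<dots> = ((2 * norm A1 + 2 * K * h) * norm D + e) * (norm v)\<^sup>2"
      by (simp add: e_def algebra_simps)
    also have "\<dots> \<le> (L * norm D + e) * (norm v)\<^sup>2"
      using L by (intro mult_right_mono add_mono) auto
    finally show ?thesis by (simp add: D_def)
  qed
  show ?thesis unfolding e_def[symmetric] H1_def[symmetric] H2_def[symmetric]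
  proof (rule backward_gronwall[where C="2 * K" and L=L and T=T and n="\<lambda>t. norm (S1 t - S2 t)"])
    fix m t assume m: "\<And>s. s \<in> {0..T} \<Longrightarrow> norm (S1 s - S2 s) \<le> m * exp (2 * L * (T - s))"
      and t: "t \<in> {0..T}"
    have m0: "0 \<le> m" using m[of T] r1.T order_trans[OF norm_ge_zero] by fastforce
    have le: "\<bar>r1.rhs s v - r2.rhs s v\<bar> \<le> (L * (m * exp (2 * L * (T - s))) + e) * (norm v)\<^sup>2"
      if s: "s \<in> {0..T}" for s v
      using diff[OF s, of v]
        mult_right_mono[OF add_right_mono[OF mult_left_mono[OF m[OF s] less_imp_le[OF L(2)]], of e], of "(norm v)\<^sup>2"]
      by simp
    define k where "k = norm (MT1 - MT2) + T * e"
    have der: "((\<lambda>t. inner ((S1 t - S2 t) v) v) has_real_derivative - (r1.rhs s v - r2.rhs s v)) (at s within {0..T})"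
      if "s \<in> {0..T}" for s v
      using DERIV_diff[OF r1.derivative[OF that, of v] r2.derivative[OF that, of v]]
      by (simp add: blinfun.diff_left inner_diff_left algebra_simps)
    have der': "((\<lambda>t. - inner ((S1 t - S2 t) v) v) has_real_derivative - (r2.rhs s v - r1.rhs s v)) (at s within {0..T})"
      if "s \<in> {0..T}" for s v
      using DERIV_minus[OF der[OF that]] by simp
    have T: "S1 T - S2 T = MT1 - MT2" by (simp add: r1.terminal r2.terminal)
    have up: "inner ((S1 t - S2 t) v) v \<le> inner ((MT1 - MT2) v) v
        + (m / 2 * exp (2 * L * (T - t)) + T * e) * (norm v)\<^sup>2" for v
      unfolding T[symmetric]
      by (rule backward_comparison[OF der order_trans[OF abs_ge_self le]]) (use t L m0 e0 in auto)
    have lo: "- inner ((S1 t - S2 t) v) v \<le> - inner ((MT1 - MT2) v) v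
        + (m / 2 * exp (2 * L * (T - t)) + T * e) * (norm v)\<^sup>2" for v
      unfolding T[symmetric]
      by (rule backward_comparison[OF der' order_trans[OF abs_ge_self le[unfolded abs_minus_commute[of "r1.rhs _ _"]]]])
        (use t L m0 e0 in auto)
    have "\<bar>inner ((S1 t - S2 t) v) v\<bar> \<le> (k + m / 2 * exp (2 * L * (T - t))) * (norm v)\<^sup>2" for v
      using up[of v] lo[of v] blinfun_quadratic_le[of "MT1 - MT2" v]
      unfolding k_def distrib_right abs_le_iff by linarith
    from norm_self_adjoint_le[OF sa[OF t] this]
    show "norm (S1 t - S2 t) \<le> norm (MT1 - MT2) + T * e + m / 2 * exp (2 * L * (T - t))"
      using m0 e0 r1.T by (simp add: k_def)
  next
    show "0 \<le> norm (S1 s - S2 s) \<and> norm (S1 s - S2 s) \<le> 2 * K" if "s \<in> {0..T}" for s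
      using K[OF that] norm_triangle_ineq4[of "S1 s" "S2 s"] by simp
  qed (use r1.T t L e0 in auto)
qed

lemma uniform_limit_norm_le:
  fixes f :: "nat \<Rightarrow> 'a \<Rightarrow> 'b::real_normed_vector"
  assumes "\<forall>\<^sub>F N in sequentially. \<forall>t\<in>X. norm (f N t - l t) \<le> d N" "d \<longlonglongrightarrow> 0"
  shows "uniform_limit X f l sequentially"
proof (rule uniform_limitI)
  fix e :: real assume "e > 0"
  with assms(2) have "\<forall>\<^sub>F N in sequentially. d N < e" by (rule order_tendstoD)
  with assms(1) show "\<forall>\<^sub>F N in sequentially. \<forall>t\<in>X. dist (f N t) (l t) < e"
    by eventually_elim (auto simp: dist_norm intro: le_less_trans)
qed

lemma eventually_norm_le_plus_1:
  fixes X :: "'a::real_normed_vector"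
  assumes "XN \<longlonglongrightarrow> X" shows "\<forall>\<^sub>F N in sequentially. norm (XN N) \<le> norm X + 1"
proof -
  have "(\<lambda>N. norm (XN N)) \<longlonglongrightarrow> norm X" using assms by (rule tendsto_norm)
  then have "\<forall>\<^sub>F N in sequentially. norm (XN N) < norm X + 1" by (rule order_tendstoD) simp
  then show ?thesis by eventually_elim simp
qed

text \<open>
  The a priori bound \<open>K\<close> and the Lipschitz constant \<open>L\<close> are chosen for data whose norms exceed those of
  the limit by at most one, so that they serve the limit equation and almost all approximations at
  once.
\<close>
lemma gain_uniform_limit:
  assumes lim: "AN \<longlonglongrightarrow> A" "BN \<longlonglongrightarrow> B" "RN \<longlonglongrightarrow> R" "MN \<longlonglongrightarrow> M" "MTN \<longlonglongrightarrow> MT"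
    and S: "riccati T A B R M MT S r"
    and SN: "\<forall>\<^sub>F N in sequentially. self_adjoint_op (AN N) \<and> self_adjoint_op (BN N) \<and>
      riccati_solution T (AN N) (BN N) (RN N) (MN N) (MTN N) (SN N)"
  shows "uniform_limit {0..T} (\<lambda>N t. gain (BN N) (RN N) (SN N t)) (\<lambda>t. gain B R (S t)) sequentially"
proof -
  interpret riccati T A B R M MT S r by (rule S)
  note inv = coercive_op_inverse_tendsto[OF R lim(3)]
  have Hlim: "(\<lambda>N. control_weight (BN N) (RN N)) \<longlonglongrightarrow> control_weight B R"
    unfolding control_weight_def by (intro tendsto_intros lim inv)
  have riccatiN: "\<forall>\<^sub>F N in sequentially. riccati T (AN N) (BN N) (RN N) (MN N) (MTN N) (SN N) (r / 2)"
    using SN inv(1) by eventually_elim (use T in \<open>auto intro: riccati.intro\<close>)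
  define L0 where "L0 = 2 * (norm A + 1)"
  define K where "K = 2 * (norm MT + 1 + T * (norm M + 1)) * exp (2 * L0 * T)"
  define h where "h = norm (control_weight B R) + 1"
  define L where "L = 2 * (norm A + 1) + 2 * K * h"
  have L0: "L0 > 0" by (simp add: L0_def add_nonneg_pos)
  have "K \<ge> 0" using T by (simp add: K_def)
  moreover have h: "h \<ge> 0" by (simp add: h_def)
  ultimately have L: "L > 0" by (simp add: L_def add_pos_nonneg add_nonneg_pos)
  have le_K: "norm (S' t) \<le> K"
    if "riccati T A' B' R' M' MT' S' r'" "t \<in> {0..T}"
      "norm A' \<le> norm A + 1" "norm M' \<le> norm M + 1" "norm MT' \<le> norm MT + 1"
    for A' B' R' M' MT' S' r' t
  proof -
    have "norm (S' t) \<le> 2 * (norm MT' + T * norm M') * exp (2 * L0 * T)"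
      by (rule riccati.norm_le[OF that(1)]) (use that L0 in \<open>auto simp: L0_def\<close>)
    also have "\<dots> \<le> K"
      unfolding K_def using that T by (intro mult_right_mono mult_left_mono add_mono) auto
    finally show ?thesis .
  qed
  define d where "d N = 2 * (norm (MTN N - MT) + T * (2 * K * norm (AN N - A)
    + K\<^sup>2 * norm (control_weight (BN N) (RN N) - control_weight B R) + norm (MN N - M))) * exp (2 * L * T)" for N
  have "d \<longlonglongrightarrow> 2 * (norm (MT - MT) + T * (2 * K * norm (A - A)
    + K\<^sup>2 * norm (control_weight B R - control_weight B R) + norm (M - M))) * exp (2 * L * T)"
    unfolding d_def by (intro tendsto_intros lim Hlim)
  then have d: "d \<longlonglongrightarrow> 0" by simp
  have "\<forall>\<^sub>F N in sequentially. \<forall>t\<in>{0..T}. norm (SN N t - S t) \<le> d N"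
    using riccatiN eventually_norm_le_plus_1[OF lim(1)] eventually_norm_le_plus_1[OF lim(4)]
      eventually_norm_le_plus_1[OF lim(5)] eventually_norm_le_plus_1[OF Hlim]
  proof eventually_elim
    case (elim N)
    show ?case unfolding d_def
    proof (intro ballI riccati_stability[OF elim(1) S])
      show "norm (SN N t) \<le> K \<and> norm (S t) \<le> K" if "t \<in> {0..T}" for t
        by (intro conjI le_K[OF elim(1) that] le_K[OF S that] elim) auto
    qed (use elim L in \<open>auto simp: h_def L_def\<close>)
  qed
  then have Slim: "uniform_limit {0..T} SN S sequentially"
    using d by (rule uniform_limit_norm_le)
  have const: "uniform_limit {0..T} (\<lambda>N t. XN N) (\<lambda>t. X) sequentially"
    if "XN \<longlonglongrightarrow> X" for XN and X :: "L2I \<Rightarrow>\<^sub>L L2I"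
    by (rule uniform_limit_norm_le[where d="\<lambda>N. norm (XN N - X)"])
      (use that in \<open>auto intro: tendsto_norm_zero LIM_zero\<close>)
  have S_bdd: "bounded (S ` {0..T})"
    using solution_bounded by (auto simp: bounded_iff)
  have "norm (B o\<^sub>L S t) \<le> norm B * K" if "t \<in> {0..T}" for t
    by (rule order_trans[OF norm_blinfun_compose])
      (intro mult_left_mono le_K[OF S that], auto)
  then have BS_bdd: "bounded ((\<lambda>t. B o\<^sub>L S t) ` {0..T})"
    unfolding bounded_iff by blast
  have c_bdd: "bounded ((\<lambda>t. X) ` {0..T})" for X :: "L2I \<Rightarrow>\<^sub>L L2I"
    by (auto simp: bounded_iff)
  show ?thesis
    unfolding gain_def
    by (intro bounded_bilinear.bounded_uniform_limit[OF bounded_bilinear_blinfun_compose]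
        const lim inv Slim S_bdd BS_bdd c_bdd)
qed

section \<open>A Gronwall inequality in the mean\<close>

text \<open>
  The weight \<open>exp (- 2 L t)\<close> halves the Volterra operator with kernel \<open>L\<close>.
\<close>
lemma nn_integral_exp_le:
  assumes L: "L > 0" and s: "s \<in> {0..T}"
  shows "(\<integral>\<^sup>+t. ennreal (exp (- 2 * L * t)) * (ennreal L * indicator {0..t} s) \<partial>restrict_space lborel {0..T})
    \<le> ennreal (exp (- 2 * L * s) / 2)"
proof -
  define F where "F t = - exp (- 2 * L * t) / 2" for t
  have "(\<integral>\<^sup>+t. ennreal (exp (- 2 * L * t)) * (ennreal L * indicator {0..t} s) \<partial>restrict_space lborel {0..T})
      = (\<integral>\<^sup>+t. ennreal (L * exp (- 2 * L * t)) * indicator {s..T} t \<partial>lborel)"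
    using L s by (subst nn_integral_restrict_space)
      (auto intro!: nn_integral_cong simp: ennreal_mult mult.commute split: split_indicator)
  also have "\<dots> = F T - F s"
  proof (rule nn_integral_FTC_Icc)
    show "(F has_real_derivative L * exp (- 2 * L * t)) (at t)" for t
      unfolding F_def by (auto intro!: derivative_eq_intros)
  qed (use L s in auto)
  also have "\<dots> \<le> ennreal (exp (- 2 * L * s) / 2)"
    by (intro ennreal_leI) (simp add: F_def)
  finally show ?thesis .
qed

text \<open>
  A linear Volterra inequality that holds at each time outside a null set depending on the time.
  Finiteness is assumed of the path integrals only, and almost surely: the expectation of \<open>Y t\<close> may be
  infinite at the outset, and for finite \<open>\<eta>\<close> its finiteness is part of the conclusion.
\<close>
locale mean_gronwall = prob_space P for P :: "'w measure" +
  fixes T L :: real and Y R :: "real \<Rightarrow> 'w \<Rightarrow> ennreal" and \<eta> :: ennreal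
  assumes T: "T \<ge> 0" and L: "L > 0"
    and Y_measurable: "(\<lambda>(t, \<omega>). Y t \<omega>) \<in> borel_measurable (restrict_space borel {0..T} \<Otimes>\<^sub>M P)"
    and finite_paths: "AE \<omega> in P. (\<integral>\<^sup>+t. Y t \<omega> \<partial>restrict_space lborel {0..T}) < \<infinity>"
    and path_le: "\<And>t. t \<in> {0..T} \<Longrightarrow> AE \<omega> in P.
      Y t \<omega> \<le> ennreal L * (\<integral>\<^sup>+s. Y s \<omega> * indicator {0..t} s \<partial>restrict_space lborel {0..T}) + R t \<omega>"
    and R_measurable: "\<And>t. t \<in> {0..T} \<Longrightarrow> R t \<in> borel_measurable P"
    and R_le: "\<And>t. t \<in> {0..T} \<Longrightarrow> (\<integral>\<^sup>+\<omega>. R t \<omega> \<partial>P) \<le> \<eta>"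
begin

abbreviation "\<mu> \<equiv> restrict_space lborel {0..T}"

lemma sets_mu[measurable_cong]: "sets \<mu> = sets (restrict_space borel {0..T})"
  by (simp add: sets_restrict_space)

sublocale mu: finite_measure \<mu>
  by (rule finite_measureI)
    (simp add: emeasure_restrict_space space_restrict_space emeasure_lborel_Icc_eq)

lemma id_meas[measurable]: "(\<lambda>t. t) \<in> borel_measurable \<mu>"
  by (simp add: measurable_restrict_space1)

sublocale pair_sigma_finite \<mu> P ..

lemma Y_meas[measurable]: "(\<lambda>(t, \<omega>). Y t \<omega>) \<in> borel_measurable (\<mu> \<Otimes>\<^sub>M P)"
  using Y_measurable measurable_cong_sets[OF sets_pair_measure_cong[OF sets_mu refl] refl] by blast

abbreviation "J t \<omega> \<equiv> \<integral>\<^sup>+s. Y s \<omega> * indicator {0..t} s \<partial>\<mu>"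

lemma J_meas[measurable]: "(\<lambda>(t, \<omega>). J t \<omega>) \<in> borel_measurable (\<mu> \<Otimes>\<^sub>M P)"
proof -
  note [measurable] = id_meas
  have "(\<lambda>(x, s). indicator {0..fst x} s :: ennreal) \<in> borel_measurable ((\<mu> \<Otimes>\<^sub>M P) \<Otimes>\<^sub>M \<mu>)"
    unfolding indicator_def atLeastAtMost_iff by measurable
  then have "(\<lambda>(x, s). Y s (snd x) * indicator {0..fst x} s) \<in> borel_measurable ((\<mu> \<Otimes>\<^sub>M P) \<Otimes>\<^sub>M \<mu>)"
    by (simp add: case_prod_beta') 
  then show ?thesis
    unfolding case_prod_beta' by (rule mu.borel_measurable_nn_integral[unfolded case_prod_beta'])
qed

text \<open>
  The part of \<open>Y\<close> that the Volterra term does not account for. By construction the inequality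
  \<open>Y \<le> H + L J\<close> holds at all times on every path and \<open>H\<close> is jointly measurable. The given \<open>R\<close> need
  not have either property; it enters through the expectation of \<open>H\<close> at fixed times.
\<close>
definition H :: "real \<Rightarrow> 'w \<Rightarrow> ennreal" where "H t \<omega> = Y t \<omega> - ennreal L * J t \<omega>"

lemma H_meas[measurable]: "(\<lambda>(t, \<omega>). H t \<omega>) \<in> borel_measurable (\<mu> \<Otimes>\<^sub>M P)"
  unfolding H_def case_prod_beta'
  using Y_meas J_meas unfolding case_prod_beta' by measurable

lemma J_le: "J t \<omega> \<le> (\<integral>\<^sup>+s. Y s \<omega> \<partial>\<mu>)"
  by (rule nn_integral_mono) (auto split: split_indicator)

lemma expectation_H_le:
  assumes t: "t \<in> {0..T}" shows "(\<integral>\<^sup>+\<omega>. H t \<omega> \<partial>P) \<le> \<eta>"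
proof -
  have "AE \<omega> in P. H t \<omega> \<le> R t \<omega>"
    using path_le[OF t] finite_paths
  proof eventually_elim
    case (elim \<omega>)
    have "ennreal L * J t \<omega> < \<infinity>"
      using le_less_trans[OF J_le elim(2)] by (simp add: ennreal_mult_less_top)
    with elim(1) show ?case
      unfolding H_def by (subst ennreal_minus_le_iff) auto
  qed
  then show ?thesis using nn_integral_mono_AE R_le[OF t] order_trans by blast
qed

text \<open>
  In the weighted norm the Volterra term is at most half of the left-hand side, which is finite and
  can be absorbed.
\<close>
lemma path_weighted_le:
  assumes Y\<omega>[measurable]: "(\<lambda>t. Y t \<omega>) \<in> borel_measurable \<mu>" and H\<omega>: "(\<lambda>t. H t \<omega>) \<in> borel_measurable \<mu>"
    and fin: "(\<integral>\<^sup>+t. Y t \<omega> \<partial>\<mu>) < \<infinity>"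
  shows "(\<integral>\<^sup>+t. ennreal (exp (- 2 * L * t)) * Y t \<omega> \<partial>\<mu>) \<le> 2 * (\<integral>\<^sup>+t. H t \<omega> \<partial>\<mu>)"
proof -
  interpret mm: pair_sigma_finite \<mu> \<mu> ..
  let ?e = "\<lambda>t. ennreal (exp (- 2 * L * t))"
  let ?I = "\<integral>\<^sup>+t. ?e t * Y t \<omega> \<partial>\<mu>"
  note [measurable] = id_meas
  have ind[measurable]: "(\<lambda>x. indicator {0..fst x} (snd x) :: ennreal) \<in> borel_measurable (\<mu> \<Otimes>\<^sub>M \<mu>)"
    unfolding indicator_def atLeastAtMost_iff by measurable
  have ind': "(\<lambda>x. indicator {0..snd x} (fst x) :: ennreal) \<in> borel_measurable (\<mu> \<Otimes>\<^sub>M \<mu>)"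
    unfolding indicator_def atLeastAtMost_iff by measurable
  have e1: "?e t \<le> 1" if "t \<in> {0..T}" for t using that L by simp
  have fin': "?I < \<infinity>"
  proof (rule le_less_trans[OF nn_integral_mono fin])
    show "?e t * Y t \<omega> \<le> Y t \<omega>" if "t \<in> space \<mu>" for t
      using mult_right_mono[OF e1, of t "Y t \<omega>"] that by (simp add: space_restrict_space)
  qed
  have "?I \<le> (\<integral>\<^sup>+t. H t \<omega> + (\<integral>\<^sup>+s. ?e t * (ennreal L * indicator {0..t} s) * Y s \<omega> \<partial>\<mu>) \<partial>\<mu>)"
  proof (rule nn_integral_mono)
    fix t assume "t \<in> space \<mu>"
    then have t: "t \<in> {0..T}" by (simp add: space_restrict_space)
    have tm: "t \<in> space \<mu>" by fact
    have "Y t \<omega> \<le> H t \<omega> + ennreal L * J t \<omega>"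
      unfolding H_def
      by (cases "ennreal L * J t \<omega> \<le> Y t \<omega>") (simp_all add: diff_add_cancel_ennreal add_increasing)
    then have "?e t * Y t \<omega> \<le> ?e t * H t \<omega> + ?e t * (ennreal L * J t \<omega>)"
      using mult_left_mono[of "Y t \<omega>" "H t \<omega> + ennreal L * J t \<omega>" "?e t"] by (simp add: distrib_left)
    also have "\<dots> \<le> H t \<omega> + ?e t * (ennreal L * J t \<omega>)"
      using mult_right_mono[OF e1[OF t], of "H t \<omega>"] by (intro add_right_mono) simp
    also have "?e t * (ennreal L * J t \<omega>) = (\<integral>\<^sup>+s. ?e t * (ennreal L * indicator {0..t} s) * Y s \<omega> \<partial>\<mu>)"
      using measurable_Pair2[OF ind tm]
      by (simp add: nn_integral_cmult[symmetric] mult_ac)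
    finally show "?e t * Y t \<omega> \<le> H t \<omega> + (\<integral>\<^sup>+s. ?e t * (ennreal L * indicator {0..t} s) * Y s \<omega> \<partial>\<mu>)" .
  qed
  also have "\<dots> = (\<integral>\<^sup>+t. H t \<omega> \<partial>\<mu>) + (\<integral>\<^sup>+t. (\<integral>\<^sup>+s. ?e t * (ennreal L * indicator {0..t} s) * Y s \<omega> \<partial>\<mu>) \<partial>\<mu>)"
    by (rule nn_integral_add[OF H\<omega>])
      (rule mu.borel_measurable_nn_integral, use ind in \<open>simp add: case_prod_beta'\<close>)
  also have "(\<integral>\<^sup>+t. (\<integral>\<^sup>+s. ?e t * (ennreal L * indicator {0..t} s) * Y s \<omega> \<partial>\<mu>) \<partial>\<mu>)
      = (\<integral>\<^sup>+s. (\<integral>\<^sup>+t. ?e t * (ennreal L * indicator {0..t} s) * Y s \<omega> \<partial>\<mu>) \<partial>\<mu>)"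
    by (rule mm.Fubini') (use ind' in \<open>simp add: case_prod_beta'\<close>)
  also have "\<dots> \<le> (\<integral>\<^sup>+s. ?e s * Y s \<omega> * ennreal (1 / 2) \<partial>\<mu>)"
  proof (rule nn_integral_mono)
    fix s assume sm: "s \<in> space \<mu>"
    then have s: "s \<in> {0..T}" by (simp add: space_restrict_space)
    have "(\<integral>\<^sup>+t. ?e t * (ennreal L * indicator {0..t} s) * Y s \<omega> \<partial>\<mu>)
        = (\<integral>\<^sup>+t. ?e t * (ennreal L * indicator {0..t} s) \<partial>\<mu>) * Y s \<omega>"
      by (rule nn_integral_multc) (use measurable_Pair1[OF ind sm] in simp)
    also have "\<dots> \<le> ennreal (exp (- 2 * L * s) / 2) * Y s \<omega>"
      by (intro mult_right_mono nn_integral_exp_le L s) simp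
    also have "ennreal (exp (- 2 * L * s) / 2) = ?e s * ennreal (1 / 2)"
      by (subst ennreal_mult[symmetric]) auto
    finally show "(\<integral>\<^sup>+t. ?e t * (ennreal L * indicator {0..t} s) * Y s \<omega> \<partial>\<mu>) \<le> ?e s * Y s \<omega> * ennreal (1 / 2)"
      by (simp add: mult_ac)
  qed
  also have "\<dots> = ?I * ennreal (1 / 2)"
    by (rule nn_integral_multc) measurable
  finally have le: "?I \<le> (\<integral>\<^sup>+t. H t \<omega> \<partial>\<mu>) + ?I * ennreal (1 / 2)" by - simp
  show ?thesis
  proof (cases "(\<integral>\<^sup>+t. H t \<omega> \<partial>\<mu>)" rule: ennreal_cases)
    case (real h)
    obtain i where i: "?I = ennreal i" "0 \<le> i" using fin' by (cases ?I rule: ennreal_cases) auto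
    have "ennreal (h + i * (1 / 2)) = ennreal h + ennreal (i * (1 / 2))"
      by (rule ennreal_plus) (use real(1) i(2) in auto)
    also have "ennreal (i * (1 / 2)) = ennreal i * ennreal (1 / 2)"
      by (rule ennreal_mult) (use i(2) in auto)
    finally have "ennreal i \<le> ennreal (h + i * (1 / 2))"
      using le unfolding i(1) real(2) by (simp only:)
    then have "i \<le> h + i * (1 / 2)" using real(1) i(2) by (subst (asm) ennreal_le_iff) auto
    then show ?thesis unfolding i(1) real(2)
      using real(1) by (simp add: ennreal_mult[symmetric] flip: ennreal_numeral)
  qed (simp add: ennreal_mult_top)
qed

lemma expected_path_integral_le:
  "(\<integral>\<^sup>+\<omega>. (\<integral>\<^sup>+t. Y t \<omega> \<partial>\<mu>) \<partial>P) \<le> ennreal (2 * T * exp (2 * L * T)) * \<eta>"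
proof -
  let ?c = "ennreal (exp (2 * L * T))"
  have "AE \<omega> in P. (\<integral>\<^sup>+t. Y t \<omega> \<partial>\<mu>) \<le> ?c * 2 * (\<integral>\<^sup>+t. H t \<omega> \<partial>\<mu>)"
    using finite_paths AE_space
  proof eventually_elim
    case (elim \<omega>)
    have Ym: "(\<lambda>t. Y t \<omega>) \<in> borel_measurable \<mu>" and Hm: "(\<lambda>t. H t \<omega>) \<in> borel_measurable \<mu>"
      using measurable_Pair1[OF Y_meas elim(2)] measurable_Pair1[OF H_meas elim(2)] by simp_all
    have "(\<integral>\<^sup>+t. Y t \<omega> \<partial>\<mu>) \<le> (\<integral>\<^sup>+t. ?c * (ennreal (exp (- 2 * L * t)) * Y t \<omega>) \<partial>\<mu>)"
    proof (rule nn_integral_mono)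
      fix t assume "t \<in> space \<mu>"
      then have "t \<le> T" by (simp add: space_restrict_space)
      then have "1 \<le> exp (2 * L * T) * exp (- 2 * L * t)"
        using L by (simp add: exp_add[symmetric])
      then have "1 \<le> ?c * ennreal (exp (- 2 * L * t))"
        by (subst ennreal_mult[symmetric]) auto
      from mult_right_mono[OF this, of "Y t \<omega>"]
      show "Y t \<omega> \<le> ?c * (ennreal (exp (- 2 * L * t)) * Y t \<omega>)" by (simp add: mult.assoc)
    qed
    also have "\<dots> = ?c * (\<integral>\<^sup>+t. ennreal (exp (- 2 * L * t)) * Y t \<omega> \<partial>\<mu>)"
      by (rule nn_integral_cmult, rule borel_measurable_times_ennreal[OF _ Ym]) measurable
    also have "\<dots> \<le> ?c * (2 * (\<integral>\<^sup>+t. H t \<omega> \<partial>\<mu>))"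
      by (intro mult_left_mono path_weighted_le Ym Hm elim) simp
    finally show ?case by (simp add: mult.assoc)
  qed
  then have "(\<integral>\<^sup>+\<omega>. (\<integral>\<^sup>+t. Y t \<omega> \<partial>\<mu>) \<partial>P) \<le> (\<integral>\<^sup>+\<omega>. ?c * 2 * (\<integral>\<^sup>+t. H t \<omega> \<partial>\<mu>) \<partial>P)"
    by (rule nn_integral_mono_AE)
  also have "\<dots> = ?c * 2 * (\<integral>\<^sup>+\<omega>. (\<integral>\<^sup>+t. H t \<omega> \<partial>\<mu>) \<partial>P)"
    by (rule nn_integral_cmult) (use H_meas in measurable)
  also have "(\<integral>\<^sup>+\<omega>. (\<integral>\<^sup>+t. H t \<omega> \<partial>\<mu>) \<partial>P) = (\<integral>\<^sup>+t. (\<integral>\<^sup>+\<omega>. H t \<omega> \<partial>P) \<partial>\<mu>)"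
    by (rule Fubini') (rule H_meas)
  also have "\<dots> \<le> (\<integral>\<^sup>+t. \<eta> \<partial>\<mu>)"
    by (rule nn_integral_mono) (auto simp: space_restrict_space intro!: expectation_H_le)
  also have "\<dots> = \<eta> * ennreal T"
    using T by (simp add: emeasure_restrict_space space_restrict_space)
  finally have "(\<integral>\<^sup>+\<omega>. (\<integral>\<^sup>+t. Y t \<omega> \<partial>\<mu>) \<partial>P) \<le> ?c * 2 * (\<eta> * ennreal T)"
    by (simp add: mult_left_mono)
  also have "\<dots> = ennreal (2 * T * exp (2 * L * T)) * \<eta>"
    using T by (simp add: ennreal_mult mult_ac)
  finally show ?thesis .
qed

lemma expected_value_le:
  assumes t: "t \<in> {0..T}"
  shows "(\<integral>\<^sup>+\<omega>. Y t \<omega> \<partial>P) \<le> ennreal (2 * L * T * exp (2 * L * T) + 1) * \<eta>"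
proof -
  have tm: "t \<in> space \<mu>" using t by (simp add: space_restrict_space)
  have Jt: "J t \<in> borel_measurable P" using measurable_Pair2[OF J_meas tm] by simp
  have "(\<integral>\<^sup>+\<omega>. Y t \<omega> \<partial>P) \<le> (\<integral>\<^sup>+\<omega>. ennreal L * J t \<omega> + R t \<omega> \<partial>P)"
    by (rule nn_integral_mono_AE) (rule path_le[OF t])
  also have "\<dots> = (\<integral>\<^sup>+\<omega>. ennreal L * J t \<omega> \<partial>P) + (\<integral>\<^sup>+\<omega>. R t \<omega> \<partial>P)"
    by (rule nn_integral_add) (use Jt R_measurable[OF t] in auto)
  also have "(\<integral>\<^sup>+\<omega>. ennreal L * J t \<omega> \<partial>P) = ennreal L * (\<integral>\<^sup>+\<omega>. J t \<omega> \<partial>P)"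
    by (rule nn_integral_cmult) (rule Jt)
  also have "ennreal L * (\<integral>\<^sup>+\<omega>. J t \<omega> \<partial>P) + (\<integral>\<^sup>+\<omega>. R t \<omega> \<partial>P)
      \<le> ennreal L * (ennreal (2 * T * exp (2 * L * T)) * \<eta>) + \<eta>"
    by (intro add_mono mult_left_mono R_le t order_trans[OF nn_integral_mono expected_path_integral_le] J_le) simp
  also have "\<dots> = ennreal (2 * L * T * exp (2 * L * T) + 1) * \<eta>"
    using t L by (simp add: ennreal_plus ennreal_mult distrib_left mult_ac)
  finally show ?thesis .
qed

end

section \<open>Mean squares\<close>

lemma mean_sq_triangle:
  fixes X Y Z :: "'w \<Rightarrow> 'b::{real_normed_vector, second_countable_topology}"
  assumes "X \<in> borel_measurable P" "Y \<in> borel_measurable P" "Z \<in> borel_measurable P"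
  shows "mean_sq P (\<lambda>\<omega>. X \<omega> - Z \<omega>) \<le> 2 * mean_sq P (\<lambda>\<omega>. X \<omega> - Y \<omega>) + 2 * mean_sq P (\<lambda>\<omega>. Y \<omega> - Z \<omega>)"
proof -
  have le: "ennreal ((norm (x - z))\<^sup>2) \<le> 2 * ennreal ((norm (x - y))\<^sup>2) + 2 * ennreal ((norm (y - z))\<^sup>2)" for x y z :: 'b
  proof -
    have "norm (x - z) \<le> norm (x - y) + norm (y - z)"
      using norm_triangle_ineq[of "x - y" "y - z"] by simp
    then have "(norm (x - z))\<^sup>2 \<le> (norm (x - y) + norm (y - z))\<^sup>2" by (rule power_mono) simp
    also have "\<dots> \<le> 2 * (norm (x - y))\<^sup>2 + 2 * (norm (y - z))\<^sup>2"
      using sum_squares_bound[of "norm (x - y)" "norm (y - z)"] by (simp add: power2_sum)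
    finally have "ennreal ((norm (x - z))\<^sup>2) \<le> ennreal (2 * (norm (x - y))\<^sup>2 + 2 * (norm (y - z))\<^sup>2)"
      by (rule ennreal_leI)
    then show ?thesis by (simp add: ennreal_plus ennreal_mult)
  qed
  have "mean_sq P (\<lambda>\<omega>. X \<omega> - Z \<omega>)
      \<le> (\<integral>\<^sup>+\<omega>. 2 * ennreal ((norm (X \<omega> - Y \<omega>))\<^sup>2) + 2 * ennreal ((norm (Y \<omega> - Z \<omega>))\<^sup>2) \<partial>P)"
    unfolding mean_sq_def by (intro nn_integral_mono le)
  also have "\<dots> = 2 * mean_sq P (\<lambda>\<omega>. X \<omega> - Y \<omega>) + 2 * mean_sq P (\<lambda>\<omega>. Y \<omega> - Z \<omega>)"
    unfolding mean_sq_def using assms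
    by (subst nn_integral_add) (auto simp: nn_integral_cmult)
  finally show ?thesis .
qed

lemma mean_sq_commute: "mean_sq P (\<lambda>\<omega>. X \<omega> - Y \<omega>) = mean_sq P (\<lambda>\<omega>. Y \<omega> - X \<omega>)"
  by (simp add: mean_sq_def norm_minus_commute)

lemma tendsto_bound_ennreal:
  fixes f :: "nat \<Rightarrow> ennreal"
  assumes f: "f \<longlonglongrightarrow> 0" and c: "c \<noteq> \<infinity>" and le: "\<forall>\<^sub>F n in sequentially. x \<le> b + c * f n"
  shows "x \<le> b"
proof -
  have "(\<lambda>n. b + c * f n) \<longlonglongrightarrow> b + c * 0"
    by (intro tendsto_add tendsto_const ennreal_tendsto_cmult f) (use c in \<open>simp add: less_top\<close>)
  then show ?thesis by (intro tendsto_lowerbound[OF _ le]) auto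
qed

lemma mean_sq_blinfun_le:
  fixes f :: "'w \<Rightarrow> L2I" and G :: "L2I \<Rightarrow>\<^sub>L L2I"
  assumes f[measurable]: "f \<in> borel_measurable P"
  shows "mean_sq P (\<lambda>\<omega>. G (f \<omega>)) \<le> ennreal ((norm G)\<^sup>2) * mean_sq P f"
proof -
  have "mean_sq P (\<lambda>\<omega>. G (f \<omega>)) \<le> (\<integral>\<^sup>+\<omega>. ennreal ((norm G)\<^sup>2) * ennreal ((norm (f \<omega>))\<^sup>2) \<partial>P)"
    unfolding mean_sq_def using power_mono[OF norm_blinfun[of G] norm_ge_zero, where n=2]
    by (intro nn_integral_mono) (simp add: ennreal_mult[symmetric] power_mult_distrib ennreal_leI)
  also have "\<dots> = ennreal ((norm G)\<^sup>2) * mean_sq P f"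
    unfolding mean_sq_def by (rule nn_integral_cmult) measurable
  finally show ?thesis .
qed

lemma blinfun_measurable:
  fixes f :: "'w \<Rightarrow> 'a::real_normed_vector" and G :: "'a \<Rightarrow>\<^sub>L 'b::real_normed_vector"
  assumes "f \<in> borel_measurable P" shows "(\<lambda>\<omega>. G (f \<omega>)) \<in> borel_measurable P"
  using assms by (rule measurable_compose) (intro borel_measurable_continuous_onI continuous_intros)

lemma mean_sq_limit_le:
  fixes X :: "nat \<Rightarrow> 'w \<Rightarrow> 'b::{real_normed_vector, second_countable_topology}"
  assumes X: "\<And>n. X n \<in> borel_measurable P" and Y: "Y \<in> borel_measurable P" and Z: "Z \<in> borel_measurable P"
    and lim: "(\<lambda>n. mean_sq P (\<lambda>\<omega>. X n \<omega> - Y \<omega>)) \<longlonglongrightarrow> 0"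
    and le: "\<forall>\<^sub>F n in sequentially. mean_sq P (\<lambda>\<omega>. X n \<omega> - Z \<omega>) \<le> C"
  shows "mean_sq P (\<lambda>\<omega>. Y \<omega> - Z \<omega>) \<le> 2 * C"
proof (rule tendsto_bound_ennreal[OF lim])
  show "\<forall>\<^sub>F n in sequentially. mean_sq P (\<lambda>\<omega>. Y \<omega> - Z \<omega>) \<le> 2 * C + 2 * mean_sq P (\<lambda>\<omega>. X n \<omega> - Y \<omega>)"
    using le
  proof eventually_elim
    case (elim n)
    have "mean_sq P (\<lambda>\<omega>. Y \<omega> - Z \<omega>) \<le> 2 * mean_sq P (\<lambda>\<omega>. X n \<omega> - Y \<omega>) + 2 * mean_sq P (\<lambda>\<omega>. X n \<omega> - Z \<omega>)"
      using mean_sq_triangle[OF Y X Z, of n] by (simp add: mean_sq_commute[of P Y])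
    also have "\<dots> \<le> 2 * mean_sq P (\<lambda>\<omega>. X n \<omega> - Y \<omega>) + 2 * C"
      by (intro add_left_mono mult_left_mono elim) simp
    finally show ?case by (simp add: add.commute)
  qed
qed simp

lemma (in prob_space) nn_integral_norm_le_mean_sq:
  fixes X :: "'a \<Rightarrow> 'b::real_normed_vector"
  assumes X: "X \<in> borel_measurable M" and le: "mean_sq M X \<le> ennreal (c\<^sup>2)" and c: "0 \<le> c"
  shows "(\<integral>\<^sup>+\<omega>. ennreal (norm (X \<omega>)) \<partial>M) \<le> ennreal c"
proof -
  define I where "I = (\<integral>\<^sup>+\<omega>. ennreal (norm (X \<omega>)) \<partial>M)"
  have "(\<integral>\<^sup>+\<omega>. ennreal (norm (X \<omega>)) * 1 \<partial>M)\<^sup>2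
      \<le> (\<integral>\<^sup>+\<omega>. (ennreal (norm (X \<omega>)))\<^sup>2 \<partial>M) * (\<integral>\<^sup>+\<omega>. 1\<^sup>2 \<partial>M)"
    by (rule Cauchy_Schwarz_nn_integral) (use X in measurable)
  then have I2: "I\<^sup>2 \<le> ennreal (c\<^sup>2)"
    using le emeasure_space_1 unfolding I_def mean_sq_def by (simp add: ennreal_power)
  have "I \<le> ennreal c"
  proof (cases I rule: ennreal_cases)
    case (real r)
    have "r\<^sup>2 \<le> c\<^sup>2"
      using I2 real(1) unfolding real(2) by (simp add: ennreal_power del: power_mono_iff)
    then have "r \<le> c" using c by (rule power2_le_imp_le)
    then show ?thesis unfolding real(2) by (rule ennreal_leI)
  next
    case top
    then show ?thesis using I2 by (simp add: power2_eq_square top_unique)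
  qed
  then show ?thesis by (simp add: I_def)
qed

lemma integrable_mult_square:
  fixes f g :: "'a \<Rightarrow> real"
  assumes [measurable]: "f \<in> borel_measurable M" "g \<in> borel_measurable M"
    and f: "integrable M (\<lambda>x. (f x)\<^sup>2)" and g: "integrable M (\<lambda>x. (g x)\<^sup>2)"
  shows "integrable M (\<lambda>x. f x * g x)"
proof (rule Bochner_Integration.integrable_bound[OF Bochner_Integration.integrable_add[OF f g]])
  have "\<bar>a * b\<bar> \<le> a\<^sup>2 + b\<^sup>2" for a b :: real
    using sum_squares_bound[of "\<bar>a\<bar>" "\<bar>b\<bar>"] abs_ge_zero[of "a * b"] unfolding abs_mult power2_abs by linarith
  then show "AE x in M. norm (f x * g x) \<le> norm ((f x)\<^sup>2 + (g x)\<^sup>2)" by (intro AE_I2) simp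
qed measurable

lemma integrable_square_diff:
  fixes f g :: "'a \<Rightarrow> real"
  assumes "f \<in> borel_measurable M" "g \<in> borel_measurable M"
    and "integrable M (\<lambda>x. (f x)\<^sup>2)" and "integrable M (\<lambda>x. (g x)\<^sup>2)"
  shows "integrable M (\<lambda>x. (f x - g x)\<^sup>2)"
  using assms integrable_mult_square[OF assms] by (simp add: power2_diff mult.assoc)

lemma integral_norm_square_sum:
  fixes d :: "'i \<Rightarrow> 'w \<Rightarrow> real" and g :: "'i \<Rightarrow> 'b::real_inner"
  assumes d: "\<And>p. p \<in> I \<Longrightarrow> d p \<in> borel_measurable P" "\<And>p. p \<in> I \<Longrightarrow> integrable P (\<lambda>\<omega>. (d p \<omega>)\<^sup>2)"
  shows "integrable P (\<lambda>\<omega>. (norm (\<Sum>p\<in>I. d p \<omega> *\<^sub>R g p))\<^sup>2)"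
    and "(\<integral>\<omega>. (norm (\<Sum>p\<in>I. d p \<omega> *\<^sub>R g p))\<^sup>2 \<partial>P)
      = (\<Sum>p\<in>I. \<Sum>p'\<in>I. (\<integral>\<omega>. d p \<omega> * d p' \<omega> \<partial>P) * inner (g p) (g p'))"
proof -
  have eq: "(norm (\<Sum>p\<in>I. d p \<omega> *\<^sub>R g p))\<^sup>2 = (\<Sum>p\<in>I. \<Sum>p'\<in>I. d p \<omega> * d p' \<omega> * inner (g p) (g p'))" for \<omega>
    unfolding power2_norm_eq_inner inner_sum_left by (simp add: inner_sum_right sum_distrib_left mult_ac)
  have int: "integrable P (\<lambda>\<omega>. d p \<omega> * d p' \<omega>)" if "p \<in> I" "p' \<in> I" for p p'
    by (rule integrable_mult_square) (use d that in auto)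
  show "integrable P (\<lambda>\<omega>. (norm (\<Sum>p\<in>I. d p \<omega> *\<^sub>R g p))\<^sup>2)"
    unfolding eq using int by auto
  show "(\<integral>\<omega>. (norm (\<Sum>p\<in>I. d p \<omega> *\<^sub>R g p))\<^sup>2 \<partial>P)
      = (\<Sum>p\<in>I. \<Sum>p'\<in>I. (\<integral>\<omega>. d p \<omega> * d p' \<omega> \<partial>P) * inner (g p) (g p'))"
    unfolding eq using int by (simp add: integral_sum)
qed

lemma mean_sq_eq_integral: "integrable P (\<lambda>\<omega>. (norm (X \<omega>))\<^sup>2) \<Longrightarrow> mean_sq P X = ennreal (\<integral>\<omega>. (norm (X \<omega>))\<^sup>2 \<partial>P)"
  unfolding mean_sq_def by (rule nn_integral_eq_integral) auto

section \<open>Elementary stochastic integrals\<close>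

text \<open>
  A step integrand is a list of intervals \<open>{a<..b}\<close> with operators \<open>G\<close>. The intervals may overlap: the
  difference of two elementary integrals is then the integral of a concatenated list, without passing to a
  common refinement of two partitions.
\<close>
definition elementary_integral ::
  "(real \<Rightarrow> 'w \<Rightarrow> L2I) \<Rightarrow> (real \<times> real \<times> (L2I \<Rightarrow>\<^sub>L L2I)) list \<Rightarrow> 'w \<Rightarrow> L2I" where
  "elementary_integral w L \<omega> = (\<Sum>(a, b, G)\<leftarrow>L. G (w b \<omega> - w a \<omega>))"

definition step_integrand :: "(real \<times> real \<times> (L2I \<Rightarrow>\<^sub>L L2I)) list \<Rightarrow> real \<Rightarrow> L2I \<Rightarrow>\<^sub>L L2I" where
  "step_integrand L s = (\<Sum>(a, b, G)\<leftarrow>L. indicator {a<..b} s *\<^sub>R G)"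

definition intervals_in :: "real \<Rightarrow> (real \<times> real \<times> (L2I \<Rightarrow>\<^sub>L L2I)) list \<Rightarrow> bool" where
  "intervals_in T L \<longleftrightarrow> (\<forall>(a, b, G)\<in>set L. 0 \<le> a \<and> a \<le> b \<and> b \<le> T)"

text \<open>
  One half of the Ito isometry. The constant \<open>\<kappa>\<close> takes the place of the trace of the covariance
  operator.
\<close>
definition wiener_bound :: "'w measure \<Rightarrow> real \<Rightarrow> real \<Rightarrow> (real \<Rightarrow> 'w \<Rightarrow> L2I) \<Rightarrow> bool" where
  "wiener_bound P T \<kappa> w \<longleftrightarrow> 0 \<le> \<kappa> \<and> (\<forall>t\<in>{0..T}. w t \<in> borel_measurable P) \<and>
     (\<forall>L. intervals_in T L \<longrightarrow> mean_sq P (elementary_integral w L)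
        \<le> ennreal \<kappa> * (\<integral>\<^sup>+s. ennreal ((norm (step_integrand L s))\<^sup>2) \<partial>lborel))"

lemma elementary_integral_nth:
  "elementary_integral w L \<omega> = (\<Sum>i<length L. snd (snd (L ! i)) (w (fst (snd (L ! i))) \<omega> - w (fst (L ! i)) \<omega>))"
  unfolding elementary_integral_def sum_list_sum_nth by (simp add: case_prod_beta' atLeast0LessThan)

lemma step_integrand_nth:
  "step_integrand L s = (\<Sum>i<length L. indicator {fst (L ! i)<..fst (snd (L ! i))} s *\<^sub>R snd (snd (L ! i)))"
  unfolding step_integrand_def sum_list_sum_nth by (simp add: case_prod_beta' atLeast0LessThan)

lemma intervals_in_nth:
  assumes "intervals_in T L" "i < length L"
  shows "fst (L ! i) \<in> {0..T}" "fst (snd (L ! i)) \<in> {0..T}" "fst (L ! i) \<le> fst (snd (L ! i))"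
proof -
  have "\<forall>x\<in>set L. 0 \<le> fst x \<and> fst x \<le> fst (snd x) \<and> fst (snd x) \<le> T"
    using assms(1) unfolding intervals_in_def by (auto simp: case_prod_beta')
  from bspec[OF this nth_mem[OF assms(2)]]
  show "fst (L ! i) \<in> {0..T}" "fst (snd (L ! i)) \<in> {0..T}" "fst (L ! i) \<le> fst (snd (L ! i))" by auto
qed

lemma elementary_integral_measurable:
  assumes w: "\<And>t. t \<in> {0..T} \<Longrightarrow> w t \<in> borel_measurable P" and L: "intervals_in T L"
  shows "elementary_integral w L \<in> borel_measurable P"
proof -
  have "(\<lambda>\<omega>. \<Sum>i<length L. snd (snd (L ! i)) (w (fst (snd (L ! i))) \<omega> - w (fst (L ! i)) \<omega>)) \<in> borel_measurable P"
  proof (rule borel_measurable_sum)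
    fix i assume "i \<in> {..<length L}"
    then have "fst (L ! i) \<in> {0..T}" "fst (snd (L ! i)) \<in> {0..T}"
      using intervals_in_nth[OF L] by auto
    from borel_measurable_diff[OF w[OF this(2)] w[OF this(1)]]
    show "(\<lambda>\<omega>. snd (snd (L ! i)) (w (fst (snd (L ! i))) \<omega> - w (fst (L ! i)) \<omega>)) \<in> borel_measurable P"
      by (rule blinfun_measurable)
  qed
  then show ?thesis by (simp add: elementary_integral_nth[abs_def])
qed

lemma measure_Int_Ioc:
  assumes "a \<le> b" "a' \<le> b'"
  shows "measure lborel ({a<..b} \<inter> {a'<..b'}) = min b b' - min b a' - min a b' + min a (a'::real)"
proof -
  have "{a<..b} \<inter> {a'<..b'} = {max a a'<..min b b'}" by auto
  then show ?thesis using assms by (auto simp: min_def max_def)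
qed

text \<open>
  For \<open>w = \<Sum>k. \<xi> k e k\<close> the covariance gives
  \<open>E \<langle>G (w b - w a), G' (w b' - w a')\<rangle> = \<lambda>({a<..b} \<inter> {a'<..b'}) \<beta>(G, G')\<close> with Lebesgue measure \<open>\<lambda>\<close> and the
  bilinear form \<open>\<beta>(G, G') = \<Sum>k l. q k l \<langle>G (e k), G' (e l)\<rangle>\<close>. Hence the mean square of an elementary integral
  is the integral of \<open>\<beta>\<close> along the step integrand. The same identity for a single interval \<open>{0<..T}\<close> shows that
  \<open>T \<beta>(H, H)\<close> is the mean square of \<open>H (w T - w 0)\<close>, so \<open>\<beta>(H, H) \<le> \<kappa> (norm H)\<^sup>2\<close>.
\<close>
lemma wiener_bound_finite_rank:
  fixes \<xi> :: "'k \<Rightarrow> real \<Rightarrow> 'w \<Rightarrow> real" and e :: "'k \<Rightarrow> L2I"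
  assumes T: "T > 0" and K: "finite K" and \<kappa>: "0 \<le> \<kappa>"
    and \<xi>: "\<And>k t. k \<in> K \<Longrightarrow> t \<in> {0..T} \<Longrightarrow> \<xi> k t \<in> borel_measurable P"
      "\<And>k t. k \<in> K \<Longrightarrow> t \<in> {0..T} \<Longrightarrow> integrable P (\<lambda>\<omega>. (\<xi> k t \<omega>)\<^sup>2)"
    and cov: "\<And>k l t s. k \<in> K \<Longrightarrow> l \<in> K \<Longrightarrow> t \<in> {0..T} \<Longrightarrow> s \<in> {0..T} \<Longrightarrow>
      (\<integral>\<omega>. \<xi> k t \<omega> * \<xi> l s \<omega> \<partial>P) = min t s * q k l"
    and w: "\<And>t \<omega>. t \<in> {0..T} \<Longrightarrow> w t \<omega> = (\<Sum>k\<in>K. \<xi> k t \<omega> *\<^sub>R e k)"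
    and le: "mean_sq P (\<lambda>\<omega>. w T \<omega> - w 0 \<omega>) \<le> ennreal (\<kappa> * T)"
  shows "wiener_bound P T \<kappa> w"
  unfolding wiener_bound_def
proof (intro conjI ballI allI impI \<kappa>)
  fix t assume t: "t \<in> {0..T}"
  have "(\<lambda>\<omega>. \<Sum>k\<in>K. \<xi> k t \<omega> *\<^sub>R e k) \<in> borel_measurable P"
    by (intro borel_measurable_sum borel_measurable_scaleR \<xi> t) auto
  then show "w t \<in> borel_measurable P" using w[OF t] by (simp add: fun_eq_iff cong: measurable_cong)
next
  define d where "d k a b \<omega> = \<xi> k b \<omega> - \<xi> k a \<omega>" for k a b \<omega>
  have d: "d k a b \<in> borel_measurable P" "integrable P (\<lambda>\<omega>. (d k a b \<omega>)\<^sup>2)"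
    if "k \<in> K" "a \<in> {0..T}" "b \<in> {0..T}" for k a b
    unfolding d_def using that \<xi> by (auto intro!: integrable_square_diff)
  have int: "integrable P (\<lambda>\<omega>. \<xi> k t \<omega> * \<xi> l s \<omega>)"
    if "k \<in> K" "l \<in> K" "t \<in> {0..T}" "s \<in> {0..T}" for k l t s
    by (intro integrable_mult_square \<xi> that)
  have dd: "(\<integral>\<omega>. d k a b \<omega> * d l a' b' \<omega> \<partial>P) = q k l * measure lborel ({a<..b} \<inter> {a'<..b'})"
    if "k \<in> K" "l \<in> K" "a \<in> {0..T}" "b \<in> {0..T}" "a' \<in> {0..T}" "b' \<in> {0..T}" "a \<le> b" "a' \<le> b'"
    for k l a b a' b'
  proof -
    have "(\<integral>\<omega>. d k a b \<omega> * d l a' b' \<omega> \<partial>P)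
        = (\<integral>\<omega>. (\<xi> k b \<omega> * \<xi> l b' \<omega> - \<xi> k b \<omega> * \<xi> l a' \<omega>) - (\<xi> k a \<omega> * \<xi> l b' \<omega> - \<xi> k a \<omega> * \<xi> l a' \<omega>) \<partial>P)"
      unfolding d_def by (simp add: algebra_simps)
    also have "\<dots> = (min b b' * q k l - min b a' * q k l) - (min a b' * q k l - min a a' * q k l)"
      using that by (simp add: int cov)
    finally show ?thesis
      unfolding measure_Int_Ioc[OF that(7,8)] by (simp add: algebra_simps)
  qed
  \<comment> \<open>The quadratic form \<open>\<beta>(H, H)\<close>; positivity comes from its interpretation as a mean square.\<close>
  define \<beta> where "\<beta> H = (\<Sum>k\<in>K. \<Sum>l\<in>K. q k l * inner (H (e k)) (H (e l)))" for H :: "L2I \<Rightarrow>\<^sub>L L2I"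
  have \<beta>_le: "\<beta> H \<le> \<kappa> * (norm H)\<^sup>2" and \<beta>_nonneg: "0 \<le> \<beta> H" for H
  proof -
    have 0: "0 \<in> {0..T}" "T \<in> {0..T}" using T by auto
    have sum: "(\<Sum>k\<in>K. d k 0 T \<omega> *\<^sub>R H (e k)) = H (w T \<omega> - w 0 \<omega>)" for \<omega>
      unfolding d_def w[OF 0(1)] w[OF 0(2)]
      by (simp add: blinfun.bilinear_simps sum_subtractf[symmetric] scaleR_diff_left blinfun.sum_right)
    have I: "integrable P (\<lambda>\<omega>. (norm (H (w T \<omega> - w 0 \<omega>)))\<^sup>2)"
      "(\<integral>\<omega>. (norm (H (w T \<omega> - w 0 \<omega>)))\<^sup>2 \<partial>P)
        = (\<Sum>k\<in>K. \<Sum>l\<in>K. (\<integral>\<omega>. d k 0 T \<omega> * d l 0 T \<omega> \<partial>P) * inner (H (e k)) (H (e l)))"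
      unfolding sum[symmetric] by (rule integral_norm_square_sum; rule d[OF _ 0]; assumption)+
    have "(\<integral>\<omega>. (norm (H (w T \<omega> - w 0 \<omega>)))\<^sup>2 \<partial>P) = (\<Sum>k\<in>K. \<Sum>l\<in>K. (T * q k l) * inner (H (e k)) (H (e l)))"
      unfolding I(2) using dd[OF _ _ 0 0] T by (intro sum.cong refl) (simp add: mult.commute)
    also have "\<dots> = T * \<beta> H" by (simp add: \<beta>_def sum_distrib_left mult_ac)
    finally have eq: "T * \<beta> H = (\<integral>\<omega>. (norm (H (w T \<omega> - w 0 \<omega>)))\<^sup>2 \<partial>P)" ..
    have "0 \<le> T * \<beta> H" unfolding eq by (rule Bochner_Integration.integral_nonneg) simp
    then show "0 \<le> \<beta> H" using T by (simp add: zero_le_mult_iff)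
    have "ennreal (T * \<beta> H) = mean_sq P (\<lambda>\<omega>. H (w T \<omega> - w 0 \<omega>))"
      unfolding eq by (rule mean_sq_eq_integral[symmetric]) (rule I(1))
    also have "\<dots> \<le> ennreal ((norm H)\<^sup>2) * mean_sq P (\<lambda>\<omega>. w T \<omega> - w 0 \<omega>)"
    proof (rule mean_sq_blinfun_le)
      have "(\<lambda>\<omega>. \<Sum>k\<in>K. d k 0 T \<omega> *\<^sub>R e k) \<in> borel_measurable P"
        by (intro borel_measurable_sum borel_measurable_scaleR d 0) auto
      moreover have "(\<Sum>k\<in>K. d k 0 T \<omega> *\<^sub>R e k) = w T \<omega> - w 0 \<omega>" for \<omega>
        unfolding d_def w[OF 0(1)] w[OF 0(2)] by (simp add: sum_subtractf[symmetric] scaleR_diff_left)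
      ultimately show "(\<lambda>\<omega>. w T \<omega> - w 0 \<omega>) \<in> borel_measurable P" by simp
    qed
    also have "\<dots> \<le> ennreal ((norm H)\<^sup>2) * ennreal (\<kappa> * T)" by (intro mult_left_mono le) simp
    also have "\<dots> = ennreal (T * (\<kappa> * (norm H)\<^sup>2))"
      using \<kappa> T by (simp add: ennreal_mult[symmetric] mult_ac)
    finally have "T * \<beta> H \<le> T * (\<kappa> * (norm H)\<^sup>2)"
      using \<kappa> T by (subst (asm) ennreal_le_iff) auto
    then show "\<beta> H \<le> \<kappa> * (norm H)\<^sup>2" using T by simp
  qed
  fix L assume L: "intervals_in T L"
  define a where "a i = fst (L ! i)" for i
  define b where "b i = fst (snd (L ! i))" for i
  define G where "G i = snd (snd (L ! i))" for i
  have ab: "a i \<in> {0..T} \<and> b i \<in> {0..T} \<and> a i \<le> b i" if "i < length L" for i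
    using intervals_in_nth[OF L that] unfolding a_def b_def by blast
  let ?I = "{..<length L} \<times> K"
  let ?d = "\<lambda>p. d (snd p) (a (fst p)) (b (fst p))"
  let ?g = "\<lambda>p. G (fst p) (e (snd p))"
  let ?q = "\<lambda>p p'. q (snd p) (snd p') * inner (?g p) (?g p')"
  let ?J = "\<lambda>p p'. {a (fst p)<..b (fst p)} \<inter> {a (fst p')<..b (fst p')}"
  have sum: "elementary_integral w L \<omega> = (\<Sum>p\<in>?I. ?d p \<omega> *\<^sub>R ?g p)" for \<omega>
  proof -
    have "elementary_integral w L \<omega> = (\<Sum>i<length L. G i (w (b i) \<omega> - w (a i) \<omega>))"
      by (simp add: elementary_integral_nth a_def b_def G_def)
    also have "\<dots> = (\<Sum>i<length L. \<Sum>k\<in>K. d k (a i) (b i) \<omega> *\<^sub>R G i (e k))"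
    proof (rule sum.cong[OF refl])
      fix i assume "i \<in> {..<length L}"
      then have "a i \<in> {0..T}" "b i \<in> {0..T}" using ab by auto
      then show "G i (w (b i) \<omega> - w (a i) \<omega>) = (\<Sum>k\<in>K. d k (a i) (b i) \<omega> *\<^sub>R G i (e k))"
        by (simp add: w d_def blinfun.bilinear_simps sum_subtractf[symmetric] scaleR_diff_left blinfun.sum_right)
    qed
    also have "\<dots> = (\<Sum>p\<in>?I. ?d p \<omega> *\<^sub>R ?g p)" by (simp add: sum.cartesian_product case_prod_beta')
    finally show ?thesis .
  qed
  have step: "(\<Sum>p\<in>?I. \<Sum>p'\<in>?I. ?q p p' * indicator (?J p p') s) = \<beta> (step_integrand L s)" for s
  proof -
    define h where "h i = (indicator {a i<..b i} s :: real)" for i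
    have prod_sum: "(\<Sum>p\<in>?I. F p) = (\<Sum>i<length L. \<Sum>k\<in>K. F (i, k))" for F :: "_ \<Rightarrow> real"
      by (simp add: sum.cartesian_product case_prod_beta')
    have Hs: "step_integrand L s y = (\<Sum>i<length L. h i *\<^sub>R G i y)" for y
      by (simp add: step_integrand_nth h_def a_def b_def G_def blinfun.sum_left blinfun.scaleR_left)
    have "\<beta> (step_integrand L s)
        = (\<Sum>k\<in>K. \<Sum>l\<in>K. \<Sum>i<length L. \<Sum>j<length L. q k l * (h i * (h j * inner (G i (e k)) (G j (e l)))))"
      unfolding \<beta>_def Hs inner_sum_left by (simp add: inner_sum_right sum_distrib_left mult_ac)
    also have "\<dots> = (\<Sum>k\<in>K. \<Sum>i<length L. \<Sum>l\<in>K. \<Sum>j<length L. q k l * (h i * (h j * inner (G i (e k)) (G j (e l)))))"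
      by (rule sum.cong[OF refl], rule sum.swap)
    also have "\<dots> = (\<Sum>i<length L. \<Sum>k\<in>K. \<Sum>l\<in>K. \<Sum>j<length L. q k l * (h i * (h j * inner (G i (e k)) (G j (e l)))))"
      by (rule sum.swap)
    also have "\<dots> = (\<Sum>i<length L. \<Sum>k\<in>K. \<Sum>j<length L. \<Sum>l\<in>K. q k l * (h i * (h j * inner (G i (e k)) (G j (e l)))))"
      by (rule sum.cong[OF refl], rule sum.cong[OF refl], rule sum.swap)
    also have "\<dots> = (\<Sum>p\<in>?I. \<Sum>p'\<in>?I. ?q p p' * indicator (?J p p') s)"
by (simp only: prod_sum fst_conv snd_conv h_def indicator_inter_arith mult_ac)
    finally show ?thesis by simp
  qed
  have Jint: "integrable lborel (indicator (?J p p') :: real \<Rightarrow> real)" for p p'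
  proof -
    have "?J p p' = {max (a (fst p)) (a (fst p'))<..min (b (fst p)) (b (fst p'))}" by auto
    moreover have "emeasure lborel {x<..y} < \<infinity>" for x y :: real
      by (cases "x \<le> y") auto
    ultimately show ?thesis by (simp only: integrable_indicator_iff) simp
  qed
  have \<beta>int: "integrable lborel (\<lambda>s. \<beta> (step_integrand L s))"
    unfolding step[symmetric] using Jint by (intro Bochner_Integration.integrable_sum) auto
  have dI: "?d p \<in> borel_measurable P" "integrable P (\<lambda>\<omega>. (?d p \<omega>)\<^sup>2)" if "p \<in> ?I" for p
    using that ab by (auto intro!: d)
  have I: "integrable P (\<lambda>\<omega>. (norm (elementary_integral w L \<omega>))\<^sup>2)"
    "(\<integral>\<omega>. (norm (elementary_integral w L \<omega>))\<^sup>2 \<partial>P)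
      = (\<Sum>p\<in>?I. \<Sum>p'\<in>?I. (\<integral>\<omega>. ?d p \<omega> * ?d p' \<omega> \<partial>P) * inner (?g p) (?g p'))"
    unfolding sum by (rule integral_norm_square_sum; rule dI; assumption)+
  have "(\<integral>\<omega>. (norm (elementary_integral w L \<omega>))\<^sup>2 \<partial>P)
      = (\<Sum>p\<in>?I. \<Sum>p'\<in>?I. q (snd p) (snd p') * measure lborel (?J p p') * inner (?g p) (?g p'))"
    unfolding I(2)
  proof (intro sum.cong refl)
    fix p p' assume "p \<in> ?I" "p' \<in> ?I"
    then show "(\<integral>\<omega>. ?d p \<omega> * ?d p' \<omega> \<partial>P) * inner (?g p) (?g p')
        = q (snd p) (snd p') * measure lborel (?J p p') * inner (?g p) (?g p')"
      using ab by (subst dd) auto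
  qed
  also have "\<dots> = (\<Sum>p\<in>?I. \<Sum>p'\<in>?I. \<integral>s. ?q p p' * indicator (?J p p') s \<partial>lborel)"
    by (simp add: mult_ac)
  also have "\<dots> = (\<integral>s. (\<Sum>p\<in>?I. \<Sum>p'\<in>?I. ?q p p' * indicator (?J p p') s) \<partial>lborel)"
    by (simp only: Bochner_Integration.integral_sum Bochner_Integration.integrable_sum
        integrable_mult_right Jint)
  also have "\<dots> = (\<integral>s. \<beta> (step_integrand L s) \<partial>lborel)" by (simp only: step)
  finally have "mean_sq P (elementary_integral w L) = ennreal (\<integral>s. \<beta> (step_integrand L s) \<partial>lborel)"
    using mean_sq_eq_integral[OF I(1)] by simp
  also have "\<dots> = (\<integral>\<^sup>+s. ennreal (\<beta> (step_integrand L s)) \<partial>lborel)"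
    by (rule nn_integral_eq_integral[symmetric, OF \<beta>int]) (simp add: \<beta>_nonneg)
  also have "\<dots> \<le> (\<integral>\<^sup>+s. ennreal \<kappa> * ennreal ((norm (step_integrand L s))\<^sup>2) \<partial>lborel)"
    by (intro nn_integral_mono) (simp add: ennreal_mult[symmetric] \<kappa> ennreal_leI \<beta>_le)
  also have "\<dots> = ennreal \<kappa> * (\<integral>\<^sup>+s. ennreal ((norm (step_integrand L s))\<^sup>2) \<partial>lborel)"
  proof (rule nn_integral_cmult)
    have "simple_function borel (step_integrand L)"
      unfolding step_integrand_nth[abs_def]
      by (intro simple_function_sum simple_function_indicator) auto
    then have [measurable]: "step_integrand L \<in> borel_measurable borel"
      using measurable_compose[OF measurable_simple_function, of borel "step_integrand L" "\<lambda>x. x" borel] by simp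
    show "(\<lambda>s. ennreal ((norm (step_integrand L s))\<^sup>2)) \<in> borel_measurable lborel" by measurable
  qed
  finally show "mean_sq P (elementary_integral w L)
    \<le> ennreal \<kappa> * (\<integral>\<^sup>+s. ennreal ((norm (step_integrand L s))\<^sup>2) \<partial>lborel)" .
qed

lemma mean_sq_minus: "mean_sq P (\<lambda>\<omega>. - Y \<omega>) = mean_sq P Y"
  by (simp add: mean_sq_def)

lemma mean_sq_diff_tendsto_0:
  fixes X Y :: "nat \<Rightarrow> 'w \<Rightarrow> 'b::{real_normed_vector, second_countable_topology}"
  assumes "\<And>n. X n \<in> borel_measurable P" "\<And>n. Y n \<in> borel_measurable P"
    and "(\<lambda>n. mean_sq P (X n)) \<longlonglongrightarrow> 0" "(\<lambda>n. mean_sq P (Y n)) \<longlonglongrightarrow> 0"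
  shows "(\<lambda>n. mean_sq P (\<lambda>\<omega>. X n \<omega> - Y n \<omega>)) \<longlonglongrightarrow> 0"
proof (rule tendsto_sandwich[OF always_eventually always_eventually tendsto_const])
  have "(\<lambda>n. 2 * mean_sq P (X n) + 2 * mean_sq P (Y n)) \<longlonglongrightarrow> 2 * 0 + 2 * 0"
    by (intro tendsto_add ennreal_tendsto_cmult assms) auto
  then show "(\<lambda>n. 2 * mean_sq P (X n) + 2 * mean_sq P (Y n)) \<longlonglongrightarrow> 0" by simp
  show "\<forall>n. mean_sq P (\<lambda>\<omega>. X n \<omega> - Y n \<omega>) \<le> 2 * mean_sq P (X n) + 2 * mean_sq P (Y n)"
    using mean_sq_triangle[of "X _" P "\<lambda>_. 0" "Y _"] assms(1,2)
    by (simp add: mean_sq_minus)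
qed simp

lemma mean_sq_sum_tendsto_0:
  fixes X :: "'i \<Rightarrow> nat \<Rightarrow> 'w \<Rightarrow> 'b::{real_normed_vector, second_countable_topology}"
  assumes "finite I" "\<And>i n. i \<in> I \<Longrightarrow> X i n \<in> borel_measurable P"
    and "\<And>i. i \<in> I \<Longrightarrow> (\<lambda>n. mean_sq P (X i n)) \<longlonglongrightarrow> 0"
  shows "(\<lambda>n. mean_sq P (\<lambda>\<omega>. \<Sum>i\<in>I. X i n \<omega>)) \<longlonglongrightarrow> 0"
  using assms
proof (induction I rule: finite_induct)
  case empty
  then show ?case by (simp add: mean_sq_def)
next
  case (insert i I)
  have "(\<lambda>n. mean_sq P (\<lambda>\<omega>. X i n \<omega> - - (\<Sum>i\<in>I. X i n \<omega>))) \<longlonglongrightarrow> 0"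
    using insert by (intro mean_sq_diff_tendsto_0) (auto simp: mean_sq_minus)
  then show ?case using insert(1,2) by simp
qed

lemma elementary_integral_tendsto:
  assumes w: "\<And>N t. t \<in> {0..T} \<Longrightarrow> wN N t \<in> borel_measurable P"
    and lim: "\<And>t. t \<in> {0..T} \<Longrightarrow> msq_tendsto P (\<lambda>N. wN N t) (w t)"
    and L: "intervals_in T L"
  shows "msq_tendsto P (\<lambda>N. elementary_integral (wN N) L) (elementary_integral w L)"
  unfolding msq_tendsto_def
proof
  have wm: "w t \<in> borel_measurable P" if "t \<in> {0..T}" for t
    using lim[OF that] by (simp add: msq_tendsto_def)
  then show "elementary_integral w L \<in> borel_measurable P"
    by (rule elementary_integral_measurable[OF _ L])
  define D where "D t N \<omega> = wN N t \<omega> - w t \<omega>" for t N \<omega>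
  have D: "D t N \<in> borel_measurable P" "(\<lambda>N. mean_sq P (D t N)) \<longlonglongrightarrow> 0" if "t \<in> {0..T}" for t N
    using that w wm lim by (auto simp: D_def[abs_def] msq_tendsto_def)
  define X where "X i N \<omega> = snd (snd (L ! i)) (D (fst (snd (L ! i))) N \<omega> - D (fst (L ! i)) N \<omega>)" for i N \<omega>
  have "(\<lambda>N. mean_sq P (\<lambda>\<omega>. \<Sum>i<length L. X i N \<omega>)) \<longlonglongrightarrow> 0"
  proof (rule mean_sq_sum_tendsto_0)
    fix i assume "i \<in> {..<length L}"
    then have ab: "fst (L ! i) \<in> {0..T}" "fst (snd (L ! i)) \<in> {0..T}"
      using intervals_in_nth[OF L] by auto
    let ?d = "\<lambda>N \<omega>. D (fst (snd (L ! i))) N \<omega> - D (fst (L ! i)) N \<omega>"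
    let ?c = "ennreal ((norm (snd (snd (L ! i))))\<^sup>2)"
    have dm: "?d N \<in> borel_measurable P" for N using D(1) ab by simp
    then show "X i N \<in> borel_measurable P" for N
      unfolding X_def[abs_def] by (rule blinfun_measurable)
    have "(\<lambda>N. ?c * mean_sq P (?d N)) \<longlonglongrightarrow> ?c * 0"
      by (intro ennreal_tendsto_cmult mean_sq_diff_tendsto_0 D ab) simp
    then have up: "(\<lambda>N. ?c * mean_sq P (?d N)) \<longlonglongrightarrow> 0" by simp
    show "(\<lambda>N. mean_sq P (X i N)) \<longlonglongrightarrow> 0"
      by (rule tendsto_sandwich[OF always_eventually always_eventually tendsto_const up])
        (simp_all add: X_def[abs_def] mean_sq_blinfun_le[OF dm])
  qed simp
  also have "(\<lambda>N \<omega>. \<Sum>i<length L. X i N \<omega>) = (\<lambda>N \<omega>. elementary_integral (wN N) L \<omega> - elementary_integral w L \<omega>)"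
    by (simp add: elementary_integral_nth X_def D_def sum_subtractf[symmetric] blinfun.diff_right[symmetric] algebra_simps)
  finally show "(\<lambda>N. mean_sq P (\<lambda>\<omega>. elementary_integral (wN N) L \<omega> - elementary_integral w L \<omega>)) \<longlonglongrightarrow> 0" .
qed

text \<open>
  The factor 2 comes from the triangle inequality for mean squares.
\<close>
lemma wiener_bound_limit:
  assumes wN: "\<And>N. wiener_bound P T \<kappa> (wN N)"
    and lim: "\<And>t. t \<in> {0..T} \<Longrightarrow> msq_tendsto P (\<lambda>N. wN N t) (w t)"
  shows "wiener_bound P T (2 * \<kappa>) w"
  unfolding wiener_bound_def
proof (intro conjI ballI allI impI)
  show "0 \<le> 2 * \<kappa>" using wN[of 0] by (simp add: wiener_bound_def)
  show "w t \<in> borel_measurable P" if "t \<in> {0..T}" for t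
    using lim[OF that] by (simp add: msq_tendsto_def)
  fix L assume L: "intervals_in T L"
  have wNm: "wN N t \<in> borel_measurable P" if "t \<in> {0..T}" for N t
    using wN that by (simp add: wiener_bound_def)
  let ?s = "\<integral>\<^sup>+s. ennreal ((norm (step_integrand L s))\<^sup>2) \<partial>lborel"
  have E: "msq_tendsto P (\<lambda>N. elementary_integral (wN N) L) (elementary_integral w L)"
    by (rule elementary_integral_tendsto[OF wNm lim L])
  then have "mean_sq P (\<lambda>\<omega>. elementary_integral w L \<omega> - 0) \<le> 2 * (ennreal \<kappa> * ?s)"
    using wN L
    by (intro mean_sq_limit_le[of "\<lambda>N. elementary_integral (wN N) L"] elementary_integral_measurable[OF wNm])
      (auto simp: msq_tendsto_def wiener_bound_def)
  then show "mean_sq P (elementary_integral w L) \<le> ennreal (2 * \<kappa>) * ?s"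
    using wN[of 0] by (simp add: wiener_bound_def ennreal_mult mult.assoc)
qed

text \<open>
  Partition points may coincide; the interval is found as the first one that reaches \<open>s\<close>.
\<close>
lemma partition_step:
  fixes \<tau> :: "nat \<Rightarrow> real"
  assumes mono: "\<And>i. i < m \<Longrightarrow> \<tau> i \<le> \<tau> (Suc i)"
  shows "i \<le> j \<Longrightarrow> j \<le> m \<Longrightarrow> \<tau> i \<le> \<tau> j"
    and "\<tau> 0 < s \<Longrightarrow> s \<le> \<tau> m \<Longrightarrow> \<exists>i<m. \<forall>j<m. s \<in> {\<tau> j<..\<tau> (Suc j)} \<longleftrightarrow> j = i"
proof -
  show le: "\<tau> i \<le> \<tau> j" if "i \<le> j" "j \<le> m" for i j
    using that by (induction j rule: dec_induct) (auto intro: order_trans[OF _ mono])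
  assume s: "\<tau> 0 < s" "s \<le> \<tau> m"
  define i where "i = (LEAST i. s \<le> \<tau> (Suc i))"
  have m: "m > 0" using s by (cases m) auto
  have ex: "s \<le> \<tau> (Suc (m - 1))" using m s by simp
  have i: "s \<le> \<tau> (Suc i)" unfolding i_def by (rule LeastI[of _ "m - 1"]) (rule ex)
  have im: "i < m" using Least_le[of "\<lambda>i. s \<le> \<tau> (Suc i)", OF ex] m by (simp add: i_def)
  have lower: "\<tau> i < s"
  proof (cases i)
    case (Suc k)
    then show ?thesis using not_less_Least[of k "\<lambda>i. s \<le> \<tau> (Suc i)"] by (simp add: i_def not_le)
  qed (use s in simp)
  have "j = i" if "j < m" "s \<in> {\<tau> j<..\<tau> (Suc j)}" for j
  proof (rule ccontr)
    assume "j \<noteq> i"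
    then consider "Suc j \<le> i" | "Suc i \<le> j" by linarith
    then show False
    proof cases
      case 1
      from le[OF 1 less_imp_le[OF im]] lower that(2) show False by simp
    next
      case 2
      from le[OF 2 less_imp_le[OF that(1)]] i that(2) show False by simp
    qed
  qed
  moreover have "s \<in> {\<tau> i<..\<tau> (Suc i)}" using i lower by simp
  ultimately show "\<exists>i<m. \<forall>j<m. s \<in> {\<tau> j<..\<tau> (Suc j)} \<longleftrightarrow> j = i"
    using im by blast
qed

lemma step_integrand_map:
  "step_integrand (map (\<lambda>i. (lo i, hi i, G i)) [0..<m]) s = (\<Sum>i<m. indicator {lo i<..hi i} s *\<^sub>R G i)"
  by (simp add: step_integrand_def interv_sum_list_conv_sum_set_nat comp_def atLeast0LessThan)

lemma elementary_integral_map: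
  "elementary_integral w (map (\<lambda>i. (lo i, hi i, G i)) [0..<m]) \<omega> = (\<Sum>i<m. G i (w (hi i) \<omega> - w (lo i) \<omega>))"
  by (simp add: elementary_integral_def interv_sum_list_conv_sum_set_nat comp_def atLeast0LessThan)

lemma step_integrand_partition:
  fixes \<tau> :: "nat \<Rightarrow> real"
  assumes mono: "\<And>i. i < m \<Longrightarrow> \<tau> i \<le> \<tau> (Suc i)" and s: "\<tau> 0 < s" "s \<le> \<tau> m"
  obtains i where "i < m" "s \<in> {\<tau> i<..\<tau> (Suc i)}"
    "step_integrand (map (\<lambda>i. (\<tau> i, \<tau> (Suc i), G i)) [0..<m]) s = G i"
proof -
  obtain i where i: "i < m" "\<forall>j<m. s \<in> {\<tau> j<..\<tau> (Suc j)} \<longleftrightarrow> j = i"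
    using partition_step(2)[of m \<tau>, OF mono s] by blast
  have "step_integrand (map (\<lambda>i. (\<tau> i, \<tau> (Suc i), G i)) [0..<m]) s
      = (\<Sum>j<m. if j = i then G j else 0)"
    unfolding step_integrand_map using i(2) by (intro sum.cong) (auto simp: indicator_def)
  also have "\<dots> = G i" using i(1) by simp
  finally show ?thesis using i that by blast
qed

definition negate :: "(real \<times> real \<times> (L2I \<Rightarrow>\<^sub>L L2I)) list \<Rightarrow> (real \<times> real \<times> (L2I \<Rightarrow>\<^sub>L L2I)) list" where
  "negate L = map (\<lambda>(a, b, G). (a, b, - G)) L"

lemma step_integrand_append_negate:
  "step_integrand (L1 @ negate L2) s = step_integrand L1 s - step_integrand L2 s"
proof -
  have "step_integrand (negate L2) s = - step_integrand L2 s"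
    by (induction L2) (auto simp: step_integrand_def negate_def)
  then show ?thesis by (simp add: step_integrand_def)
qed

lemma elementary_integral_append_negate:
  "elementary_integral w (L1 @ negate L2) \<omega> = elementary_integral w L1 \<omega> - elementary_integral w L2 \<omega>"
proof -
  have "elementary_integral w (negate L2) \<omega> = - elementary_integral w L2 \<omega>"
    by (induction L2) (auto simp: elementary_integral_def negate_def blinfun.minus_left)
  then show ?thesis by (simp add: elementary_integral_def)
qed

lemma intervals_in_append_negate:
  "intervals_in T L1 \<Longrightarrow> intervals_in T L2 \<Longrightarrow> intervals_in T (L1 @ negate L2)"
  by (auto simp: intervals_in_def negate_def)

lemma intervals_in_mono: "intervals_in t L \<Longrightarrow> t \<le> T \<Longrightarrow> intervals_in T L"
  by (force simp: intervals_in_def)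

lemma step_integrand_outside:
  assumes "intervals_in t L" "s \<notin> {0<..t}" shows "step_integrand L s = 0"
proof -
  have "(\<Sum>i<length L. indicator {fst (L ! i)<..fst (snd (L ! i))} s *\<^sub>R snd (snd (L ! i))) = 0"
  proof (rule sum.neutral, rule ballI)
    fix i assume "i \<in> {..<length L}"
    then show "indicator {fst (L ! i)<..fst (snd (L ! i))} s *\<^sub>R snd (snd (L ! i)) = 0"
      using intervals_in_nth[OF assms(1), of i] assms(2) by (auto simp: indicator_def)
  qed
  then show ?thesis by (simp add: step_integrand_nth)
qed

section \<open>Wiener integrals of deterministic integrands\<close>

text \<open>
  Compares the elementary integrals that define \<open>Z\<close> with the given one. The constant 4 is the
  product of two uses of the triangle inequality for squares, one for the integrands and one for the mean squares.
  Taking \<open>L\<close> empty bounds \<open>Z\<close> itself.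
\<close>
lemma wiener_integral_step_approximation:
  assumes w: "wiener_bound P T \<kappa> w" and t: "0 \<le> t" "t \<le> T"
    and Z: "has_wiener_integral P w 0 t F Z" and F: "continuous_on {0..t} F"
    and L: "intervals_in t L" and close: "\<And>s. s \<in> {0<..t} \<Longrightarrow> norm (F s - step_integrand L s) \<le> \<epsilon>"
    and \<epsilon>: "0 \<le> \<epsilon>"
  shows "mean_sq P (\<lambda>\<omega>. Z \<omega> - elementary_integral w L \<omega>) \<le> ennreal (4 * \<kappa> * \<epsilon>\<^sup>2 * T)"
proof -
  obtain m \<tau> G where \<tau>: "\<And>n. \<tau> n 0 = 0" "\<And>n. \<tau> n (m n) = t" "\<And>n i. i < m n \<Longrightarrow> \<tau> n i \<le> \<tau> n (Suc i)"
    and F_lim: "(\<lambda>n. \<Sum>i<m n. \<integral>\<^sup>+s\<in>{\<tau> n i<..\<tau> n (Suc i)}. ennreal ((norm (G n i - F s))\<^sup>2) \<partial>lborel) \<longlonglongrightarrow> 0"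
    and Z_lim: "msq_tendsto P (\<lambda>n \<omega>. \<Sum>i<m n. G n i (w (\<tau> n (Suc i)) \<omega> - w (\<tau> n i) \<omega>)) Z"
    using Z unfolding has_wiener_integral_def by blast
  have \<kappa>: "0 \<le> \<kappa>" and wm: "\<And>t. t \<in> {0..T} \<Longrightarrow> w t \<in> borel_measurable P"
    and bound: "\<And>L. intervals_in T L \<Longrightarrow> mean_sq P (elementary_integral w L)
        \<le> ennreal \<kappa> * (\<integral>\<^sup>+s. ennreal ((norm (step_integrand L s))\<^sup>2) \<partial>lborel)"
    using w by (auto simp: wiener_bound_def)
  define Ln where "Ln n = map (\<lambda>i. (\<tau> n i, \<tau> n (Suc i), G n i)) [0..<m n]" for n
  define c where "c n i = (\<integral>\<^sup>+s\<in>{\<tau> n i<..\<tau> n (Suc i)}. ennreal ((norm (G n i - F s))\<^sup>2) \<partial>lborel)" for n i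
  have \<tau>_in: "0 \<le> \<tau> n i" "\<tau> n i \<le> t" if "i \<le> m n" for n i
    using partition_step(1)[of "m n" "\<tau> n" 0 i] partition_step(1)[of "m n" "\<tau> n" i "m n"] \<tau> that by auto
  have Ln: "intervals_in t (Ln n)" for n
    using \<tau>_in \<tau>(3) by (auto simp: intervals_in_def Ln_def)
  note LT = intervals_in_mono[OF L t(2)] and LnT = intervals_in_mono[OF Ln t(2)]
  have Em: "elementary_integral w L' \<in> borel_measurable P" if "intervals_in T L'" for L'
    by (rule elementary_integral_measurable[OF wm that])
  have diff_le: "mean_sq P (\<lambda>\<omega>. elementary_integral w (Ln n) \<omega> - elementary_integral w L \<omega>)
      \<le> ennreal \<kappa> * (2 * (\<Sum>i<m n. c n i) + ennreal (2 * \<epsilon>\<^sup>2 * t))" for n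
  proof -
    let ?f = "\<lambda>i s. ennreal ((norm (G n i - F s))\<^sup>2) * indicator {\<tau> n i<..\<tau> n (Suc i)} s"
    have fm: "?f i \<in> borel_measurable lborel" if "i < m n" for i
    proof -
      have "continuous_on {0..t} (\<lambda>s. (norm (G n i - F s))\<^sup>2)" by (intro continuous_intros F)
      then have "continuous_on {\<tau> n i<..\<tau> n (Suc i)} (\<lambda>s. (norm (G n i - F s))\<^sup>2)"
        by (rule continuous_on_subset) (use \<tau>_in[of i n] \<tau>_in[of "Suc i" n] that in auto)
      then have "(\<lambda>s. indicator {\<tau> n i<..\<tau> n (Suc i)} s *\<^sub>R (norm (G n i - F s))\<^sup>2) \<in> borel_measurable borel"
        by (intro borel_measurable_continuous_on_indicator) auto
      then have "(\<lambda>s. ennreal (indicator {\<tau> n i<..\<tau> n (Suc i)} s *\<^sub>R (norm (G n i - F s))\<^sup>2)) \<in> borel_measurable lborel"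
        by simp
      also have "(\<lambda>s. ennreal (indicator {\<tau> n i<..\<tau> n (Suc i)} s *\<^sub>R (norm (G n i - F s))\<^sup>2)) = ?f i"
        by (auto simp: fun_eq_iff indicator_def)
      finally show ?thesis .
    qed
    have pt: "ennreal ((norm (step_integrand (Ln n @ negate L) s))\<^sup>2)
        \<le> 2 * (\<Sum>i<m n. ?f i s) + ennreal (2 * \<epsilon>\<^sup>2) * indicator {0<..t} s" for s
    proof (cases "s \<in> {0<..t}")
      case True
      then obtain i where i: "i < m n" "s \<in> {\<tau> n i<..\<tau> n (Suc i)}" "step_integrand (Ln n) s = G n i"
        unfolding Ln_def using step_integrand_partition[of "m n" "\<tau> n" s "G n"] \<tau> by auto
      have "norm (step_integrand (Ln n @ negate L) s) \<le> norm (G n i - F s) + \<epsilon>"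
        using norm_triangle_ineq[of "G n i - F s" "F s - step_integrand L s"] close[OF True]
        by (simp add: step_integrand_append_negate i(3))
      then have "(norm (step_integrand (Ln n @ negate L) s))\<^sup>2 \<le> (norm (G n i - F s) + \<epsilon>)\<^sup>2"
        by (rule power_mono) simp
      also have "\<dots> \<le> 2 * (norm (G n i - F s))\<^sup>2 + 2 * \<epsilon>\<^sup>2"
        using sum_squares_bound[of "norm (G n i - F s)" \<epsilon>] by (simp add: power2_sum)
      finally have "ennreal ((norm (step_integrand (Ln n @ negate L) s))\<^sup>2)
          \<le> ennreal (2 * (norm (G n i - F s))\<^sup>2 + 2 * \<epsilon>\<^sup>2)" by (rule ennreal_leI)
      also have "\<dots> = 2 * ?f i s + ennreal (2 * \<epsilon>\<^sup>2) * indicator {0<..t} s"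
        using i(2) True by (simp add: ennreal_plus ennreal_mult)
      also have "\<dots> \<le> 2 * (\<Sum>i<m n. ?f i s) + ennreal (2 * \<epsilon>\<^sup>2) * indicator {0<..t} s"
        by (intro add_right_mono mult_left_mono member_le_sum) (use i in auto)
      finally show ?thesis .
    next
      case False
      then show ?thesis
        by (simp add: step_integrand_append_negate step_integrand_outside[OF L] step_integrand_outside[OF Ln])
    qed
    have "mean_sq P (\<lambda>\<omega>. elementary_integral w (Ln n) \<omega> - elementary_integral w L \<omega>)
        \<le> ennreal \<kappa> * (\<integral>\<^sup>+s. ennreal ((norm (step_integrand (Ln n @ negate L) s))\<^sup>2) \<partial>lborel)"
      using bound[OF intervals_in_append_negate[OF LnT LT]]
      by (simp add: elementary_integral_append_negate[abs_def])
    also have "(\<integral>\<^sup>+s. ennreal ((norm (step_integrand (Ln n @ negate L) s))\<^sup>2) \<partial>lborel)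
        \<le> (\<integral>\<^sup>+s. 2 * (\<Sum>i<m n. ?f i s) + ennreal (2 * \<epsilon>\<^sup>2) * indicator {0<..t} s \<partial>lborel)"
      by (intro nn_integral_mono pt)
    also have "\<dots> = (\<integral>\<^sup>+s. 2 * (\<Sum>i<m n. ?f i s) \<partial>lborel) + (\<integral>\<^sup>+s. ennreal (2 * \<epsilon>\<^sup>2) * indicator {0<..t} s \<partial>lborel)"
      by (intro nn_integral_add borel_measurable_times_ennreal borel_measurable_sum fm) auto
    also have "(\<integral>\<^sup>+s. 2 * (\<Sum>i<m n. ?f i s) \<partial>lborel) = 2 * (\<Sum>i<m n. c n i)"
    proof -
      have "(\<integral>\<^sup>+s. 2 * (\<Sum>i<m n. ?f i s) \<partial>lborel) = 2 * (\<integral>\<^sup>+s. (\<Sum>i<m n. ?f i s) \<partial>lborel)"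
        by (rule nn_integral_cmult) (rule borel_measurable_sum, rule fm, simp only: lessThan_iff)
      also have "(\<integral>\<^sup>+s. (\<Sum>i<m n. ?f i s) \<partial>lborel) = (\<Sum>i<m n. c n i)"
        unfolding c_def by (rule nn_integral_sum, rule fm, simp only: lessThan_iff)
      finally show ?thesis .
    qed
    also have "(\<integral>\<^sup>+s. ennreal (2 * \<epsilon>\<^sup>2) * indicator {0<..t} s \<partial>lborel) = ennreal (2 * \<epsilon>\<^sup>2 * t)"
      using t by (simp add: nn_integral_cmult ennreal_mult)
    finally show ?thesis by (simp add: mult_left_mono)
  qed
  have Zm: "Z \<in> borel_measurable P" using Z_lim by (simp add: msq_tendsto_def)
  have Ln_lim: "(\<lambda>n. mean_sq P (\<lambda>\<omega>. elementary_integral w (Ln n) \<omega> - Z \<omega>)) \<longlonglongrightarrow> 0"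
    using Z_lim by (simp add: msq_tendsto_def Ln_def elementary_integral_map)
  have "(\<lambda>n. 2 * mean_sq P (\<lambda>\<omega>. elementary_integral w (Ln n) \<omega> - Z \<omega>) + 2 * (ennreal \<kappa> * (2 * (\<Sum>i<m n. c n i) + ennreal (2 * \<epsilon>\<^sup>2 * t))))
      \<longlonglongrightarrow> 2 * 0 + 2 * (ennreal \<kappa> * (2 * 0 + ennreal (2 * \<epsilon>\<^sup>2 * t)))"
    using F_lim by (intro tendsto_add ennreal_tendsto_cmult Ln_lim tendsto_const) (auto simp: c_def)
  moreover have "mean_sq P (\<lambda>\<omega>. Z \<omega> - elementary_integral w L \<omega>)
      \<le> 2 * mean_sq P (\<lambda>\<omega>. elementary_integral w (Ln n) \<omega> - Z \<omega>) + 2 * (ennreal \<kappa> * (2 * (\<Sum>i<m n. c n i) + ennreal (2 * \<epsilon>\<^sup>2 * t)))" for n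
    using mean_sq_triangle[OF Zm Em[OF LnT, of n] Em[OF LT]]
      mult_left_mono[OF diff_le[of n], of 2]
    by (simp add: mean_sq_commute[of P Z]) (meson add_left_mono order_trans)
  ultimately have "mean_sq P (\<lambda>\<omega>. Z \<omega> - elementary_integral w L \<omega>) \<le> 2 * (ennreal \<kappa> * ennreal (2 * \<epsilon>\<^sup>2 * t))"
    by (intro LIMSEQ_le_const) auto
  also have "\<dots> = ennreal (4 * \<kappa> * \<epsilon>\<^sup>2 * t)"
    using \<kappa> t by (simp add: ennreal_mult[symmetric] mult_ac flip: ennreal_numeral)
  also have "\<dots> \<le> ennreal (4 * \<kappa> * \<epsilon>\<^sup>2 * T)"
    using \<kappa> t by (intro ennreal_leI mult_left_mono) auto
  finally show ?thesis .
qed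

lemma has_wiener_integral_measurable: "has_wiener_integral P w a b F Z \<Longrightarrow> Z \<in> borel_measurable P"
  by (auto simp: has_wiener_integral_def msq_tendsto_def)

lemma wiener_bound_mono:
  assumes "wiener_bound P T \<kappa> w" "\<kappa> \<le> \<kappa>'" shows "wiener_bound P T \<kappa>' w"
  using assms unfolding wiener_bound_def
  by (auto intro: order_trans[OF _ mult_right_mono[OF ennreal_leI]])

lemma wiener_bound_measurable: "wiener_bound P T \<kappa> w \<Longrightarrow> t \<in> {0..T} \<Longrightarrow> w t \<in> borel_measurable P"
  by (simp add: wiener_bound_def)

lemma (in prob_space) expected_norm_step_approximation:
  assumes w: "wiener_bound M T \<kappa> w" and t: "0 \<le> t" "t \<le> T"
    and Z: "has_wiener_integral M w 0 t F Z" and F: "continuous_on {0..t} F"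
    and L: "intervals_in t L" and close: "\<And>s. s \<in> {0<..t} \<Longrightarrow> norm (F s - step_integrand L s) \<le> \<epsilon>"
    and \<epsilon>: "0 \<le> \<epsilon>"
  shows "(\<integral>\<^sup>+\<omega>. ennreal (norm (Z \<omega> - elementary_integral w L \<omega>)) \<partial>M) \<le> ennreal (2 * \<epsilon> * sqrt (\<kappa> * T))"
proof (rule nn_integral_norm_le_mean_sq)
  have \<kappa>: "0 \<le> \<kappa>" using w by (simp add: wiener_bound_def)
  show "(\<lambda>\<omega>. Z \<omega> - elementary_integral w L \<omega>) \<in> borel_measurable M"
    by (intro borel_measurable_diff has_wiener_integral_measurable[OF Z]
        elementary_integral_measurable[OF wiener_bound_measurable[OF w] intervals_in_mono[OF L t(2)]])
  have "4 * \<kappa> * \<epsilon>\<^sup>2 * T = (2 * \<epsilon> * sqrt (\<kappa> * T))\<^sup>2"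
    using \<kappa> t by (simp add: power_mult_distrib)
  then show "mean_sq M (\<lambda>\<omega>. Z \<omega> - elementary_integral w L \<omega>) \<le> ennreal ((2 * \<epsilon> * sqrt (\<kappa> * T))\<^sup>2)"
    using wiener_integral_step_approximation[OF w t Z F L close \<epsilon>] by simp
  show "0 \<le> 2 * \<epsilon> * sqrt (\<kappa> * T)" using \<epsilon> \<kappa> t by simp
qed

lemma (in prob_space) expected_norm_wiener_integral_le:
  assumes w: "wiener_bound M T \<kappa> w" and t: "t \<in> {0..T}" and Z: "has_wiener_integral M w 0 t (Phi A t) Z"
  shows "(\<integral>\<^sup>+\<omega>. ennreal (norm (Z \<omega>)) \<partial>M) \<le> ennreal (2 * exp (T * norm A) * sqrt (\<kappa> * T))"
  using expected_norm_step_approximation[OF w _ _ Z continuous_on_Phi, of "[]" "exp (T * norm A)"]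
    norm_Phi_le[of A "norm A" _ t T] t
  by (simp add: intervals_in_def step_integrand_def elementary_integral_def)

text \<open>
  Both integrals are compared with elementary integrals of the limit propagator on the grid of
  \<open>m\<close> equal cells in \<open>{0..t}\<close>. The Lipschitz bound in time makes one \<open>m\<close> suffice for all \<open>t\<close>; for this \<open>m\<close>
  the difference of the two elementary integrals, one for each noise, is a sum of \<open>2 m\<close> values of the noise
  difference with bounded operator coefficients.
\<close>
lemma wiener_integral_convergence:
  fixes P :: "'w measure"
  assumes P: "prob_space P" and T: "T > 0"
    and wN: "\<forall>\<^sub>F N in sequentially. wiener_bound P T \<kappa> (wN N)" and w: "wiener_bound P T \<kappa> w"
    and A: "AN \<longlonglongrightarrow> A"
    and D: "\<And>\<epsilon>. \<epsilon> > 0 \<Longrightarrow> \<forall>\<^sub>F N in sequentially. \<forall>t\<in>{0..T}. mean_sq P (\<lambda>\<omega>. wN N t \<omega> - w t \<omega>) \<le> ennreal \<epsilon>"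
    and \<epsilon>: "\<epsilon> > 0"
  shows "\<forall>\<^sub>F N in sequentially. \<forall>t\<in>{0..T}. \<forall>ZN Z. has_wiener_integral P (wN N) 0 t (Phi (AN N) t) ZN \<longrightarrow>
    has_wiener_integral P w 0 t (Phi A t) Z \<longrightarrow> (\<integral>\<^sup>+\<omega>. ennreal (norm (ZN \<omega> - Z \<omega>)) \<partial>P) \<le> ennreal \<epsilon>"
proof -
  interpret prob_space P by (rule P)
  have \<kappa>: "0 \<le> \<kappa>" using w by (simp add: wiener_bound_def)
  define c where "c = norm A + 1"
  define C where "C = exp (T * c)"
  \<comment> \<open>Admissible error of the integrands: it costs at most \<open>\<epsilon> / 4\<close> in each of the two comparisons.\<close>
  define \<delta> where "\<delta> = \<epsilon> / (8 * (sqrt (\<kappa> * T) + 1))"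
  have c: "c > 0" by (simp add: c_def add_nonneg_pos)
  have C: "C > 0" by (simp add: C_def)
  have sq: "0 \<le> sqrt (\<kappa> * T)" using \<kappa> T by simp
  then have \<delta>: "\<delta> > 0" using \<epsilon> by (simp add: \<delta>_def add_nonneg_pos)
  have "2 * \<delta> * sqrt (\<kappa> * T) = \<epsilon> / 4 * (sqrt (\<kappa> * T) / (sqrt (\<kappa> * T) + 1))"
  proof -
    have "2 * (\<epsilon> / (8 * y)) * x = \<epsilon> / 4 * (x / y)" for x y :: real by simp
    then show ?thesis unfolding \<delta>_def .
  qed
  also have "\<dots> \<le> \<epsilon> / 4 * 1"
  proof (rule mult_left_mono)
    show "sqrt (\<kappa> * T) / (sqrt (\<kappa> * T) + 1) \<le> 1" using sq by (subst divide_le_eq_1_pos) (auto simp: add_nonneg_pos)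
  qed (use \<epsilon> in simp)
  finally have \<delta>\<epsilon>: "2 * \<delta> * sqrt (\<kappa> * T) \<le> \<epsilon> / 4" by simp
  obtain m :: nat where m: "2 * C * c * T / \<delta> \<le> real m" "m > 0"
    using real_arch_simple[of "max 1 (2 * C * c * T / \<delta>)"] by (auto simp: max_def split: if_splits)
  have mesh: "C * c * (T / m) \<le> \<delta> / 2"
    using m \<delta> by (simp add: field_simps)
  \<comment> \<open>Admissible error of the noise at a single time: \<open>2 m\<close> of them, amplified by \<open>C\<close>, add up to \<open>\<epsilon> / 2\<close>.\<close>
  define \<theta> where "\<theta> = \<epsilon> / (4 * m * C)"
  have \<theta>: "\<theta> > 0" using \<epsilon> m C by (simp add: \<theta>_def)
  have "(\<lambda>N. C * (T * norm (AN N - A))) \<longlonglongrightarrow> C * (T * norm (A - A))"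
    by (intro tendsto_intros A)
  then have "(\<lambda>N. C * (T * norm (AN N - A))) \<longlonglongrightarrow> 0" by simp
  then have "\<forall>\<^sub>F N in sequentially. C * (T * norm (AN N - A)) < \<delta> / 2"
    by (rule order_tendstoD) (use \<delta> in simp)
  moreover have "\<forall>\<^sub>F N in sequentially. norm (AN N) \<le> c"
    unfolding c_def by (rule eventually_norm_le_plus_1[OF A])
  moreover have "\<forall>\<^sub>F N in sequentially. \<forall>t\<in>{0..T}. mean_sq P (\<lambda>\<omega>. wN N t \<omega> - w t \<omega>) \<le> ennreal (\<theta>\<^sup>2)"
    using \<theta> by (intro D) simp
  ultimately show ?thesis using wN
  proof eventually_elim
    case (elim N)
    show ?case
    proof (intro ballI allI impI)
      fix t ZN Z assume t: "t \<in> {0..T}"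
        and ZN: "has_wiener_integral P (wN N) 0 t (Phi (AN N) t) ZN"
        and Z: "has_wiener_integral P w 0 t (Phi A t) Z"
      define \<tau> where "\<tau> i = t * real i / real m" for i
      define L where "L = map (\<lambda>i. (\<tau> i, \<tau> (Suc i), Phi A t (\<tau> (Suc i)))) [0..<m]"
      have \<tau>: "\<tau> 0 = 0" "\<tau> m = t" using m by (auto simp: \<tau>_def)
      have \<tau>_le: "\<tau> i \<le> \<tau> j" if "i \<le> j" for i j
        unfolding \<tau>_def using that t by (intro divide_right_mono mult_left_mono) auto
      have \<tau>_in: "\<tau> i \<in> {0..t}" if "i \<le> m" for i
        using \<tau>_le[of 0 i] \<tau>_le[OF that] \<tau> by simp
      have L: "intervals_in t L"
        using \<tau>_in \<tau>_le by (auto simp: intervals_in_def L_def)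
      have Acl: "norm (Phi A t s - step_integrand L s) \<le> \<delta> / 2" if s: "s \<in> {0<..t}" for s
      proof -
        obtain i where i: "i < m" "s \<in> {\<tau> i<..\<tau> (Suc i)}" "step_integrand L s = Phi A t (\<tau> (Suc i))"
          using step_integrand_partition[of m \<tau> s "\<lambda>i. Phi A t (\<tau> (Suc i))"] \<tau>_le \<tau> s
          unfolding L_def by auto
        have "norm (Phi A t s - Phi A t (\<tau> (Suc i))) \<le> C * c * \<bar>s - \<tau> (Suc i)\<bar>"
          unfolding C_def using i \<tau>_in[of "Suc i"] s t
          by (intro norm_Phi_lipschitz) (auto simp: c_def)
        also have "\<bar>s - \<tau> (Suc i)\<bar> \<le> \<tau> (Suc i) - \<tau> i" using i by auto
        also have "\<dots> \<le> T / m"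
          using t m by (simp add: \<tau>_def diff_divide_distrib[symmetric] algebra_simps divide_right_mono)
        finally have "norm (Phi A t s - Phi A t (\<tau> (Suc i))) \<le> C * c * (T / m)"
          using C c by (simp add: mult_left_mono)
        from order_trans[OF this mesh] show ?thesis by (simp only: i(3))
      qed
      have ANcl: "norm (Phi (AN N) t s - step_integrand L s) \<le> \<delta>" if s: "s \<in> {0<..t}" for s
      proof -
        have "norm (Phi (AN N) t s - Phi A t s) \<le> C * (T * norm (AN N - A))"
          unfolding C_def using elim s t by (intro norm_Phi_diff_le) (auto simp: c_def)
        then show ?thesis
          using Acl[OF s] elim(1) norm_triangle_ineq[of "Phi (AN N) t s - Phi A t s" "Phi A t s - step_integrand L s"]
          by simp
      qed
      have tT: "0 \<le> t" "t \<le> T" using t by auto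
      let ?E = "\<lambda>X. \<integral>\<^sup>+\<omega>. ennreal (norm (X \<omega> :: L2I)) \<partial>P"
      let ?eN = "elementary_integral (wN N) L" and ?e = "elementary_integral w L"
      note wm = wiener_bound_measurable[OF w] and wNm = wiener_bound_measurable[OF elim(4)]
      note LT = intervals_in_mono[OF L tT(2)]
      note [measurable] = has_wiener_integral_measurable[OF Z] has_wiener_integral_measurable[OF ZN]
        elementary_integral_measurable[OF wm LT] elementary_integral_measurable[OF wNm LT]
      have 1: "?E (\<lambda>\<omega>. ZN \<omega> - ?eN \<omega>) \<le> ennreal (\<epsilon> / 4)"
        by (rule order_trans[OF expected_norm_step_approximation[OF elim(4) tT ZN continuous_on_Phi L ANcl]])
          (use \<delta> \<delta>\<epsilon> in \<open>auto intro: ennreal_leI\<close>)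
      have 3: "?E (\<lambda>\<omega>. Z \<omega> - ?e \<omega>) \<le> ennreal (\<epsilon> / 4)"
        by (rule order_trans[OF expected_norm_step_approximation[OF w tT Z continuous_on_Phi L, of \<delta>]])
          (use \<delta> \<delta>\<epsilon> Acl in \<open>auto intro: ennreal_leI order_trans[OF Acl]\<close>)
      have Dm: "(\<lambda>\<omega>. wN N s \<omega> - w s \<omega>) \<in> borel_measurable P" if "s \<in> {0..T}" for s
        using wm[OF that] wNm[OF that] by simp
      have D1: "?E (\<lambda>\<omega>. wN N s \<omega> - w s \<omega>) \<le> ennreal \<theta>" if "s \<in> {0..T}" for s
        using elim(3) that \<theta> by (intro nn_integral_norm_le_mean_sq Dm) auto
      have "?E (\<lambda>\<omega>. ?eN \<omega> - ?e \<omega>) \<le> (\<integral>\<^sup>+\<omega>. (\<Sum>i<m. ennreal C *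
          (ennreal (norm (wN N (\<tau> (Suc i)) \<omega> - w (\<tau> (Suc i)) \<omega>)) + ennreal (norm (wN N (\<tau> i) \<omega> - w (\<tau> i) \<omega>)))) \<partial>P)"
      proof (rule nn_integral_mono)
        fix \<omega>
        let ?d = "\<lambda>i. wN N (\<tau> i) \<omega> - w (\<tau> i) \<omega>"
        have "?eN \<omega> - ?e \<omega> = (\<Sum>i<m. Phi A t (\<tau> (Suc i)) (?d (Suc i) - ?d i))"
          unfolding L_def elementary_integral_map
          by (simp add: sum_subtractf[symmetric] blinfun.diff_right[symmetric] algebra_simps)
        also have "norm \<dots> \<le> (\<Sum>i<m. C * (norm (?d (Suc i)) + norm (?d i)))"
        proof (rule sum_norm_le)
          fix i assume "i \<in> {..<m}"
          then have "norm (Phi A t (\<tau> (Suc i))) \<le> C"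
            unfolding C_def using \<tau>_in[of "Suc i"] tT by (intro norm_Phi_le) (auto simp: c_def)
          then show "norm (Phi A t (\<tau> (Suc i)) (?d (Suc i) - ?d i)) \<le> C * (norm (?d (Suc i)) + norm (?d i))"
            using C by (intro order_trans[OF norm_blinfun] mult_mono norm_triangle_ineq4) auto
        qed
        finally have "ennreal (norm (?eN \<omega> - ?e \<omega>)) \<le> ennreal (\<Sum>i<m. C * (norm (?d (Suc i)) + norm (?d i)))"
          by (rule ennreal_leI)
        also have "\<dots> = (\<Sum>i<m. ennreal C * (ennreal (norm (?d (Suc i))) + ennreal (norm (?d i))))"
          using C by (simp add: sum_ennreal[symmetric] ennreal_mult)
        finally show "ennreal (norm (?eN \<omega> - ?e \<omega>)) \<le> \<dots>" .
      qed
      also have "\<dots> = (\<Sum>i<m. ennreal C * (?E (\<lambda>\<omega>. wN N (\<tau> (Suc i)) \<omega> - w (\<tau> (Suc i)) \<omega>) + ?E (\<lambda>\<omega>. wN N (\<tau> i) \<omega> - w (\<tau> i) \<omega>)))"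
      proof -
        define n where "n i \<omega> = ennreal (norm (wN N (\<tau> i) \<omega> - w (\<tau> i) \<omega>))" for i \<omega>
        have n: "n i \<in> borel_measurable P" if "i \<le> m" for i
        proof -
          have [measurable]: "(\<lambda>\<omega>. wN N (\<tau> i) \<omega> - w (\<tau> i) \<omega>) \<in> borel_measurable P"
            using \<tau>_in[OF that] tT by (intro Dm) auto
          show ?thesis unfolding n_def[abs_def] by measurable
        qed
        have "(\<integral>\<^sup>+\<omega>. (\<Sum>i<m. ennreal C * (n (Suc i) \<omega> + n i \<omega>)) \<partial>P)
            = (\<Sum>i<m. \<integral>\<^sup>+\<omega>. ennreal C * (n (Suc i) \<omega> + n i \<omega>) \<partial>P)"
          using n by (intro nn_integral_sum) auto
        also have "\<dots> = (\<Sum>i<m. ennreal C * (integral\<^sup>N P (n (Suc i)) + integral\<^sup>N P (n i)))"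
          using n by (intro sum.cong) (simp_all add: nn_integral_cmult nn_integral_add)
        finally show ?thesis by (simp only: n_def[abs_def])
      qed
      also have "\<dots> \<le> (\<Sum>i<m. ennreal C * (ennreal \<theta> + ennreal \<theta>))"
      proof (intro sum_mono mult_left_mono add_mono D1)
        fix i assume "i \<in> {..<m}"
        then show "\<tau> (Suc i) \<in> {0..T}" "\<tau> i \<in> {0..T}" using \<tau>_in[of i] \<tau>_in[of "Suc i"] tT by auto
      qed simp
      also have "\<dots> = ennreal (\<epsilon> / 2)"
      proof -
        have "ennreal (\<theta> + \<theta>) = ennreal \<theta> + ennreal \<theta>"
          by (rule ennreal_plus) (use \<theta> in auto)
        moreover have "ennreal (C * (\<theta> + \<theta>)) = ennreal C * ennreal (\<theta> + \<theta>)"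
          by (rule ennreal_mult) (use C \<theta> in auto)
        ultimately have "(\<Sum>i<m. ennreal C * (ennreal \<theta> + ennreal \<theta>)) = (\<Sum>i<m. ennreal (C * (\<theta> + \<theta>)))"
          by (simp only:)
        also have "\<dots> = ennreal (\<Sum>i<m. C * (\<theta> + \<theta>))"
          using C \<theta> by (intro sum_ennreal) auto
        also have "(\<Sum>i<m. C * (\<theta> + \<theta>)) = \<epsilon> / 2"
          using C m by (simp add: \<theta>_def field_simps)
        finally show ?thesis .
      qed
      finally have 2: "?E (\<lambda>\<omega>. ?eN \<omega> - ?e \<omega>) \<le> ennreal (\<epsilon> / 2)" .
      have "?E (\<lambda>\<omega>. ZN \<omega> - Z \<omega>) \<le> (\<integral>\<^sup>+\<omega>. ennreal (norm (ZN \<omega> - ?eN \<omega>)) + ennreal (norm (?eN \<omega> - ?e \<omega>)) + ennreal (norm (Z \<omega> - ?e \<omega>)) \<partial>P)"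
      proof (rule nn_integral_mono)
        fix \<omega>
        have "norm (ZN \<omega> - Z \<omega>) \<le> norm (ZN \<omega> - ?eN \<omega>) + norm (?eN \<omega> - ?e \<omega>) + norm (Z \<omega> - ?e \<omega>)"
          using norm_triangle_ineq[of "ZN \<omega> - ?eN \<omega>" "?eN \<omega> - ?e \<omega>"]
            norm_triangle_ineq4[of "ZN \<omega> - ?e \<omega>" "Z \<omega> - ?e \<omega>"] by simp
        then show "ennreal (norm (ZN \<omega> - Z \<omega>)) \<le> ennreal (norm (ZN \<omega> - ?eN \<omega>)) + ennreal (norm (?eN \<omega> - ?e \<omega>)) + ennreal (norm (Z \<omega> - ?e \<omega>))"
          by (simp flip: ennreal_plus add: ennreal_leI)
      qed
      also have "\<dots> = ?E (\<lambda>\<omega>. ZN \<omega> - ?eN \<omega>) + ?E (\<lambda>\<omega>. ?eN \<omega> - ?e \<omega>) + ?E (\<lambda>\<omega>. Z \<omega> - ?e \<omega>)"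
        by (simp add: nn_integral_add)
      also have "\<dots> \<le> ennreal (\<epsilon> / 4) + ennreal (\<epsilon> / 2) + ennreal (\<epsilon> / 4)"
        by (intro add_mono 1 2 3)
      also have "\<dots> = ennreal \<epsilon>" using \<epsilon> by (simp flip: ennreal_plus)
      finally show "?E (\<lambda>\<omega>. ZN \<omega> - Z \<omega>) \<le> ennreal \<epsilon>" .
    qed
  qed
qed

section \<open>The noise of the step systems\<close>

text \<open>
  The value at a positive time is almost surely a Gaussian increment, since the motion starts
  at 0.
\<close>
lemma brownian_motion_square_integrable:
  assumes P: "prob_space P" and W: "brownian_motion P W" and t: "0 \<le> t"
  shows "W t \<in> borel_measurable P" "integrable P (\<lambda>\<omega>. (W t \<omega>)\<^sup>2)"
proof -
  have m[measurable]: "W t \<in> borel_measurable P" if "0 \<le> t" for t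
    using W that by (simp add: brownian_motion_def)
  show "W t \<in> borel_measurable P" using t by (rule m)
  have W0: "AE \<omega> in P. W 0 \<omega> = 0" using W by (simp add: brownian_motion_def)
  show "integrable P (\<lambda>\<omega>. (W t \<omega>)\<^sup>2)"
  proof (cases "t = 0")
    case True
    have "integrable P (\<lambda>\<omega>. (W t \<omega>)\<^sup>2) \<longleftrightarrow> integrable P (\<lambda>\<omega>. 0 :: real)"
      by (rule integrable_cong_AE) (use W0 m[OF t] True in auto)
    then show ?thesis by simp
  next
    case False
    have "\<forall>s t. 0 \<le> s \<and> s < t \<longrightarrow>
        distributed P lborel (\<lambda>\<omega>. W t \<omega> - W s \<omega>) (normal_density 0 (sqrt (t - s)))"
      using W unfolding brownian_motion_def by blast
    from this[rule_format, of 0 t]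
    have "distributed P lborel (\<lambda>\<omega>. W t \<omega> - W 0 \<omega>) (normal_density 0 (sqrt (t - 0)))"
      using t False by simp
    from distributed_integrable[OF this, of "\<lambda>x. x\<^sup>2"]
    have "integrable lborel (\<lambda>x. normal_density 0 (sqrt (t - 0)) x * x\<^sup>2)
        \<longleftrightarrow> integrable P (\<lambda>\<omega>. (W t \<omega> - W 0 \<omega>)\<^sup>2)" by simp
    moreover have "integrable lborel (\<lambda>x. normal_density 0 (sqrt (t - 0)) x * x\<^sup>2)"
      using integrable_normal_moment[of "sqrt (t - 0)" 0 2] t False by simp
    ultimately have "integrable P (\<lambda>\<omega>. (W t \<omega> - W 0 \<omega>)\<^sup>2)" by blast
    moreover have "integrable P (\<lambda>\<omega>. (W t \<omega> - W 0 \<omega>)\<^sup>2) \<longleftrightarrow> integrable P (\<lambda>\<omega>. (W t \<omega>)\<^sup>2)"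
      by (rule integrable_cong_AE) (use W0 m[OF t] m[of 0] in auto)
    ultimately show ?thesis by simp
  qed
qed

lemma msq_tendsto_square_integrable:
  fixes X :: "nat \<Rightarrow> 'w \<Rightarrow> real"
  assumes lim: "msq_tendsto P X Y" and X: "\<And>n. X n \<in> borel_measurable P" "\<And>n. integrable P (\<lambda>\<omega>. (X n \<omega>)\<^sup>2)"
  shows "Y \<in> borel_measurable P" "integrable P (\<lambda>\<omega>. (Y \<omega>)\<^sup>2)"
proof -
  show Y[measurable]: "Y \<in> borel_measurable P" using lim by (simp add: msq_tendsto_def)
  have "(\<lambda>n. mean_sq P (\<lambda>\<omega>. X n \<omega> - Y \<omega>)) \<longlonglongrightarrow> 0" using lim by (simp add: msq_tendsto_def)
  then have "\<forall>\<^sub>F n in sequentially. mean_sq P (\<lambda>\<omega>. X n \<omega> - Y \<omega>) < 1" by (rule order_tendstoD) simp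
  then obtain n where n: "mean_sq P (\<lambda>\<omega>. X n \<omega> - Y \<omega>) < 1" by (auto simp: eventually_sequentially)
  have "mean_sq P (\<lambda>\<omega>. Y \<omega> - 0) \<le> 2 * mean_sq P (\<lambda>\<omega>. Y \<omega> - X n \<omega>) + 2 * mean_sq P (\<lambda>\<omega>. X n \<omega> - 0)"
    by (intro mean_sq_triangle Y X) simp
  also have "\<dots> < \<infinity>"
    using n mean_sq_eq_integral[of P "X n"] X(2)[of n]
    by (auto simp: mean_sq_commute[of P Y] ennreal_mult_less_top intro: less_trans)
  finally have "(\<integral>\<^sup>+\<omega>. ennreal (norm ((Y \<omega>)\<^sup>2)) \<partial>P) < \<infinity>" by (simp add: mean_sq_def)
  then show "integrable P (\<lambda>\<omega>. (Y \<omega>)\<^sup>2)" by (intro integrableI_bounded) auto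
qed

lemma brownian_series_square_integrable:
  fixes W :: "nat \<Rightarrow> real \<Rightarrow> 'w \<Rightarrow> real"
  assumes P: "prob_space P" and W: "\<And>r. r \<in> {1..} \<Longrightarrow> brownian_motion P (W r)" and t: "0 \<le> t"
    and lim: "msq_tendsto P (\<lambda>n \<omega>. \<Sum>r=1..n. c r * W r t \<omega>) Y"
  shows "Y \<in> borel_measurable P" "integrable P (\<lambda>\<omega>. (Y \<omega>)\<^sup>2)"
proof -
  have Wt: "W r t \<in> borel_measurable P" "integrable P (\<lambda>\<omega>. (W r t \<omega>)\<^sup>2)" if "r \<in> {1..n}" for r n
    using brownian_motion_square_integrable[OF P W t, of r] that by auto
  have m: "(\<lambda>\<omega>. \<Sum>r=1..n. c r * W r t \<omega>) \<in> borel_measurable P" for n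
    by (intro borel_measurable_sum borel_measurable_times Wt) auto
  have "integrable P (\<lambda>\<omega>. (norm (\<Sum>r=1..n. W r t \<omega> *\<^sub>R c r))\<^sup>2)" for n
    by (rule integral_norm_square_sum) (use Wt in auto)
  then have i: "integrable P (\<lambda>\<omega>. (\<Sum>r=1..n. c r * W r t \<omega>)\<^sup>2)" for n by (simp add: mult.commute)
  from msq_tendsto_square_integrable[OF lim m i]
  show "Y \<in> borel_measurable P" "integrable P (\<lambda>\<omega>. (Y \<omega>)\<^sup>2)" by auto
qed

lemma abs_L2I_sum:
  assumes "finite K" "\<And>k. k \<in> K \<Longrightarrow> sq_int (f k)"
  shows "sq_int (\<lambda>x. \<Sum>k\<in>K. f k x) \<and> abs_L2I (\<lambda>x. \<Sum>k\<in>K. f k x) = (\<Sum>k\<in>K. abs_L2I (f k))"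
  using assms
proof (induction K rule: finite_induct)
  case empty
  then show ?case by (simp add: sq_int_zero zero_L2I_def)
next
  case (insert k K)
  then show ?case by (auto intro: sq_int_add simp: abs_L2I_add[symmetric])
qed

lemma abs_noise_field:
  "abs_L2I (noise_field N \<xi> t \<omega>) = (\<Sum>k\<in>{1..N}. \<xi> k t \<omega> *\<^sub>R abs_L2I (indicator (cell N k)))"
proof -
  have cell: "sq_int (indicator (cell N k))" for k
    by (rule sq_int_indicator) (simp add: cell_def)
  have "noise_field N \<xi> t \<omega> = (\<lambda>x. \<Sum>k\<in>{1..N}. \<xi> k t \<omega> * indicator (cell N k) x)"
    by (simp add: noise_field_def fun_eq_iff mult.commute)
  then show ?thesis
    using abs_L2I_sum[of "{1..N}" "\<lambda>k x. \<xi> k t \<omega> * indicator (cell N k) x"] cell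
    by (simp add: sq_int_scale abs_L2I_scaleR)
qed

text \<open>
  The right end point \<open>k / N\<close> belongs to the \<open>k\<close>-th cell. Evaluating the covariance of the noise field at
  these nodes recovers the covariances of the coefficients.
\<close>
lemma noise_field_at_node:
  assumes "k \<in> {1..N}" shows "noise_field N \<xi> t \<omega> (real k / real N) = \<xi> k t \<omega>"
proof -
  have "real k / real N \<in> cell N j \<longleftrightarrow> j = k" if "j \<in> {1..N}" for j
    using assms that by (auto simp: cell_def divide_le_cancel divide_less_cancel)
  then have "noise_field N \<xi> t \<omega> (real k / real N) = (\<Sum>j=1..N. if j = k then \<xi> j t \<omega> else 0)"
    unfolding noise_field_def by (intro sum.cong) (auto simp: indicator_def)
  then show ?thesis using assms by simp
qed

lemma mean_sq_increment_finite:
  fixes X Y :: "'w \<Rightarrow> L2I"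
  assumes "\<And>k. k \<in> K \<Longrightarrow> f k \<in> borel_measurable P \<and> integrable P (\<lambda>\<omega>. (f k \<omega>)\<^sup>2)"
    and "\<And>\<omega>. X \<omega> = (\<Sum>k\<in>K. f k \<omega> *\<^sub>R e k)"
  shows "mean_sq P X < \<infinity>"
proof -
  have "integrable P (\<lambda>\<omega>. (norm (X \<omega>))\<^sup>2)"
    unfolding assms(2) by (rule integral_norm_square_sum) (use assms(1) in auto)
  then show ?thesis by (simp add: mean_sq_eq_integral)
qed

text \<open>
  The Cauchy property is uniform in time, and it survives letting the larger index tend to infinity.
  The limit noise is only known to exist at each time separately.
\<close>
lemma noise_uniformly_close:
  fixes wN :: "nat \<Rightarrow> real \<Rightarrow> 'w \<Rightarrow> L2I"
  assumes Cauchy: "\<And>\<epsilon>. \<epsilon> > 0 \<Longrightarrow> \<exists>N0. \<forall>N M. N > M \<and> M > N0 \<longrightarrow>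
      (\<forall>t\<in>{0..T}. mean_sq P (\<lambda>\<omega>. wN N t \<omega> - wN M t \<omega>) < ennreal \<epsilon>)"
    and m: "\<And>N t. N \<ge> 1 \<Longrightarrow> t \<in> {0..T} \<Longrightarrow> wN N t \<in> borel_measurable P"
    and lim: "\<And>t. t \<in> {0..T} \<Longrightarrow> msq_tendsto P (\<lambda>N. wN N t) (w t)" and \<epsilon>: "\<epsilon> > 0"
  shows "\<forall>\<^sub>F N in sequentially. \<forall>t\<in>{0..T}. mean_sq P (\<lambda>\<omega>. wN N t \<omega> - w t \<omega>) \<le> ennreal \<epsilon>"
proof -
  obtain N0 where N0: "\<And>N M t. N > M \<Longrightarrow> M > N0 \<Longrightarrow> t \<in> {0..T} \<Longrightarrow>
      mean_sq P (\<lambda>\<omega>. wN N t \<omega> - wN M t \<omega>) < ennreal (\<epsilon> / 2)"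
    using Cauchy[OF half_gt_zero[OF \<epsilon>]] by blast
  have close: "mean_sq P (\<lambda>\<omega>. wN M t \<omega> - w t \<omega>) \<le> ennreal \<epsilon>" if M: "M > N0" and t: "t \<in> {0..T}" for M t
  proof -
    have "mean_sq P (\<lambda>\<omega>. w t \<omega> - wN M t \<omega>) \<le> 2 * ennreal (\<epsilon> / 2)"
    proof (rule mean_sq_limit_le[of "\<lambda>N. wN (N + 1) t"])
      show "(\<lambda>N. mean_sq P (\<lambda>\<omega>. wN (N + 1) t \<omega> - w t \<omega>)) \<longlonglongrightarrow> 0"
        using lim[OF t] LIMSEQ_ignore_initial_segment[of "\<lambda>N. mean_sq P (\<lambda>\<omega>. wN N t \<omega> - w t \<omega>)" 0 1]
        by (simp add: msq_tendsto_def)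
      show "\<forall>\<^sub>F N in sequentially. mean_sq P (\<lambda>\<omega>. wN (N + 1) t \<omega> - wN M t \<omega>) \<le> ennreal (\<epsilon> / 2)"
        using eventually_ge_at_top[of M] by eventually_elim (use N0[OF _ M t] in \<open>auto intro: less_imp_le\<close>)
    qed (use m t M lim[OF t] in \<open>auto simp: msq_tendsto_def\<close>)
    also have "2 * ennreal (\<epsilon> / 2) = ennreal \<epsilon>"
      using ennreal_mult[of 2 "\<epsilon> / 2"] \<epsilon> by simp
    finally show ?thesis by (simp add: mean_sq_commute)
  qed
  show ?thesis
    using eventually_gt_at_top[of N0] by eventually_elim (blast intro: close)
qed

text \<open>
  The Brownian series make the coefficients \<open>\<xi>\<close> square integrable; their second moments are prescribed by
  the covariance.
\<close>
locale step_noise = prob_space P for P :: "'w measure" +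
  fixes T :: real and W :: "nat \<Rightarrow> real \<Rightarrow> 'w \<Rightarrow> real" and c :: "nat \<Rightarrow> nat \<Rightarrow> nat \<Rightarrow> real"
    and \<xi> :: "nat \<Rightarrow> nat \<Rightarrow> real \<Rightarrow> 'w \<Rightarrow> real" and QN :: "nat \<Rightarrow> real \<Rightarrow> real \<Rightarrow> real"
    and wN :: "nat \<Rightarrow> real \<Rightarrow> 'w \<Rightarrow> L2I" and w :: "real \<Rightarrow> 'w \<Rightarrow> L2I"
  assumes T: "T > 0"
    and W: "\<And>r. r \<in> {1..} \<Longrightarrow> brownian_motion P (W r)"
    and series: "\<And>N k t. N \<ge> 1 \<Longrightarrow> k \<in> {1..N} \<Longrightarrow> t \<in> {0..T} \<Longrightarrow>
      msq_tendsto P (\<lambda>n \<omega>. \<Sum>r=1..n. c N k r * W r t \<omega>) (\<xi> N k t)"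
    and wN: "\<And>N t \<omega>. N \<ge> 1 \<Longrightarrow> t \<in> {0..T} \<Longrightarrow> wN N t \<omega> = abs_L2I (noise_field N (\<xi> N) t \<omega>)"
    and covariance: "\<And>N t s \<alpha> \<beta>. N \<ge> 1 \<Longrightarrow> t \<in> {0..T} \<Longrightarrow> s \<in> {0..T} \<Longrightarrow> \<alpha> \<in> {0..1} \<Longrightarrow> \<beta> \<in> {0..1} \<Longrightarrow>
      (\<integral>\<omega>. noise_field N (\<xi> N) t \<omega> \<alpha> * noise_field N (\<xi> N) s \<omega> \<beta> \<partial>P) = min t s * QN N \<alpha> \<beta>"
    and w: "\<And>t. t \<in> {0..T} \<Longrightarrow> msq_tendsto P (\<lambda>N. wN N t) (w t)"
    and Cauchy: "\<And>\<epsilon>. \<epsilon> > 0 \<Longrightarrow> \<exists>N0. \<forall>N M. N > M \<and> M > N0 \<longrightarrow>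
      (\<forall>t\<in>{0..T}. mean_sq P (\<lambda>\<omega>. wN N t \<omega> - wN M t \<omega>) < ennreal \<epsilon>)"
begin

lemma \<xi>_square_integrable:
  assumes "N \<ge> 1" "k \<in> {1..N}" "t \<in> {0..T}"
  shows "\<xi> N k t \<in> borel_measurable P" "integrable P (\<lambda>\<omega>. (\<xi> N k t \<omega>)\<^sup>2)"
  using brownian_series_square_integrable[OF prob_space_axioms W _ series[OF assms]] assms by auto

lemma wN_finite_rank:
  "N \<ge> 1 \<Longrightarrow> t \<in> {0..T} \<Longrightarrow> wN N t \<omega> = (\<Sum>k\<in>{1..N}. \<xi> N k t \<omega> *\<^sub>R abs_L2I (indicator (cell N k)))"
  by (simp only: wN abs_noise_field)

lemma wN_measurable:
  assumes "N \<ge> 1" "t \<in> {0..T}" shows "wN N t \<in> borel_measurable P"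
proof -
  have "(\<lambda>\<omega>. \<Sum>k\<in>{1..N}. \<xi> N k t \<omega> *\<^sub>R abs_L2I (indicator (cell N k))) \<in> borel_measurable P"
    by (intro borel_measurable_sum borel_measurable_scaleR \<xi>_square_integrable assms) auto
  then show ?thesis by (simp only: wN_finite_rank[OF assms, abs_def])
qed

lemma wN_wiener_bound:
  assumes N: "N \<ge> 1" and \<kappa>: "0 \<le> \<kappa>" and le: "mean_sq P (\<lambda>\<omega>. wN N T \<omega> - wN N 0 \<omega>) \<le> ennreal (\<kappa> * T)"
  shows "wiener_bound P T \<kappa> (wN N)"
proof (rule wiener_bound_finite_rank[where K="{1..N}" and \<xi>="\<xi> N" and q="\<lambda>k l. QN N (real k / real N) (real l / real N)"])
  show "(\<integral>\<omega>. \<xi> N k t \<omega> * \<xi> N l s \<omega> \<partial>P) = min t s * QN N (real k / real N) (real l / real N)"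
    if "k \<in> {1..N}" "l \<in> {1..N}" "t \<in> {0..T}" "s \<in> {0..T}" for k l t s
    using covariance[OF N that(3,4), of "real k / real N" "real l / real N"] that
    by (simp add: noise_field_at_node)
qed (use T \<kappa> le N \<xi>_square_integrable wN_finite_rank in auto)

lemma wN_uniformly_close:
  "\<epsilon> > 0 \<Longrightarrow> \<forall>\<^sub>F N in sequentially. \<forall>t\<in>{0..T}. mean_sq P (\<lambda>\<omega>. wN N t \<omega> - w t \<omega>) \<le> ennreal \<epsilon>"
  by (rule noise_uniformly_close[OF Cauchy wN_measurable w])

text \<open>
  By the Cauchy property the mean squares of \<open>w\<^sup>N T - w\<^sup>N 0\<close> are bounded in terms of the one for
  a single index \<open>M\<close>, and these numbers determine the constants of \<open>wN_wiener_bound\<close>.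
\<close>
lemma uniform_wiener_bound:
  "\<exists>\<kappa>. (\<forall>\<^sub>F N in sequentially. wiener_bound P T \<kappa> (wN N)) \<and> wiener_bound P T \<kappa> w"
proof -
  have T0: "0 \<in> {0..T}" "T \<in> {0..T}" using T by auto
  obtain N0 where N0: "\<And>N M t. N > M \<Longrightarrow> M > N0 \<Longrightarrow> t \<in> {0..T} \<Longrightarrow>
      mean_sq P (\<lambda>\<omega>. wN N t \<omega> - wN M t \<omega>) < ennreal 1"
    using Cauchy[OF zero_less_one] by blast
  define M where "M = Suc N0"
  have M: "M \<ge> 1" "M > N0" by (simp_all add: M_def)
  have "mean_sq P (\<lambda>\<omega>. wN M T \<omega> - wN M 0 \<omega>) < \<infinity>"
    by (rule mean_sq_increment_finite[where K="{1..M}" and f="\<lambda>k \<omega>. \<xi> M k T \<omega> - \<xi> M k 0 \<omega>"])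
      (use M T0 \<xi>_square_integrable in \<open>auto intro!: integrable_square_diff
        simp: wN_finite_rank scaleR_diff_left sum_subtractf\<close>)
  then obtain m where m: "mean_sq P (\<lambda>\<omega>. wN M T \<omega> - wN M 0 \<omega>) = ennreal m" "0 \<le> m"
    by (cases "mean_sq P (\<lambda>\<omega>. wN M T \<omega> - wN M 0 \<omega>)" rule: ennreal_cases) auto
  define \<kappa> where "\<kappa> = (2 + 2 * (2 * m + 2)) / T"
  have \<kappa>: "\<kappa> \<ge> 0" using m T by (simp add: \<kappa>_def)
  have bound: "wiener_bound P T \<kappa> (wN N)" if "N > M" for N
  proof (rule wN_wiener_bound)
    show "N \<ge> 1" using that by simp
    note meas = wN_measurable[OF \<open>N \<ge> 1\<close>] wN_measurable[OF M(1)]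
    have "mean_sq P (\<lambda>\<omega>. wN N T \<omega> - wN N 0 \<omega>)
        \<le> 2 * mean_sq P (\<lambda>\<omega>. wN N T \<omega> - wN M T \<omega>) + 2 * mean_sq P (\<lambda>\<omega>. wN M T \<omega> - wN N 0 \<omega>)"
      by (intro mean_sq_triangle meas T0)
    also have "\<dots> \<le> 2 * mean_sq P (\<lambda>\<omega>. wN N T \<omega> - wN M T \<omega>) + 2 * (2 * mean_sq P (\<lambda>\<omega>. wN M T \<omega> - wN M 0 \<omega>)
        + 2 * mean_sq P (\<lambda>\<omega>. wN M 0 \<omega> - wN N 0 \<omega>))"
      by (intro add_left_mono mult_left_mono mean_sq_triangle meas T0) simp
    also have "\<dots> \<le> 2 * 1 + 2 * (2 * ennreal m + 2 * 1)"
      using N0[OF that M(2) T0(2)] N0[OF that M(2) T0(1)] m(1)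
      by (intro add_mono mult_left_mono) (auto simp: mean_sq_commute[of P "wN M 0"] intro: less_imp_le)
    also have "\<dots> = ennreal (2 + 2 * (2 * m + 2))"
      using m(2) by (simp add: ennreal_plus ennreal_mult)
    finally show "mean_sq P (\<lambda>\<omega>. wN N T \<omega> - wN N 0 \<omega>) \<le> ennreal (\<kappa> * T)"
      using T by (simp add: \<kappa>_def)
  qed (rule \<kappa>)
  have "wiener_bound P T (2 * \<kappa>) w"
  proof (rule wiener_bound_limit[of P T \<kappa> "\<lambda>N. wN (N + Suc M)"])
    show "wiener_bound P T \<kappa> (wN (N + Suc M))" for N by (rule bound) simp
    show "msq_tendsto P (\<lambda>N. wN (N + Suc M) t) (w t)" if "t \<in> {0..T}" for t
      using w[OF that] LIMSEQ_ignore_initial_segment[of "\<lambda>N. mean_sq P (\<lambda>\<omega>. wN N t \<omega> - w t \<omega>)" 0 "Suc M"]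
      by (simp add: msq_tendsto_def)
  qed
  moreover have "\<forall>\<^sub>F N in sequentially. wiener_bound P T (2 * \<kappa>) (wN N)"
    using eventually_gt_at_top[of M] by eventually_elim (use \<kappa> in \<open>auto intro: wiener_bound_mono[OF bound]\<close>)
  ultimately show ?thesis by blast
qed

end

section \<open>Closed loops in mild form\<close>

lemma nn_integral_restrict_Icc:
  fixes t T :: real
  assumes "t \<le> T"
  shows "(\<integral>\<^sup>+s. f s * indicator {0..t} s \<partial>restrict_space lborel {0..T}) = (\<integral>\<^sup>+s. f s * indicator {0..t} s \<partial>lborel)"
proof -
  have "(\<integral>\<^sup>+s. f s * indicator {0..t} s * indicator {0..T} s \<partial>lborel) = (\<integral>\<^sup>+s. f s * indicator {0..t} s \<partial>lborel)"
    using assms by (intro nn_integral_cong) (simp add: indicator_def)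
  then show ?thesis by (subst nn_integral_restrict_space) simp_all
qed

text \<open>
  Holds for every \<open>f\<close>, as the integral of a nonintegrable function is 0.
\<close>
lemma norm_set_integral_le:
  fixes f :: "real \<Rightarrow> 'a::{banach, second_countable_topology}"
  assumes "t \<le> T"
  shows "ennreal (norm (LINT s:{0..t}|lborel. f s))
    \<le> (\<integral>\<^sup>+s. ennreal (norm (f s)) * indicator {0..t} s \<partial>restrict_space lborel {0..T})"
proof (cases "set_integrable lborel {0..t} f")
  case True
  then have "ennreal (norm (LINT s:{0..t}|lborel. f s)) \<le> (\<integral>\<^sup>+s. ennreal (norm (indicator {0..t} s *\<^sub>R f s)) \<partial>lborel)"
    unfolding set_lebesgue_integral_def set_integrable_def by (rule integral_norm_bound_ennreal)
  also have "\<dots> = (\<integral>\<^sup>+s. ennreal (norm (f s)) * indicator {0..t} s \<partial>lborel)"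
    by (intro nn_integral_cong) (auto split: split_indicator)
  finally show ?thesis by (simp add: nn_integral_restrict_Icc[OF assms])
next
  case False
  then show ?thesis
    by (simp add: set_lebesgue_integral_def set_integrable_def not_integrable_integral_eq)
qed

lemma set_integrable_Phi:
  fixes v :: "real \<Rightarrow> L2I" and A B :: "L2I \<Rightarrow>\<^sub>L L2I"
  assumes v: "set_integrable lborel {0..T} v" and t: "t \<in> {0..T}"
  shows "set_integrable lborel {0..t} (\<lambda>s. Phi A t s (B (v s)))"
proof -
  let ?v = "\<lambda>s. indicator {0..t} s *\<^sub>R v s"
  have "set_integrable lborel {0..t} v" using v by (rule set_integrable_subset) (use t in auto)
  then have int: "integrable lborel ?v" by (simp add: set_integrable_def)
  then have m: "(\<lambda>s. B (?v s)) \<in> borel_measurable lborel" by (intro blinfun_measurable) auto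
  have "integrable lborel (\<lambda>s. Phi A t s (B (?v s)))"
  proof (rule Bochner_Integration.integrable_bound)
    show "integrable lborel (\<lambda>s. (exp (T * norm A) * norm B) * norm (?v s))"
      using int by (intro integrable_mult_right integrable_norm)
    show "(\<lambda>s. Phi A t s (B (?v s))) \<in> borel_measurable lborel"
      by (rule borel_measurable_Phi_apply[OF m]) simp
    have "norm (Phi A t s (B (?v s))) \<le> exp (T * norm A) * norm B * norm (?v s)" for s
    proof (cases "s \<in> {0..t}")
      case True
      then have "norm (Phi A t s) \<le> exp (T * norm A)" using t by (intro norm_Phi_le) auto
      then show ?thesis unfolding mult.assoc
        by (intro order_trans[OF norm_blinfun] mult_mono norm_blinfun) auto
    qed simp
    then show "AE s in lborel. norm (Phi A t s (B (?v s))) \<le> norm ((exp (T * norm A) * norm B) * norm (?v s))"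
      by (intro AE_I2) (auto intro: order_trans[OF _ abs_ge_self])
  qed
  then show ?thesis by (simp add: set_integrable_def blinfun.scaleR_right)
qed

lemma set_integrable_restrict:
  "set_integrable lborel {0..T} f \<longleftrightarrow> integrable (restrict_space lborel {0..T}) f"
  for f :: "real \<Rightarrow> 'a::{banach, second_countable_topology}"
  by (simp add: set_integrable_def integrable_restrict_space)

text \<open>
  Picks a version of the stochastic convolution for each time. Nothing is known about its dependence on
  time, so joint measurability has to come from the state.
\<close>
lemma mild_solution_noise:
  assumes "mild_solution P T A B w x0 u x"
  obtains Z where "\<And>t. t \<in> {0..T} \<Longrightarrow> has_wiener_integral P w 0 t (Phi A t) (Z t)"
    and "\<And>t. t \<in> {0..T} \<Longrightarrow>
      AE \<omega> in P. x t \<omega> = Phi A t 0 x0 + (LINT s:{0..t}|lborel. Phi A t s (B (u s \<omega>))) + Z t \<omega>"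
proof -
  have "\<forall>t\<in>{0..T}. \<exists>Z. has_wiener_integral P w 0 t (Phi A t) Z \<and>
      (AE \<omega> in P. x t \<omega> = Phi A t 0 x0 + (LINT s:{0..t}|lborel. Phi A t s (B (u s \<omega>))) + Z \<omega>)"
    using assms unfolding mild_solution_def by (elim conjE)
  from bchoice[OF this] show ?thesis using that by blast
qed

text \<open>
  First use of the Gronwall inequality: \<open>Y t = norm (x t)\<close>, with the initial value and the stochastic
  convolution as inhomogeneity.
\<close>
lemma mild_solution_expected_path_integral_finite:
  fixes P :: "'w measure" and G :: "real \<Rightarrow> L2I \<Rightarrow>\<^sub>L L2I"
  assumes P: "prob_space P" and T: "T > 0"
    and sol: "mild_solution P T A B w x0 u x" and u: "\<And>t \<omega>. t \<in> {0..T} \<Longrightarrow> u t \<omega> = - G t (x t \<omega>)"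
    and G: "\<And>t. t \<in> {0..T} \<Longrightarrow> norm (G t) \<le> Kg" and w: "wiener_bound P T \<kappa> w"
  shows "(\<integral>\<^sup>+\<omega>. (\<integral>\<^sup>+t. ennreal (norm (x t \<omega>)) \<partial>restrict_space lborel {0..T}) \<partial>P) < \<infinity>"
proof -
  interpret prob_space P by (rule P)
  define C where "C = exp (T * norm A)"
  define L where "L = C * (norm B * \<bar>Kg\<bar>) + 1"
  have L: "L > 0" by (simp add: L_def C_def add_nonneg_pos)
  have \<kappa>: "0 \<le> \<kappa>" using w by (simp add: wiener_bound_def)
  from sol have xm: "(\<lambda>(t, \<omega>). x t \<omega>) \<in> borel_measurable (restrict_space borel {0..T} \<Otimes>\<^sub>M P)"
    and xi: "AE \<omega> in P. set_integrable lborel {0..T} (\<lambda>t. x t \<omega>)" by (auto simp: mild_solution_def)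
  obtain Z where Z: "\<And>t. t \<in> {0..T} \<Longrightarrow> has_wiener_integral P w 0 t (Phi A t) (Z t)"
    and x: "\<And>t. t \<in> {0..T} \<Longrightarrow> AE \<omega> in P. x t \<omega> = Phi A t 0 x0 + (LINT s:{0..t}|lborel. Phi A t s (B (u s \<omega>))) + Z t \<omega>"
    using mild_solution_noise[OF sol] by blast
  define \<rho> where "\<rho> = C * norm x0 + 2 * C * sqrt (\<kappa> * T)"
  interpret mean_gronwall P T L "\<lambda>t \<omega>. ennreal (norm (x t \<omega>))" "\<lambda>t \<omega>. ennreal (C * norm x0) + ennreal (norm (Z t \<omega>))" "ennreal \<rho>"
  proof
    show "(\<lambda>(t, \<omega>). ennreal (norm (x t \<omega>))) \<in> borel_measurable (restrict_space borel {0..T} \<Otimes>\<^sub>M P)"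
      using xm unfolding case_prod_beta' by measurable
    show "AE \<omega> in P. (\<integral>\<^sup>+t. ennreal (norm (x t \<omega>)) \<partial>restrict_space lborel {0..T}) < \<infinity>"
      using xi by eventually_elim (simp add: set_integrable_restrict integrable_iff_bounded)
    fix t assume t: "t \<in> {0..T}"
    have Zm: "Z t \<in> borel_measurable P" by (rule has_wiener_integral_measurable[OF Z[OF t]])
    then show "(\<lambda>\<omega>. ennreal (C * norm x0) + ennreal (norm (Z t \<omega>))) \<in> borel_measurable P" by measurable
    have "(\<integral>\<^sup>+\<omega>. ennreal (C * norm x0) + ennreal (norm (Z t \<omega>)) \<partial>P) = ennreal (C * norm x0) + (\<integral>\<^sup>+\<omega>. ennreal (norm (Z t \<omega>)) \<partial>P)"
      using Zm emeasure_space_1 by (subst nn_integral_add) auto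
    also have "\<dots> \<le> ennreal (C * norm x0) + ennreal (2 * C * sqrt (\<kappa> * T))"
      using expected_norm_wiener_integral_le[OF w t Z[OF t]] by (intro add_left_mono) (simp add: C_def)
    also have "\<dots> = ennreal \<rho>"
      unfolding \<rho>_def using \<kappa> T by (intro ennreal_plus[symmetric]) (auto simp: C_def)
    finally show "(\<integral>\<^sup>+\<omega>. ennreal (C * norm x0) + ennreal (norm (Z t \<omega>)) \<partial>P) \<le> ennreal \<rho>" .
    show "AE \<omega> in P. ennreal (norm (x t \<omega>)) \<le> ennreal L * (\<integral>\<^sup>+s. ennreal (norm (x s \<omega>)) * indicator {0..t} s \<partial>restrict_space lborel {0..T})
        + (ennreal (C * norm x0) + ennreal (norm (Z t \<omega>)))"
      using x[OF t] xi
    proof eventually_elim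
      case (elim \<omega>)
      let ?I = "LINT s:{0..t}|lborel. Phi A t s (B (u s \<omega>))"
      have "norm (x t \<omega>) \<le> norm (Phi A t 0 x0) + norm ?I + norm (Z t \<omega>)"
        unfolding elim(1) by (intro order_trans[OF norm_triangle_ineq] add_right_mono norm_triangle_ineq)
      also have "norm (Phi A t 0 x0) \<le> C * norm x0"
        unfolding C_def using t by (intro order_trans[OF norm_blinfun] mult_right_mono norm_Phi_le[of A "norm A"]) auto
      finally have "ennreal (norm (x t \<omega>)) \<le> ennreal (C * norm x0 + norm ?I + norm (Z t \<omega>))"
        by (simp add: ennreal_leI)
      also have "\<dots> = ennreal (norm ?I) + (ennreal (C * norm x0) + ennreal (norm (Z t \<omega>)))"
        by (simp add: C_def ennreal_plus add_ac)
      also have "ennreal (norm ?I) \<le> (\<integral>\<^sup>+s. ennreal (norm (Phi A t s (B (u s \<omega>)))) * indicator {0..t} s \<partial>restrict_space lborel {0..T})"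
        using t by (intro norm_set_integral_le) auto
      also have "\<dots> \<le> (\<integral>\<^sup>+s. ennreal L * (ennreal (norm (x s \<omega>)) * indicator {0..t} s) \<partial>restrict_space lborel {0..T})"
      proof (rule nn_integral_mono)
        fix s
        show "ennreal (norm (Phi A t s (B (u s \<omega>)))) * indicator {0..t} s \<le> ennreal L * (ennreal (norm (x s \<omega>)) * indicator {0..t} s)"
        proof (cases "s \<in> {0..t}")
          case True
          then have s: "s \<in> {0..T}" using t by auto
          have "norm (Phi A t s (B (u s \<omega>))) \<le> C * (norm B * (\<bar>Kg\<bar> * norm (x s \<omega>)))"
          proof (intro order_trans[OF norm_blinfun] mult_mono)
            show "norm (Phi A t s) \<le> C" unfolding C_def using True t by (intro norm_Phi_le) auto
            have "norm (G s) \<le> \<bar>Kg\<bar>" using G[OF s] by simp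
            then show "norm (u s \<omega>) \<le> \<bar>Kg\<bar> * norm (x s \<omega>)"
              unfolding u[OF s] norm_minus_cancel by (intro order_trans[OF norm_blinfun] mult_right_mono) auto
          qed (auto simp: C_def)
          also have "\<dots> \<le> L * norm (x s \<omega>)" by (simp add: L_def algebra_simps)
          finally show ?thesis using True L by (simp add: ennreal_mult[symmetric] ennreal_leI)
        qed simp
      qed
      also have "\<dots> = ennreal L * (\<integral>\<^sup>+s. ennreal (norm (x s \<omega>)) * indicator {0..t} s \<partial>restrict_space lborel {0..T})"
      proof (rule nn_integral_cmult)
        have [measurable]: "(\<lambda>s. x s \<omega>) \<in> borel_measurable (restrict_space lborel {0..T})"
          using elim(2) by (simp add: set_integrable_restrict)
        have [measurable]: "{0..t} \<inter> {0..T} \<in> sets (restrict_space lborel {0..T})"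
          by (auto simp: sets_restrict_space)
        have "(\<lambda>s. ennreal (norm (x s \<omega>)) * indicator ({0..t} \<inter> {0..T}) s) \<in> borel_measurable (restrict_space lborel {0..T})"
          by measurable
        then show "(\<lambda>s. ennreal (norm (x s \<omega>)) * indicator {0..t} s) \<in> borel_measurable (restrict_space lborel {0..T})"
          using t by (simp add: Int_absorb2)
      qed
      finally show ?case by (simp add: add_right_mono)
    qed
  qed (use T L in auto)
  have "(\<integral>\<^sup>+\<omega>. (\<integral>\<^sup>+t. ennreal (norm (x t \<omega>)) \<partial>restrict_space lborel {0..T}) \<partial>P) \<le> ennreal (2 * T * exp (2 * L * T)) * ennreal \<rho>"
    by (rule expected_path_integral_le)
  also have "\<dots> < \<infinity>" by (simp add: ennreal_mult_less_top)
  finally show ?thesis .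
qed

text \<open>
  Second use of the Gronwall inequality. The difference of the drifts splits as
  \<open>O\<^sub>1 x\<^sub>1 - O\<^sub>2 x\<^sub>2 = O\<^sub>1 (x\<^sub>1 - x\<^sub>2) + (O\<^sub>1 - O\<^sub>2) x\<^sub>2\<close> with \<open>O\<^sub>i = \<Phi>\<^sub>i B\<^sub>i G\<^sub>i\<close>. The first
  part is the Volterra term; the second one is small because the expected path integral of \<open>x\<^sub>2\<close>
  is finite.
\<close>
lemma mild_solution_expected_distance_le:
  fixes P :: "'w measure" and G1 G2 :: "real \<Rightarrow> L2I \<Rightarrow>\<^sub>L L2I"
  assumes P: "prob_space P" and T: "T > 0"
    and sol1: "mild_solution P T A1 B1 w1 x01 u1 x1" and sol2: "mild_solution P T A2 B2 w2 x02 u2 x2"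
    and u1: "\<And>t \<omega>. t \<in> {0..T} \<Longrightarrow> u1 t \<omega> = - G1 t (x1 t \<omega>)"
    and u2: "\<And>t \<omega>. t \<in> {0..T} \<Longrightarrow> u2 t \<omega> = - G2 t (x2 t \<omega>)"
    and L: "L > 0" and op1: "\<And>s t. \<lbrakk>0 \<le> s; s \<le> t; t \<le> T\<rbrakk> \<Longrightarrow> norm (Phi A1 t s o\<^sub>L (B1 o\<^sub>L G1 s)) \<le> L"
    and diff: "\<And>s t. \<lbrakk>0 \<le> s; s \<le> t; t \<le> T\<rbrakk> \<Longrightarrow>
      norm ((Phi A1 t s o\<^sub>L (B1 o\<^sub>L G1 s)) - (Phi A2 t s o\<^sub>L (B2 o\<^sub>L G2 s))) \<le> d" and d: "0 \<le> d"
    and init: "\<And>t. t \<in> {0..T} \<Longrightarrow> norm (Phi A1 t 0 x01 - Phi A2 t 0 x02) \<le> \<rho>0" and \<rho>0: "0 \<le> \<rho>0"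
    and noise: "\<And>t Z1 Z2. \<lbrakk>t \<in> {0..T}; has_wiener_integral P w1 0 t (Phi A1 t) Z1;
      has_wiener_integral P w2 0 t (Phi A2 t) Z2\<rbrakk> \<Longrightarrow> (\<integral>\<^sup>+\<omega>. ennreal (norm (Z1 \<omega> - Z2 \<omega>)) \<partial>P) \<le> ennreal \<rho>1"
    and \<rho>1: "0 \<le> \<rho>1"
    and i: "(\<integral>\<^sup>+\<omega>. (\<integral>\<^sup>+t. ennreal (norm (x2 t \<omega>)) \<partial>restrict_space lborel {0..T}) \<partial>P) \<le> ennreal i" "0 \<le> i"
    and t0: "t0 \<in> {0..T}"
  shows "(\<integral>\<^sup>+\<omega>. ennreal (norm (x1 t0 \<omega> - x2 t0 \<omega>)) \<partial>P)
    \<le> ennreal ((2 * L * T * exp (2 * L * T) + 1) * (\<rho>0 + d * i + \<rho>1))"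
proof -
  interpret prob_space P by (rule P)
  let ?\<mu> = "restrict_space lborel {0..T}"
  from sol1 have x1m: "(\<lambda>(t, \<omega>). x1 t \<omega>) \<in> borel_measurable (restrict_space borel {0..T} \<Otimes>\<^sub>M P)"
    and x1i: "AE \<omega> in P. set_integrable lborel {0..T} (\<lambda>t. x1 t \<omega>)"
    and u1i: "AE \<omega> in P. set_integrable lborel {0..T} (\<lambda>t. u1 t \<omega>)" by (auto simp: mild_solution_def)
  from sol2 have x2m: "(\<lambda>(t, \<omega>). x2 t \<omega>) \<in> borel_measurable (restrict_space borel {0..T} \<Otimes>\<^sub>M P)"
    and x2i: "AE \<omega> in P. set_integrable lborel {0..T} (\<lambda>t. x2 t \<omega>)"
    and u2i: "AE \<omega> in P. set_integrable lborel {0..T} (\<lambda>t. u2 t \<omega>)" by (auto simp: mild_solution_def)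
  obtain Z1 where Z1: "\<And>t. t \<in> {0..T} \<Longrightarrow> has_wiener_integral P w1 0 t (Phi A1 t) (Z1 t)"
    and x1: "\<And>t. t \<in> {0..T} \<Longrightarrow> AE \<omega> in P. x1 t \<omega> = Phi A1 t 0 x01 + (LINT s:{0..t}|lborel. Phi A1 t s (B1 (u1 s \<omega>))) + Z1 t \<omega>"
    using mild_solution_noise[OF sol1] by blast
  obtain Z2 where Z2: "\<And>t. t \<in> {0..T} \<Longrightarrow> has_wiener_integral P w2 0 t (Phi A2 t) (Z2 t)"
    and x2: "\<And>t. t \<in> {0..T} \<Longrightarrow> AE \<omega> in P. x2 t \<omega> = Phi A2 t 0 x02 + (LINT s:{0..t}|lborel. Phi A2 t s (B2 (u2 s \<omega>))) + Z2 t \<omega>"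
    using mild_solution_noise[OF sol2] by blast
  have sets_mu: "sets (restrict_space borel {0..T}) = sets ?\<mu>" by (simp add: sets_restrict_space)
  interpret mu: finite_measure ?\<mu>
    by (rule finite_measureI) (simp add: emeasure_restrict_space space_restrict_space emeasure_lborel_Icc_eq)
  let ?I = "\<lambda>\<omega>. \<integral>\<^sup>+s. ennreal (norm (x2 s \<omega>)) \<partial>?\<mu>"
  have Im: "?I \<in> borel_measurable P"
  proof (rule mu.borel_measurable_nn_integral)
    have "(\<lambda>(t, \<omega>). x2 t \<omega>) \<in> borel_measurable (?\<mu> \<Otimes>\<^sub>M P)"
      using x2m measurable_cong_sets[OF sets_pair_measure_cong[OF sets_mu refl] refl] by blast
    from measurable_compose[OF measurable_pair_swap' this]
    have [measurable]: "(\<lambda>p. x2 (snd p) (fst p)) \<in> borel_measurable (P \<Otimes>\<^sub>M ?\<mu>)"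
      by (simp add: case_prod_beta')
    show "(\<lambda>(\<omega>, s). ennreal (norm (x2 s \<omega>))) \<in> borel_measurable (P \<Otimes>\<^sub>M ?\<mu>)"
      unfolding case_prod_beta' by measurable
  qed
  define R where "R t \<omega> = ennreal \<rho>0 + (ennreal d * ?I \<omega> + ennreal (norm (Z1 t \<omega> - Z2 t \<omega>)))" for t \<omega>
  interpret mean_gronwall P T L "\<lambda>t \<omega>. ennreal (norm (x1 t \<omega> - x2 t \<omega>))" R "ennreal (\<rho>0 + d * i + \<rho>1)"
  proof
    show "(\<lambda>(t, \<omega>). ennreal (norm (x1 t \<omega> - x2 t \<omega>))) \<in> borel_measurable (restrict_space borel {0..T} \<Otimes>\<^sub>M P)"
      using x1m x2m unfolding case_prod_beta' by measurable
    show "AE \<omega> in P. (\<integral>\<^sup>+t. ennreal (norm (x1 t \<omega> - x2 t \<omega>)) \<partial>?\<mu>) < \<infinity>"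
      using x1i x2i
    proof eventually_elim
      case (elim \<omega>)
      then have "integrable ?\<mu> (\<lambda>t. x1 t \<omega> - x2 t \<omega>)" by (simp add: set_integrable_restrict)
      then show ?case by (simp add: integrable_iff_bounded)
    qed
    fix t assume t: "t \<in> {0..T}"
    note Zm[measurable] = has_wiener_integral_measurable[OF Z1[OF t]] has_wiener_integral_measurable[OF Z2[OF t]]
    note [measurable] = Im
    show "R t \<in> borel_measurable P" unfolding R_def[abs_def] by measurable
    have "(\<integral>\<^sup>+\<omega>. R t \<omega> \<partial>P) = ennreal \<rho>0 + (ennreal d * (\<integral>\<^sup>+\<omega>. ?I \<omega> \<partial>P) + (\<integral>\<^sup>+\<omega>. ennreal (norm (Z1 t \<omega> - Z2 t \<omega>)) \<partial>P))"
      unfolding R_def using emeasure_space_1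
      by (simp add: nn_integral_add nn_integral_cmult)
    also have "\<dots> \<le> ennreal \<rho>0 + (ennreal d * ennreal i + ennreal \<rho>1)"
      by (intro add_left_mono add_mono mult_left_mono i noise[OF t Z1[OF t] Z2[OF t]]) simp
    also have "\<dots> = ennreal (\<rho>0 + d * i + \<rho>1)"
      using \<rho>0 \<rho>1 d i(2) by (simp add: ennreal_plus ennreal_mult add.assoc)
    finally show "(\<integral>\<^sup>+\<omega>. R t \<omega> \<partial>P) \<le> ennreal (\<rho>0 + d * i + \<rho>1)" .
    show "AE \<omega> in P. ennreal (norm (x1 t \<omega> - x2 t \<omega>))
        \<le> ennreal L * (\<integral>\<^sup>+s. ennreal (norm (x1 s \<omega> - x2 s \<omega>)) * indicator {0..t} s \<partial>?\<mu>) + R t \<omega>"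
      using x1[OF t] x2[OF t] x1i x2i u1i u2i
    proof eventually_elim
      case (elim \<omega>)
      let ?f1 = "\<lambda>s. Phi A1 t s (B1 (u1 s \<omega>))" and ?f2 = "\<lambda>s. Phi A2 t s (B2 (u2 s \<omega>))"
      have "(LINT s:{0..t}|lborel. ?f1 s) - (LINT s:{0..t}|lborel. ?f2 s) = (LINT s:{0..t}|lborel. ?f1 s - ?f2 s)"
        by (rule set_integral_diff(2)[symmetric]) (intro set_integrable_Phi[OF _ t] elim)+
      then have "x1 t \<omega> - x2 t \<omega> = (Phi A1 t 0 x01 - Phi A2 t 0 x02) + (LINT s:{0..t}|lborel. ?f1 s - ?f2 s) + (Z1 t \<omega> - Z2 t \<omega>)"
        unfolding elim(1,2) by (simp add: algebra_simps)
      then have "norm (x1 t \<omega> - x2 t \<omega>) \<le> norm (Phi A1 t 0 x01 - Phi A2 t 0 x02) + norm (LINT s:{0..t}|lborel. ?f1 s - ?f2 s) + norm (Z1 t \<omega> - Z2 t \<omega>)"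
        by (simp only:) (intro order_trans[OF norm_triangle_ineq] add_right_mono norm_triangle_ineq)
      also have "norm (Phi A1 t 0 x01 - Phi A2 t 0 x02) \<le> \<rho>0" by (rule init[OF t])
      finally have "ennreal (norm (x1 t \<omega> - x2 t \<omega>)) \<le> ennreal (\<rho>0 + norm (LINT s:{0..t}|lborel. ?f1 s - ?f2 s) + norm (Z1 t \<omega> - Z2 t \<omega>))"
        by (simp add: ennreal_leI)
      also have "\<dots> = ennreal (norm (LINT s:{0..t}|lborel. ?f1 s - ?f2 s)) + (ennreal \<rho>0 + ennreal (norm (Z1 t \<omega> - Z2 t \<omega>)))"
        using \<rho>0 by (simp add: ennreal_plus add_ac)
      also have "ennreal (norm (LINT s:{0..t}|lborel. ?f1 s - ?f2 s))
          \<le> (\<integral>\<^sup>+s. ennreal (norm (?f1 s - ?f2 s)) * indicator {0..t} s \<partial>?\<mu>)"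
        using t by (intro norm_set_integral_le) auto
      also have "\<dots> \<le> (\<integral>\<^sup>+s. ennreal L * (ennreal (norm (x1 s \<omega> - x2 s \<omega>)) * indicator {0..t} s) + ennreal d * ennreal (norm (x2 s \<omega>)) \<partial>?\<mu>)"
      proof (rule nn_integral_mono)
        fix s
        show "ennreal (norm (?f1 s - ?f2 s)) * indicator {0..t} s
            \<le> ennreal L * (ennreal (norm (x1 s \<omega> - x2 s \<omega>)) * indicator {0..t} s) + ennreal d * ennreal (norm (x2 s \<omega>))"
        proof (cases "s \<in> {0..t}")
          case True
          then have s: "s \<in> {0..T}" "0 \<le> s" "s \<le> t" "t \<le> T" using t by auto
          let ?O1 = "Phi A1 t s o\<^sub>L (B1 o\<^sub>L G1 s)" and ?O2 = "Phi A2 t s o\<^sub>L (B2 o\<^sub>L G2 s)"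
          have "?f1 s - ?f2 s = - (?O1 (x1 s \<omega> - x2 s \<omega>) + (?O1 - ?O2) (x2 s \<omega>))"
            by (simp add: u1[OF s(1)] u2[OF s(1)] blinfun.bilinear_simps)
          also have "norm \<dots> \<le> L * norm (x1 s \<omega> - x2 s \<omega>) + d * norm (x2 s \<omega>)"
            unfolding norm_minus_cancel
            by (intro order_trans[OF norm_triangle_ineq] add_mono order_trans[OF norm_blinfun] mult_right_mono
                op1[OF s(2-4)] diff[OF s(2-4)] norm_ge_zero)
          finally have "ennreal (norm (?f1 s - ?f2 s)) \<le> ennreal (L * norm (x1 s \<omega> - x2 s \<omega>) + d * norm (x2 s \<omega>))"
            by (rule ennreal_leI)
          also have "\<dots> = ennreal L * ennreal (norm (x1 s \<omega> - x2 s \<omega>)) + ennreal d * ennreal (norm (x2 s \<omega>))"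
            using L d by (simp add: ennreal_plus ennreal_mult)
          finally show ?thesis using True by simp
        qed simp
      qed
      also have "\<dots> = ennreal L * (\<integral>\<^sup>+s. ennreal (norm (x1 s \<omega> - x2 s \<omega>)) * indicator {0..t} s \<partial>?\<mu>) + ennreal d * ?I \<omega>"
      proof -
        have [measurable]: "(\<lambda>s. x1 s \<omega>) \<in> borel_measurable ?\<mu>" "(\<lambda>s. x2 s \<omega>) \<in> borel_measurable ?\<mu>"
          using elim(3,4) by (simp_all add: set_integrable_restrict)
        have "{0..t} \<inter> {0..T} \<in> sets ?\<mu>" by (auto simp: sets_restrict_space)
        then have [measurable]: "{0..t} \<in> sets ?\<mu>" using t by (simp add: Int_absorb2)
        show ?thesis by (simp add: nn_integral_add nn_integral_cmult)
      qed
      finally show ?case by (simp add: R_def add_ac add_left_mono)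
    qed
  qed (use T L in auto)
  have "ennreal (2 * L * T * exp (2 * L * T) + 1) * ennreal (\<rho>0 + d * i + \<rho>1)
      = ennreal ((2 * L * T * exp (2 * L * T) + 1) * (\<rho>0 + d * i + \<rho>1))"
    by (rule ennreal_mult[symmetric]) (use L T \<rho>0 \<rho>1 d i(2) in auto)
  then show ?thesis using expected_value_le[OF t0] by (simp only:)
qed

text \<open>
  The drift operators \<open>\<Phi>(t,s) B (G s)\<close> converge uniformly in both times. The bound \<open>L\<close> is fixed before the
  accuracy \<open>d\<close>, so the Gronwall constant does not depend on the latter.
\<close>
lemma closed_loop_operator_limit:
  fixes AN BN :: "nat \<Rightarrow> L2I \<Rightarrow>\<^sub>L L2I" and GN :: "nat \<Rightarrow> real \<Rightarrow> L2I \<Rightarrow>\<^sub>L L2I"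
  assumes T: "T > 0" and A: "AN \<longlonglongrightarrow> A" and B: "BN \<longlonglongrightarrow> B"
    and G: "uniform_limit {0..T} GN G sequentially" and Kg: "\<And>t. t \<in> {0..T} \<Longrightarrow> norm (G t) \<le> Kg"
  shows "\<exists>L>0. \<forall>d>0. \<forall>\<^sub>F N in sequentially. \<forall>s t. 0 \<le> s \<and> s \<le> t \<and> t \<le> T \<longrightarrow>
    norm (Phi (AN N) t s o\<^sub>L (BN N o\<^sub>L GN N s)) \<le> L \<and>
    norm ((Phi (AN N) t s o\<^sub>L (BN N o\<^sub>L GN N s)) - (Phi A t s o\<^sub>L (B o\<^sub>L G s))) \<le> d"
proof -
  define c where "c = norm A + 1"
  define C where "C = exp (T * c)"
  define cb where "cb = norm B + 1"
  define cg where "cg = \<bar>Kg\<bar> + 1"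
  define L where "L = C * (cb * cg)"
  have pos: "C > 0" "cb > 0" "cg > 0" "c > 0" by (simp_all add: C_def cb_def cg_def c_def add_nonneg_pos)
  have "\<forall>\<^sub>F N in sequentially. \<forall>s t. 0 \<le> s \<and> s \<le> t \<and> t \<le> T \<longrightarrow>
    norm (Phi (AN N) t s o\<^sub>L (BN N o\<^sub>L GN N s)) \<le> L \<and>
    norm ((Phi (AN N) t s o\<^sub>L (BN N o\<^sub>L GN N s)) - (Phi A t s o\<^sub>L (B o\<^sub>L G s))) \<le> d" if d: "d > 0" for d
  proof -
    define a where "a N = C * (T * norm (AN N - A)) * (cb * cg)" for N
    define b where "b N = C * (norm (BN N - B) * cg)" for N
    have "a \<longlonglongrightarrow> C * (T * norm (A - A)) * (cb * cg)" unfolding a_def by (intro tendsto_intros A)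
    then have "\<forall>\<^sub>F N in sequentially. a N < d / 3" by (rule order_tendstoD) (use d in simp)
    moreover have "b \<longlonglongrightarrow> C * (norm (B - B) * cg)" unfolding b_def by (intro tendsto_intros B)
    then have "\<forall>\<^sub>F N in sequentially. b N < d / 3" by (rule order_tendstoD) (use d in simp)
    moreover have "\<forall>\<^sub>F N in sequentially. \<forall>t\<in>{0..T}. dist (GN N t) (G t) < min 1 (d / (3 * (C * cb)))"
      by (rule uniform_limitD[OF G]) (use d pos in simp)
    ultimately show ?thesis
      using eventually_norm_le_plus_1[OF A] eventually_norm_le_plus_1[OF B]
    proof eventually_elim
      case (elim N)
      show ?case
      proof (intro allI impI)
        fix s t assume st: "0 \<le> s \<and> s \<le> t \<and> t \<le> T"
        then have s: "s \<in> {0..T}" by auto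
        let ?PN = "Phi (AN N) t s" and ?P = "Phi A t s"
        have PN: "norm ?PN \<le> C" and P: "norm ?P \<le> C"
          using st elim(4) unfolding C_def by (auto intro!: norm_Phi_le simp: c_def)
        have PP: "norm (?PN - ?P) \<le> C * (T * norm (AN N - A))"
          using st elim(4) unfolding C_def by (intro norm_Phi_diff_le) (auto simp: c_def)
        have GG: "norm (GN N s - G s) \<le> 1" "norm (GN N s - G s) \<le> d / (3 * (C * cb))"
          using elim(3) s by (auto simp: dist_norm intro: less_imp_le)
        have BN: "norm (BN N) \<le> cb" "norm B \<le> cb" using elim(5) by (simp_all add: cb_def)
        have GNs: "norm (GN N s) \<le> cg"
          using norm_triangle_ineq[of "GN N s - G s" "G s"] GG(1) Kg[OF s] by (simp add: cg_def)
        have "norm (?PN o\<^sub>L (BN N o\<^sub>L GN N s)) \<le> L"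
          unfolding L_def by (rule norm_compose3_le[OF PN BN(1) GNs])
        moreover have "norm ((?PN o\<^sub>L (BN N o\<^sub>L GN N s)) - (?P o\<^sub>L (B o\<^sub>L G s))) \<le> d"
        proof -
          have "(?PN o\<^sub>L (BN N o\<^sub>L GN N s)) - (?P o\<^sub>L (B o\<^sub>L G s))
              = ((?PN - ?P) o\<^sub>L (BN N o\<^sub>L GN N s)) + ((?P o\<^sub>L ((BN N - B) o\<^sub>L GN N s)) + (?P o\<^sub>L (B o\<^sub>L (GN N s - G s))))"
            by (rule blinfun_eqI) (simp add: blinfun.bilinear_simps)
          also have "norm \<dots> \<le> C * (T * norm (AN N - A)) * (cb * cg)
              + (C * (norm (BN N - B) * cg) + C * (cb * (d / (3 * (C * cb)))))"
            by (intro order_trans[OF norm_triangle_ineq] add_mono norm_compose3_le PP PN P BN GNs GG order_refl)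
          also have "C * (cb * (d / (3 * (C * cb)))) = d / 3"
            using pos by (simp add: field_simps)
          finally show ?thesis using elim(1,2) unfolding a_def b_def by linarith
        qed
        ultimately show "norm (?PN o\<^sub>L (BN N o\<^sub>L GN N s)) \<le> L \<and>
            norm ((?PN o\<^sub>L (BN N o\<^sub>L GN N s)) - (?P o\<^sub>L (B o\<^sub>L G s))) \<le> d" ..
      qed
    qed
  qed
  moreover have "L > 0" using pos by (simp add: L_def)
  ultimately show ?thesis by blast
qed

lemma Phi_initial_limit:
  assumes T: "T > 0" and A: "AN \<longlonglongrightarrow> A" and x0: "x0N \<longlonglongrightarrow> x0" and \<epsilon>: "\<epsilon> > 0"
  shows "\<forall>\<^sub>F N in sequentially. \<forall>t\<in>{0..T}. norm (Phi (AN N) t 0 (x0N N) - Phi A t 0 x0) \<le> \<epsilon>"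
proof -
  define c where "c = norm A + 1"
  define C where "C = exp (T * c)"
  define a where "a N = C * norm (x0N N - x0) + C * (T * norm (AN N - A)) * norm x0" for N
  have "a \<longlonglongrightarrow> C * norm (x0 - x0) + C * (T * norm (A - A)) * norm x0"
    unfolding a_def by (intro tendsto_intros A x0)
  then have "\<forall>\<^sub>F N in sequentially. a N < \<epsilon>" by (rule order_tendstoD) (use \<epsilon> in simp)
  then show ?thesis
    using eventually_norm_le_plus_1[OF A]
  proof eventually_elim
    case (elim N)
    show ?case
    proof
      fix t assume t: "t \<in> {0..T}"
      have "Phi (AN N) t 0 (x0N N) - Phi A t 0 x0 = Phi (AN N) t 0 (x0N N - x0) + (Phi (AN N) t 0 - Phi A t 0) x0"
        by (simp add: blinfun.bilinear_simps)
      also have "norm \<dots> \<le> a N"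
        unfolding a_def C_def using t elim(2)
        by (intro order_trans[OF norm_triangle_ineq] add_mono order_trans[OF norm_blinfun] mult_right_mono
            norm_Phi_le norm_Phi_diff_le) (auto simp: c_def)
      finally show "norm (Phi (AN N) t 0 (x0N N) - Phi A t 0 x0) \<le> \<epsilon>" using elim(1) by simp
    qed
  qed
qed

section \<open>Convergence of the optimally controlled states\<close>

theorem theorem3p3:
  fixes P :: "'w measure" and T :: real
    and A B :: "real \<Rightarrow> real \<Rightarrow> real" and a b :: real
    and AN BN :: "nat \<Rightarrow> real \<Rightarrow> real \<Rightarrow> real" and aN bN :: "nat \<Rightarrow> real"
    and AA BB RR MM MT :: "L2I \<Rightarrow>\<^sub>L L2I"
    and AAN BBN RRN MMN MTN :: "nat \<Rightarrow> L2I \<Rightarrow>\<^sub>L L2I"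
    and W :: "nat \<Rightarrow> real \<Rightarrow> 'w \<Rightarrow> real" and c :: "nat \<Rightarrow> nat \<Rightarrow> nat \<Rightarrow> real"
    and \<xi> :: "nat \<Rightarrow> nat \<Rightarrow> real \<Rightarrow> 'w \<Rightarrow> real"
    and wN :: "nat \<Rightarrow> real \<Rightarrow> 'w \<Rightarrow> L2I" and w :: "real \<Rightarrow> 'w \<Rightarrow> L2I"
    and Q :: "real \<Rightarrow> real \<Rightarrow> real" and QN :: "nat \<Rightarrow> real \<Rightarrow> real \<Rightarrow> real"
    and x0 :: L2I and x0N :: "nat \<Rightarrow> L2I"
    and S :: "real \<Rightarrow> L2I \<Rightarrow>\<^sub>L L2I" and SN :: "nat \<Rightarrow> real \<Rightarrow> L2I \<Rightarrow>\<^sub>L L2I"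
    and u x :: "real \<Rightarrow> 'w \<Rightarrow> L2I" and uN xN :: "nat \<Rightarrow> real \<Rightarrow> 'w \<Rightarrow> L2I"
  assumes "prob_space P" and "T > 0"
    and "graphon A" and "AA = kernel_op A + a *\<^sub>R id_blinfun"
    and "graphon B" and "BB = kernel_op B + b *\<^sub>R id_blinfun"
    and "\<forall>N\<ge>1. graphon (AN N) \<and> step_kernel N (AN N) \<and> AAN N = kernel_op (AN N) + aN N *\<^sub>R id_blinfun"
    and "\<forall>N\<ge>1. graphon (BN N) \<and> step_kernel N (BN N) \<and> BBN N = kernel_op (BN N) + bN N *\<^sub>R id_blinfun"
    and "AAN \<longlonglongrightarrow> AA" and "BBN \<longlonglongrightarrow> BB"
    and "independent_brownian_motions P W {1..}"
    and "\<forall>N\<ge>1. \<forall>k\<in>{1..N}. \<forall>t\<in>{0..T}.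
           msq_tendsto P (\<lambda>n \<omega>. \<Sum>r=1..n. c N k r * W r t \<omega>) (\<xi> N k t)"
    and "\<forall>N\<ge>1. \<forall>t\<in>{0..T}. \<forall>\<omega>. wN N t \<omega> = abs_L2I (noise_field N (\<xi> N) t \<omega>)"
    and "\<forall>N\<ge>1. step_kernel N (QN N) \<and>
           (\<forall>t\<in>{0..T}. \<forall>s\<in>{0..T}. \<forall>\<alpha>\<in>{0..1}. \<forall>\<beta>\<in>{0..1}.
             (\<integral>\<omega>. noise_field N (\<xi> N) t \<omega> \<alpha> * noise_field N (\<xi> N) s \<omega> \<beta> \<partial>P) = min t s * QN N \<alpha> \<beta>)"
    and "\<forall>t\<in>{0..T}. msq_tendsto P (\<lambda>N. wN N t) (w t)"
    and "L2_kernel Q"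
    and "\<forall>t\<in>{0..T}. \<forall>s\<in>{0..T}. \<forall>f g.
           (\<integral>\<omega>. inner (w t \<omega>) f * inner (w s \<omega>) g \<partial>P) = min t s * inner f (kernel_op Q g)"
    and "(\<lambda>N. kernel_op (QN N)) \<longlonglongrightarrow> kernel_op Q"
    and "x0N \<longlonglongrightarrow> x0"
    and "\<forall>\<epsilon>0>0. \<forall>\<epsilon>1>0. \<forall>\<epsilon>2>0. \<exists>N0. \<forall>N M. N > M \<and> M > N0 \<longrightarrow>
           (norm (x0N N - x0N M))\<^sup>2 < \<epsilon>0 \<and>
           (\<forall>s t. 0 \<le> s \<and> s \<le> t \<and> t \<le> T \<longrightarrow>
              (norm (Phi (AAN N) t s - Phi (AAN M) t s))\<^sup>2 < \<epsilon>1 \<and>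
              mean_sq P (\<lambda>\<omega>. wN N t \<omega> - wN M t \<omega>) < ennreal \<epsilon>2)"
    and "\<exists>\<alpha> C :: real. \<forall>N\<ge>1. (\<Sum>k=1..N. \<Sum>r=1..N. \<bar>c N k r\<bar>\<^sup>2) \<le> C \<and>
           (\<forall>t\<in>{0..T}. (LINT s:{0..t}|lborel. (norm (Phi (AAN N) t s))\<^sup>2) \<le> \<alpha>)"
    and "nonneg_plus_scalar RR" and "nonneg_op MM" and "nonneg_op MT"
    and "\<forall>N\<ge>1. nonneg_plus_scalar (RRN N) \<and> nonneg_op (MMN N) \<and> nonneg_op (MTN N)"
    and "RRN \<longlonglongrightarrow> RR" and "MMN \<longlonglongrightarrow> MM" and "MTN \<longlonglongrightarrow> MT"
    and "riccati_solution T AA BB RR MM MT S"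
    and "\<forall>N\<ge>1. riccati_solution T (AAN N) (BBN N) (RRN N) (MMN N) (MTN N) (SN N)"
    and "\<forall>t\<in>{0..T}. \<forall>\<omega>. u t \<omega> = - feedback BB RR (S t) (x t \<omega>)"
    and "\<forall>N\<ge>1. \<forall>t\<in>{0..T}. \<forall>\<omega>. uN N t \<omega> = - feedback (BBN N) (RRN N) (SN N t) (xN N t \<omega>)"
    and "mild_solution P T AA BB w x0 u x"
    and "\<forall>N\<ge>1. mild_solution P T (AAN N) (BBN N) (wN N) (x0N N) (uN N) (xN N)"
  shows "\<forall>\<epsilon>>0. \<exists>N0. \<forall>N>N0. \<forall>t\<in>{0..T}.
           (\<integral>\<^sup>+\<omega>. ennreal (norm (xN N t \<omega> - x t \<omega>)) \<partial>P) < ennreal \<epsilon>"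
proof -
  interpret P: prob_space P by (rule assms(1))
  have T: "T > 0" by (rule assms(2))
  have saA: "self_adjoint_op AA" and saB: "self_adjoint_op BB"
    using self_adjoint_graphon assms(3-6) by auto
  have saN: "self_adjoint_op (AAN N) \<and> self_adjoint_op (BBN N)" if "N \<ge> 1" for N
    using self_adjoint_graphon assms(7,8) that by metis
  obtain r where R: "coercive_op r RR" using nonneg_plus_scalar_coercive[OF assms(22)] by blast
  have RN: "\<exists>r. coercive_op r (RRN N)" if "N \<ge> 1" for N
    using assms(25) that nonneg_plus_scalar_coercive by blast

  interpret noise: step_noise P T W c \<xi> QN wN w
  proof
    show "\<exists>N0. \<forall>N M. N > M \<and> M > N0 \<longrightarrow>
        (\<forall>t\<in>{0..T}. mean_sq P (\<lambda>\<omega>. wN N t \<omega> - wN M t \<omega>) < ennreal \<epsilon>)" if \<epsilon>: "\<epsilon> > 0" for \<epsilon>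
    proof -
      obtain N0 where "\<forall>N M. N > M \<and> M > N0 \<longrightarrow>
          (norm (x0N N - x0N M))\<^sup>2 < 1 \<and>
          (\<forall>s t. 0 \<le> s \<and> s \<le> t \<and> t \<le> T \<longrightarrow>
            (norm (Phi (AAN N) t s - Phi (AAN M) t s))\<^sup>2 < 1 \<and>
            mean_sq P (\<lambda>\<omega>. wN N t \<omega> - wN M t \<omega>) < ennreal \<epsilon>)"
        using assms(20)[rule_format, OF zero_less_one zero_less_one \<epsilon>] by blast
      then have "\<forall>N M. N > M \<and> M > N0 \<longrightarrow>
          (\<forall>t\<in>{0..T}. mean_sq P (\<lambda>\<omega>. wN N t \<omega> - wN M t \<omega>) < ennreal \<epsilon>)"
        by (meson atLeastAtMost_iff order_refl)
      then show ?thesis ..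
    qed
    show "brownian_motion P (W r)" if "r \<in> {1..}" for r
      using assms(11) that unfolding independent_brownian_motions_def by blast
  qed (use T assms(12-15) in \<open>blast+\<close>)
  obtain \<kappa> where \<kappa>N: "\<forall>\<^sub>F N in sequentially. wiener_bound P T \<kappa> (wN N)" and \<kappa>: "wiener_bound P T \<kappa> w"
    using noise.uniform_wiener_bound by blast

  interpret riccati T AA BB RR MM MT S r
    by unfold_locales (use T saA saB R assms(29) in auto)
  define G where "G t = gain BB RR (S t)" for t
  define GN where "GN N t = gain (BBN N) (RRN N) (SN N t)" for N t
  have u: "u t \<omega> = - G t (x t \<omega>)" if "t \<in> {0..T}" for t \<omega>
    using assms(31) that by (simp add: G_def feedback_eq_gain[OF R saB])
  have uN: "uN N t \<omega> = - GN N t (xN N t \<omega>)" if N: "N \<ge> 1" and t: "t \<in> {0..T}" for N t \<omega>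
  proof -
    obtain r' where "coercive_op r' (RRN N)" using RN[OF N] by blast
    then show ?thesis using assms(32) N t saN[OF N] by (simp add: GN_def feedback_eq_gain)
  qed
  have G_lim: "uniform_limit {0..T} GN G sequentially"
    unfolding GN_def[abs_def] G_def[abs_def]
  proof (rule gain_uniform_limit[OF assms(9,10,26-28)])
    show "riccati T AA BB RR MM MT S r" by unfold_locales
    show "\<forall>\<^sub>F N in sequentially. self_adjoint_op (AAN N) \<and> self_adjoint_op (BBN N) \<and>
        riccati_solution T (AAN N) (BBN N) (RRN N) (MMN N) (MTN N) (SN N)"
      using eventually_ge_at_top[of 1] by eventually_elim (use saN assms(30) in blast)
  qed
  obtain K where K: "\<And>t. t \<in> {0..T} \<Longrightarrow> norm (S t) \<le> K" using solution_bounded by blast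
  define Kg where "Kg = norm (op_inverse RR) * (norm BB * K)"
  have Kg: "norm (G t) \<le> Kg" if "t \<in> {0..T}" for t
    unfolding G_def gain_def Kg_def by (rule norm_compose3_le) (use K[OF that] in auto)
  obtain L where L: "L > 0" and op_lim: "\<And>d. d > 0 \<Longrightarrow> \<forall>\<^sub>F N in sequentially. \<forall>s t. 0 \<le> s \<and> s \<le> t \<and> t \<le> T \<longrightarrow>
      norm (Phi (AAN N) t s o\<^sub>L (BBN N o\<^sub>L GN N s)) \<le> L \<and>
      norm ((Phi (AAN N) t s o\<^sub>L (BBN N o\<^sub>L GN N s)) - (Phi AA t s o\<^sub>L (BB o\<^sub>L G s))) \<le> d"
    using closed_loop_operator_limit[OF T assms(9,10) G_lim Kg] by blast
  obtain i where i: "(\<integral>\<^sup>+\<omega>. (\<integral>\<^sup>+t. ennreal (norm (x t \<omega>)) \<partial>restrict_space lborel {0..T}) \<partial>P) = ennreal i" "0 \<le> i"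
    using mild_solution_expected_path_integral_finite[OF assms(1) T assms(33) u Kg \<kappa>]
    by (cases "\<integral>\<^sup>+\<omega>. (\<integral>\<^sup>+t. ennreal (norm (x t \<omega>)) \<partial>restrict_space lborel {0..T}) \<partial>P" rule: ennreal_cases) auto

  show ?thesis
  proof (intro allI impI)
    fix \<epsilon> :: real assume \<epsilon>: "\<epsilon> > 0"
    \<comment> \<open>\<open>F\<close> is the Gronwall factor. Initial values, drifts and noise may each contribute \<open>\<rho>\<close>, and \<open>3 F \<rho> < \<epsilon>\<close>.\<close>
    define F where "F = 2 * L * T * exp (2 * L * T) + 1"
    define \<rho> where "\<rho> = \<epsilon> / (4 * F)"
    \<comment> \<open>The denominator \<open>i + 1\<close> avoids a division by zero when the limit state vanishes.\<close>
    define d where "d = \<rho> / (i + 1)"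
    have F: "F > 0" using L T by (simp add: F_def add_nonneg_pos)
    have \<rho>: "\<rho> > 0" using \<epsilon> F by (simp add: \<rho>_def)
    have d: "d > 0" using \<rho> i(2) by (simp add: d_def)
    have di: "d * i \<le> \<rho>" using \<rho> i(2) by (simp add: d_def field_simps)
    have noise_lim: "\<forall>\<^sub>F N in sequentially. \<forall>t\<in>{0..T}. \<forall>ZN Z.
        has_wiener_integral P (wN N) 0 t (Phi (AAN N) t) ZN \<longrightarrow>
        has_wiener_integral P w 0 t (Phi AA t) Z \<longrightarrow>
        (\<integral>\<^sup>+\<omega>. ennreal (norm (ZN \<omega> - Z \<omega>)) \<partial>P) \<le> ennreal \<rho>"
      by (rule wiener_integral_convergence[OF assms(1) T \<kappa>N \<kappa> assms(9) _ \<rho>])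
        (rule noise.wN_uniformly_close)
    have "\<forall>\<^sub>F N in sequentially. \<forall>t\<in>{0..T}. (\<integral>\<^sup>+\<omega>. ennreal (norm (xN N t \<omega> - x t \<omega>)) \<partial>P) < ennreal \<epsilon>"
      using op_lim[OF d] Phi_initial_limit[OF T assms(9,19) \<rho>]
        noise_lim
        eventually_ge_at_top[of 1]
    proof eventually_elim
      case (elim N)
      show ?case
      proof
        fix t assume t: "t \<in> {0..T}"
        have "(\<integral>\<^sup>+\<omega>. ennreal (norm (xN N t \<omega> - x t \<omega>)) \<partial>P) \<le> ennreal (F * (\<rho> + d * i + \<rho>))"
          unfolding F_def
        proof (rule mild_solution_expected_distance_le[OF assms(1) T _ assms(33) uN[OF elim(4)] u L])
          show "mild_solution P T (AAN N) (BBN N) (wN N) (x0N N) (uN N) (xN N)"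
            using assms(34) elim(4) by blast
        qed (use elim t d \<rho> i in auto)
        also have "\<dots> < ennreal \<epsilon>"
        proof (rule ennreal_lessI[OF \<epsilon>])
          have "F * (\<rho> + d * i + \<rho>) \<le> F * (3 * \<rho>)"
            using di F by (intro mult_left_mono) auto
          also have "\<dots> = 3 / 4 * \<epsilon>" using F by (simp add: \<rho>_def)
          also have "\<dots> < \<epsilon>" using \<epsilon> by simp
          finally show "F * (\<rho> + d * i + \<rho>) < \<epsilon>" .
        qed
        finally show "(\<integral>\<^sup>+\<omega>. ennreal (norm (xN N t \<omega> - x t \<omega>)) \<partial>P) < ennreal \<epsilon>" .
      qed
    qed
    then obtain N0 where "\<forall>N\<ge>N0. \<forall>t\<in>{0..T}. (\<integral>\<^sup>+\<omega>. ennreal (norm (xN N t \<omega> - x t \<omega>)) \<partial>P) < ennreal \<epsilon>"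
      unfolding eventually_sequentially by blast
    then show "\<exists>N0. \<forall>N>N0. \<forall>t\<in>{0..T}. (\<integral>\<^sup>+\<omega>. ennreal (norm (xN N t \<omega> - x t \<omega>)) \<partial>P) < ennreal \<epsilon>"
      by (intro exI[of _ N0]) (simp add: less_imp_le)
  qed
qed

end
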